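(* Let $M\ne\mathbb S^2$ be a closed surface of genus $g\geq 1$ (orientable or non-orientable) and let $n\ge 1$. For any permutation $\tau\in S_n$ there is an automorphism of $P_n(M)$ whose induced automorphism on the abelianization $P_n(M)^{Ab}$ sends (the class of) $\rho_{i,r}$ to (the class of) $\rho_{\tau(i),r}$, for all $1\le i\le n$ and all $1\le r\le 2g$ if $M$ is orientable (resp. all $1\le r\le g$ if $M$ is non-orientable).
   Context: Surfaces are connected. $F_n(M)=\{(x_1,\dots,x_n)\in M^n : x_i\neq x_j\text{ for }i\neq j\}$ and $P_n(M)=\pi_1(F_n(M),Q)$ with base point $Q=(q_1,\dots,q_n)$. $M$ is viewed as a polygon with edges identified in pairs. If $M$ is orientable of genus $g$, it is a $4g$-gon with consecutive edges $\epsilon_1,\dots,\epsilon_{2g},\epsilon_1,\dots,\epsilon_{2g}$, opposite edges being identified by translation. If $M$ is non-orientable of genus $g$, it is a $2g$-gon with consecutive edges $\epsilon_1,\dots,\epsilon_g,\epsilon_1,\dots,\epsilon_g$, opposite edges $\epsilon_1,\dots,\epsilon_{g-1}$ being identified by translation and the edges $\epsilon_g$ with the reversed orientation. The base points $q_1,\dots,q_n$ lie in order on a segment in the interior of the polygon. The pure braid $\rho_{i,r}\in P_n(M)$ is the one whose $i$-th string is the only non-trivial one, this string being a loop based at $q_i$ that leaves the polygon exactly once, through the edge $\epsilon_r$, and returns to $q_i$ from the other copy of $\epsilon_r$, avoiding the other base points. The direction of crossing is chosen, for each $r$, independently of $i$. (It is known that the classes of the $\rho_{i,r}$ generate $P_n(M)^{Ab}$,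 which is isomorphic to $\mathbb Z^{2gn}$ in the orientable case and to $\mathbb Z_2^n\oplus\mathbb Z^{(g-1)n}$ in the non-orientable case, and the class of $\rho_{i,r}$ in $P_n(M)^{Ab}\cong H_1(M)^n$ is the class of that loop in the $i$-th factor.) *)

theory Defs
  imports
    "HOL-Analysis.Analysis"
    "HOL-Algebra.Generated_Groups"
    "HOL-Algebra.Bij"
    "HOL-Combinatorics.Permutations"
begin

section \<open>The fundamental group\<close>

definition loops_at :: "'a::topological_space set \<Rightarrow> 'a \<Rightarrow> (real \<Rightarrow> 'a) set" where
  "loops_at X x = {c. path c \<and> path_image c \<subseteq> X \<and> pathstart c = x \<and> pathfinish c = x}"

definition path_class :: "'a::topological_space set \<Rightarrow> (real \<Rightarrow> 'a) \<Rightarrow> (real \<Rightarrow> 'a) set" where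
  "path_class X c = {d. homotopic_paths X c d}"

definition fundamental_group :: "'a::topological_space set \<Rightarrow> 'a \<Rightarrow> (real \<Rightarrow> 'a) set monoid" where
  "fundamental_group X x =
     \<lparr>carrier = path_class X ` loops_at X x,
      mult = (\<lambda>A B. \<Union>c\<in>A. \<Union>d\<in>B. path_class X (c +++ d)),
      one = path_class X (\<lambda>_. x)\<rparr>"

lemma path_class_eq_iff:
  assumes "path c" "path_image c \<subseteq> X"
  shows "path_class X c = path_class X d \<longleftrightarrow> homotopic_paths X c d"
proof
  assume "path_class X c = path_class X d"
  then have "c \<in> path_class X d"
    using assms by (auto simp: path_class_def)
  then show "homotopic_paths X c d"
    by (simp add: path_class_def homotopic_paths_sym)
next
  assume "homotopic_paths X c d"
  then show "path_class X c = path_class X d"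
    by (auto simp: path_class_def intro: homotopic_paths_trans homotopic_paths_sym)
qed

lemma loops_at_join:
  "c \<in> loops_at X x \<Longrightarrow> d \<in> loops_at X x \<Longrightarrow> c +++ d \<in> loops_at X x"
  by (auto simp: loops_at_def path_image_join)

lemma fundamental_group_mult:
  assumes c: "c \<in> loops_at X x" and d: "d \<in> loops_at X x"
  shows "path_class X c \<otimes>\<^bsub>fundamental_group X x\<^esub> path_class X d = path_class X (c +++ d)"
proof -
  have *: "path_class X (c' +++ d') = path_class X (c +++ d)"
    if "c' \<in> path_class X c" "d' \<in> path_class X d" for c' d'
  proof -
    have "homotopic_paths X (c +++ d) (c' +++ d')"
      using that c d by (intro homotopic_paths_join) (auto simp: path_class_def loops_at_def)
    then show ?thesis
      using loops_at_join[OF c d] by (subst eq_commute, subst path_class_eq_iff) (auto simp: loops_at_def)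
  qed
  have "c \<in> path_class X c" "d \<in> path_class X d"
    using c d by (auto simp: path_class_def loops_at_def)
  then have "(\<Union>c'\<in>path_class X c. \<Union>d'\<in>path_class X d. path_class X (c' +++ d')) = path_class X (c +++ d)"
    using * by blast
  then show ?thesis
    by (simp add: fundamental_group_def)
qed

lemma homotopic_paths_const_left:
  assumes "path c" "path_image c \<subseteq> X" "pathstart c = x"
  shows "homotopic_paths X ((\<lambda>_. x) +++ c) c"
proof -
  have "homotopic_paths X c ((\<lambda>_. x) +++ c)"
  proof (rule homotopic_paths_reparametrize[where f = "\<lambda>t. max 0 (2 * t - 1)"])
    show "((\<lambda>_. x) +++ c) t = c (max 0 (2 * t - 1))" if "t \<in> {0..1}" for t
      using assms(3) by (cases "t \<le> 1/2") (simp_all add: joinpaths_def pathstart_def max.absorb1 max.absorb2)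
  qed (use assms in \<open>auto intro!: continuous_intros\<close>)
  then show ?thesis by (rule homotopic_paths_sym)
qed

lemma homotopic_paths_reverse_left:
  assumes "path c" "path_image c \<subseteq> X" "pathfinish c = x"
  shows "homotopic_paths X (reversepath c +++ c) (\<lambda>_. x)"
proof -
  define u where "u = (\<lambda>(s, t). max s \<bar>1 - 2 * t\<bar> :: real)"
  have cu: "continuous_on ({0..1} \<times> {0..1}) u"
    unfolding u_def case_prod_beta by (intro continuous_intros)
  have u01: "u ` ({0..1} \<times> {0..1}) \<subseteq> {0..1}"
    by (auto simp: u_def)
  show ?thesis unfolding homotopic_paths
  proof (intro exI[of _ "c \<circ> u"] conjI)
    show "continuous_on ({0..1} \<times> {0..1}) (c \<circ> u)"
      by (rule continuous_on_compose[OF cu continuous_on_subset[OF _ u01]])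
         (use assms(1) in \<open>simp add: path_def\<close>)
    show "c \<circ> u \<in> {0..1} \<times> {0..1} \<rightarrow> X"
      using u01 assms(2) by (force simp: path_image_def)
    show "\<forall>t\<in>{0..1}. (c \<circ> u) (0, t) = (reversepath c +++ c) t"
      by (auto simp: u_def joinpaths_def reversepath_def max_def abs_if)
  qed (use assms(3) in \<open>auto simp: u_def max_def abs_if pathstart_def pathfinish_def joinpaths_def reversepath_def\<close>)
qed

lemma loops_at_const: "x \<in> X \<Longrightarrow> (\<lambda>_. x) \<in> loops_at X x"
  by (auto simp: loops_at_def path_def path_image_def pathstart_def pathfinish_def)

lemma loops_at_reverse: "c \<in> loops_at X x \<Longrightarrow> reversepath c \<in> loops_at X x"
  by (auto simp: loops_at_def)

lemma group_fundamental_group: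
  assumes "x \<in> X"
  shows "group (fundamental_group X x)"
proof (rule groupI)
  let ?G = "fundamental_group X x"
  have car: "carrier ?G = path_class X ` loops_at X x"
    and one: "\<one>\<^bsub>?G\<^esub> = path_class X (\<lambda>_. x)"
    by (auto simp: fundamental_group_def)
  note m = fundamental_group_mult[of _ X x]
  show "A \<otimes>\<^bsub>?G\<^esub> B \<in> carrier ?G" if "A \<in> carrier ?G" "B \<in> carrier ?G" for A B
    using that by (auto simp: car m loops_at_join)
  show "\<one>\<^bsub>?G\<^esub> \<in> carrier ?G"
    using loops_at_const[OF assms] by (auto simp: car one)
  show "A \<otimes>\<^bsub>?G\<^esub> B \<otimes>\<^bsub>?G\<^esub> C = A \<otimes>\<^bsub>?G\<^esub> (B \<otimes>\<^bsub>?G\<^esub> C)"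
    if ABC: "A \<in> carrier ?G" "B \<in> carrier ?G" "C \<in> carrier ?G" for A B C
  proof -
    from ABC obtain a b c where *: "a \<in> loops_at X x" "b \<in> loops_at X x" "c \<in> loops_at X x"
      "A = path_class X a" "B = path_class X b" "C = path_class X c"
      by (auto simp: car)
    have "homotopic_paths X (a +++ (b +++ c)) ((a +++ b) +++ c)"
      using * by (intro homotopic_paths_assoc) (auto simp: loops_at_def)
    then have "path_class X ((a +++ b) +++ c) = path_class X (a +++ (b +++ c))"
      by (subst eq_commute, subst path_class_eq_iff)
         (use loops_at_join * in \<open>auto simp: loops_at_def path_image_join\<close>)
    then show ?thesis
      using * by (simp add: m loops_at_join)
  qed
  show "\<one>\<^bsub>?G\<^esub> \<otimes>\<^bsub>?G\<^esub> A = A" if A: "A \<in> carrier ?G" for A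
  proof -
    from A obtain a where a: "a \<in> loops_at X x" "A = path_class X a"
      by (auto simp: car)
    have "homotopic_paths X ((\<lambda>_. x) +++ a) a"
      using a by (intro homotopic_paths_const_left) (auto simp: loops_at_def)
    moreover have "(\<lambda>_. x) +++ a \<in> loops_at X x"
      using loops_at_join loops_at_const assms a by blast
    ultimately show ?thesis
      using a loops_at_const[OF assms]
      by (auto simp: one m path_class_eq_iff loops_at_def)
  qed
  show "\<exists>B\<in>carrier ?G. B \<otimes>\<^bsub>?G\<^esub> A = \<one>\<^bsub>?G\<^esub>" if A: "A \<in> carrier ?G" for A
  proof -
    from A obtain a where a: "a \<in> loops_at X x" "A = path_class X a"
      by (auto simp: car)
    have r: "reversepath a \<in> loops_at X x"
      using a loops_at_reverse by auto
    have "homotopic_paths X (reversepath a +++ a) (\<lambda>_. x)"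
      using a by (intro homotopic_paths_reverse_left) (auto simp: loops_at_def)
    moreover have "reversepath a +++ a \<in> loops_at X x"
      using loops_at_join r a by blast
    ultimately have "path_class X (reversepath a) \<otimes>\<^bsub>?G\<^esub> A = \<one>\<^bsub>?G\<^esub>"
      using a r by (simp add: one m path_class_eq_iff loops_at_def)
    then show ?thesis
      using r by (auto simp: car)
  qed
qed

section \<open>Abelianization\<close>

definition abelianization :: "('a, 'b) monoid_scheme \<Rightarrow> 'a set monoid" where
  "abelianization G = G Mod derived G (carrier G)"

definition ab_class :: "('a, 'b) monoid_scheme \<Rightarrow> 'a \<Rightarrow> 'a set" where
  "ab_class G x = derived G (carrier G) #>\<^bsub>G\<^esub> x"

text \<open>An automorphism preserves the derived subgroup, hence maps each of its cosets onto a coset.\<close>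

definition ab_map :: "('a, 'b) monoid_scheme \<Rightarrow> ('a \<Rightarrow> 'a) \<Rightarrow> 'a set \<Rightarrow> 'a set" where
  "ab_map G \<phi> = (\<lambda>C\<in>carrier (abelianization G). \<phi> ` C)"

lemma (in group) abelianization_carrier:
  "carrier (abelianization G) = ab_class G ` carrier G"
  by (auto simp: abelianization_def ab_class_def FactGroup_def RCOSETS_def)

lemma (in group) abelianization_mult:
  "x \<in> carrier G \<Longrightarrow> y \<in> carrier G \<Longrightarrow>
     ab_class G x \<otimes>\<^bsub>abelianization G\<^esub> ab_class G y = ab_class G (x \<otimes> y)"
  using normal.rcos_sum[OF derived_self_is_normal] by (simp add: abelianization_def ab_class_def FactGroup_def)

lemma (in group) ab_map_ab_class:
  assumes "\<phi> \<in> auto G" "x \<in> carrier G"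
  shows "ab_map G \<phi> (ab_class G x) = ab_class G (\<phi> x)"
proof -
  have hom: "\<phi> \<in> hom G G" and bij: "bij_betw \<phi> (carrier G) (carrier G)"
    using assms by (auto simp: auto_def Bij_def)
  interpret group_hom G G \<phi>
    by unfold_locales (rule hom)
  have "\<phi> ` derived G (carrier G) = derived G (carrier G)"
    using derived_img[of "carrier G"] bij by (simp add: bij_betw_def)
  moreover have "\<phi> ` (derived G (carrier G) #> x) = (\<phi> ` derived G (carrier G)) #> \<phi> x"
    using assms(2) derived_in_carrier[of "carrier G"] by (force simp: r_coset_def image_UN)
  ultimately show ?thesis
    using assms(2) by (simp add: ab_map_def abelianization_carrier ab_class_def)
qed

lemma (in group) ab_map_auto:
  assumes "\<phi> \<in> auto G"
  shows "ab_map G \<phi> \<in> auto (abelianization G)"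
proof -
  have hom: "\<phi> \<in> hom G G" and bij: "bij_betw \<phi> (carrier G) (carrier G)"
    using assms by (auto simp: auto_def Bij_def)
  have im: "\<phi> ` carrier G = carrier G"
    using bij by (simp add: bij_betw_def)
  note A = ab_map_ab_class[OF assms]
  have cl: "\<phi> x \<in> carrier G" if "x \<in> carrier G" for x
    using im that by blast
  have "ab_map G \<phi> \<in> hom (abelianization G) (abelianization G)"
    by (intro homI) (auto simp: abelianization_carrier A abelianization_mult hom_mult[OF hom] cl)
  moreover have "inj_on (ab_map G \<phi>) (carrier (abelianization G))"
  proof (rule inj_onI)
    fix C D assume CD: "C \<in> carrier (abelianization G)" "D \<in> carrier (abelianization G)"
      and eq: "ab_map G \<phi> C = ab_map G \<phi> D"
    have "C \<subseteq> carrier G" "D \<subseteq> carrier G"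
      using CD derived_in_carrier[of "carrier G"]
      by (auto simp: abelianization_carrier ab_class_def r_coset_def)
    moreover have "\<phi> ` C = \<phi> ` D"
      using CD eq by (simp add: ab_map_def)
    ultimately show "C = D"
      using inj_on_image_eq_iff[of \<phi> "carrier G" C D] bij by (simp add: bij_betw_def)
  qed
  moreover have "ab_map G \<phi> ` carrier (abelianization G) = carrier (abelianization G)"
  proof -
    have "ab_map G \<phi> ` carrier (abelianization G) = ab_class G ` \<phi> ` carrier G"
      by (simp add: abelianization_carrier image_image A cong: image_cong)
    then show ?thesis
      by (simp add: im abelianization_carrier)
  qed
  ultimately show ?thesis
    by (auto simp: auto_def Bij_def bij_betw_def ab_map_def)
qed

section \<open>Pure braid groups\<close>

definition config_space :: "nat \<Rightarrow> 'a set \<Rightarrow> (nat \<Rightarrow> 'a) set" where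
  "config_space n M = {x \<in> {1..n} \<rightarrow>\<^sub>E M. inj_on x {1..n}}"

definition pure_braid_group ::
    "nat \<Rightarrow> 'a::topological_space set \<Rightarrow> (nat \<Rightarrow> 'a) \<Rightarrow> (real \<Rightarrow> nat \<Rightarrow> 'a) set monoid" where
  "pure_braid_group n M Q = fundamental_group (config_space n M) Q"

section \<open>Closed surfaces as polygons with identified edges\<close>

definition num_labels :: "bool \<Rightarrow> nat \<Rightarrow> nat" where
  "num_labels orientable g = (if orientable then 2 * g else g)"

text \<open>
  The polygon with \<open>2m\<close> edges is modelled by the closed unit disc, its edges \<open>1, \<dots>, 2m\<close> being the
  consecutive arcs of length \<open>\<pi> / m\<close> of the unit circle; this includes the bigon \<open>m = 1\<close>, needed
  for the projective plane.  \<open>edge_point m k t\<close> is the point of edge \<open>k\<close> at parameter \<open>t \<in> [0, 1]\<close>,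
  counterclockwise.  The two edges labelled \<open>\<epsilon>\<^sub>r\<close> are \<open>r\<close> and the opposite edge \<open>m + r\<close>.
\<close>

definition edge_point :: "nat \<Rightarrow> nat \<Rightarrow> real \<Rightarrow> complex" where
  "edge_point m k t = cis (pi * (real k - 1 + t) / real m)"

text \<open>
  Translating an edge of a regular polygon onto the opposite one takes the parameter \<open>t\<close> to \<open>1 - t\<close>,
  since opposite edges are traversed in opposite directions along the boundary; identification with
  the reversed orientation therefore preserves \<open>t\<close>.
\<close>

definition glue_param :: "bool \<Rightarrow> nat \<Rightarrow> nat \<Rightarrow> real \<Rightarrow> real" where
  "glue_param orientable g r t = (if \<not> orientable \<and> r = g then t else 1 - t)"

definition glued :: "bool \<Rightarrow> nat \<Rightarrow> complex \<Rightarrow> complex \<Rightarrow> bool" where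
  "glued orientable g z w \<longleftrightarrow>
     (let m = num_labels orientable g in
       \<exists>r\<in>{1..m}. \<exists>t\<in>{0..1}.
         z = edge_point m r t \<and> w = edge_point m (m + r) (glue_param orientable g r t))"

text \<open>
  \<open>M\<close> is the quotient of the polygon by the least equivalence relation containing \<open>glued\<close>, with
  projection \<open>p\<close>; that is, \<open>M\<close> is the closed surface of genus \<open>g\<close> of the given orientability.
\<close>

definition polygon_surface :: "bool \<Rightarrow> nat \<Rightarrow> 'a::topological_space set \<Rightarrow> (complex \<Rightarrow> 'a) \<Rightarrow> bool" where
  "polygon_surface orientable g M p \<longleftrightarrow>
     quotient_map (top_of_set (cball 0 1)) (top_of_set M) p \<and>
     (\<forall>z\<in>cball 0 1. \<forall>w\<in>cball 0 1. p z = p w \<longleftrightarrow> equivclp (glued orientable g) z w)"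

section \<open>Base points and the braids going through an edge\<close>

definition on_segment_in_order :: "nat \<Rightarrow> (nat \<Rightarrow> complex) \<Rightarrow> bool" where
  "on_segment_in_order n b \<longleftrightarrow>
     (\<exists>u v s. u \<in> ball 0 1 \<and> v \<in> ball 0 1 \<and> u \<noteq> v \<and>
        s ` {1..n} \<subseteq> {0..1::real} \<and> strict_mono_on {1..n} s \<and>
        (\<forall>i\<in>{1..n}. b i = (1 - s i) *\<^sub>R u + s i *\<^sub>R v))"

definition base_config :: "nat \<Rightarrow> (complex \<Rightarrow> 'a) \<Rightarrow> (nat \<Rightarrow> complex) \<Rightarrow> nat \<Rightarrow> 'a" where
  "base_config n p b = (\<lambda>i\<in>{1..n}. p (b i))"

text \<open>
  The loop follows \<open>p \<circ> \<alpha>\<close>, where \<open>\<alpha>\<close> runs inside the polygon from \<open>b i\<close> to a point of the relative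
  interior of one copy of \<open>\<epsilon>\<^sub>r\<close>, and then \<open>p \<circ> \<beta>\<close>, where \<open>\<beta>\<close> starts at the identified point of the other
  copy and returns inside the polygon to \<open>b i\<close>.  If \<open>out r\<close> holds, the polygon is left through edge \<open>r\<close>,
  otherwise through edge \<open>m + r\<close>.
\<close>

definition edge_loop ::
    "bool \<Rightarrow> nat \<Rightarrow> nat \<Rightarrow> (complex \<Rightarrow> 'a::topological_space) \<Rightarrow> (nat \<Rightarrow> complex) \<Rightarrow> (nat \<Rightarrow> bool) \<Rightarrow>
     nat \<Rightarrow> nat \<Rightarrow> (real \<Rightarrow> 'a) \<Rightarrow> bool" where
  "edge_loop orientable g n p b out i r c \<longleftrightarrow>
     (let m = num_labels orientable g; P = ball 0 1 - b ` ({1..n} - {i}) in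
       \<exists>\<alpha> \<beta>. \<exists>t\<in>{0<..<1}.
         c = (p \<circ> \<alpha>) +++ (p \<circ> \<beta>) \<and> path \<alpha> \<and> path \<beta> \<and>
         pathstart \<alpha> = b i \<and> \<alpha> ` {0..<1} \<subseteq> P \<and>
         pathfinish \<alpha> = edge_point m (if out r then r else m + r) t \<and>
         pathstart \<beta> = edge_point m (if out r then m + r else r) (glue_param orientable g r t) \<and>
         \<beta> ` {0<..1} \<subseteq> P \<and> pathfinish \<beta> = b i)"

text \<open>
  The possible choices of the pure braid \<open>\<rho>\<^sub>i\<^sub>,\<^sub>r\<close>: only its \<open>i\<close>-th string moves, along such a loop.
\<close>

definition rho_braids ::
    "bool \<Rightarrow> nat \<Rightarrow> nat \<Rightarrow> 'a::topological_space set \<Rightarrow> (complex \<Rightarrow> 'a) \<Rightarrow> (nat \<Rightarrow> complex) \<Rightarrow> (nat \<Rightarrow> bool) \<Rightarrow>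
     nat \<Rightarrow> nat \<Rightarrow> (real \<Rightarrow> nat \<Rightarrow> 'a) set set" where
  "rho_braids orientable g n M p b out i r =
     {path_class (config_space n M) (\<lambda>t. (base_config n p b)(i := c t)) | c.
        edge_loop orientable g n p b out i r c}"

lemma glued_norm: "glued orientable g z w \<Longrightarrow> norm z = 1 \<and> norm w = 1"
  by (auto simp: glued_def edge_point_def Let_def)

lemma equivclp_glued_cases:
  assumes "equivclp (glued orientable g) z w"
  shows "z = w \<or> norm z = 1 \<and> norm w = 1"
  using assms
proof (induction rule: equivclp_induct)
  case base
  then show ?case by simp
next
  case (step y z)
  then show ?case using glued_norm by blast
qed

lemma polygon_surface_eqD:
  assumes "polygon_surface orientable g M p" "z \<in> ball 0 1" "w \<in> cball 0 1" "p z = p w"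
  shows "z = w"
proof -
  have "equivclp (glued orientable g) z w"
    using assms by (auto simp: polygon_surface_def)
  from equivclp_glued_cases[OF this] show ?thesis
    using assms(2) by auto
qed

lemma on_segment_in_order_ball:
  assumes "on_segment_in_order n b" "i \<in> {1..n}"
  shows "b i \<in> ball 0 1"
proof -
  from assms obtain u v s where "u \<in> ball 0 1" "v \<in> ball 0 1" "s i \<in> {0..1::real}"
    "b i = (1 - s i) *\<^sub>R u + s i *\<^sub>R v"
    unfolding on_segment_in_order_def by blast
  then show ?thesis
    using convexD_alt[of "ball 0 1" u v "s i"] by (auto simp: convex_ball)
qed

lemma on_segment_in_order_inj:
  assumes "on_segment_in_order n b"
  shows "inj_on b {1..n}"
proof -
  from assms obtain u v s where *: "u \<noteq> v" "strict_mono_on {1..n} (s :: nat \<Rightarrow> real)"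
    "\<forall>i\<in>{1..n}. b i = (1 - s i) *\<^sub>R u + s i *\<^sub>R v"
    unfolding on_segment_in_order_def by blast
  show ?thesis
  proof (rule inj_onI)
    fix i j assume ij: "i \<in> {1..n}" "j \<in> {1..n}" "b i = b j"
    then have "(s i - s j) *\<^sub>R (v - u) = 0"
      using * by (simp add: algebra_simps)
    then have "s i = s j"
      using *(1) by simp
    then show "i = j"
      using strict_mono_on_imp_inj_on[OF *(2)] ij by (auto dest: inj_onD)
  qed
qed

lemma base_config_in_config_space:
  assumes "polygon_surface orientable g M p" "on_segment_in_order n b"
  shows "base_config n p b \<in> config_space n M"
proof -
  have "p z \<in> M" if "z \<in> cball 0 1" for z
    using assms(1) that by (auto simp: polygon_surface_def quotient_map_def)
  moreover have b: "b i \<in> ball 0 1" if "i \<in> {1..n}" for i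
    using on_segment_in_order_ball[OF assms(2) that] .
  moreover have "inj_on (base_config n p b) {1..n}"
  proof (rule inj_onI)
    fix i j assume ij: "i \<in> {1..n}" "j \<in> {1..n}" "base_config n p b i = base_config n p b j"
    then have "p (b i) = p (b j)"
      by (simp add: base_config_def)
    then have "b i = b j"
      using polygon_surface_eqD[OF assms(1) b[OF ij(1)]] b[OF ij(2)] by simp
    then show "i = j"
      using on_segment_in_order_inj[OF assms(2)] ij by (auto dest: inj_onD)
  qed
  moreover have "b i \<in> cball 0 1" if "i \<in> {1..n}" for i
    using b[OF that] ball_subset_cball by blast
  ultimately show ?thesis
    by (auto simp del: mem_ball mem_cball atLeastAtMost_iff simp: config_space_def base_config_def)
qed

lemma rho_braids_in_carrier:
  assumes M: "polygon_surface orientable g M p" and b: "on_segment_in_order n b"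
    and i: "i \<in> {1..n}" and r: "r \<in> {1..num_labels orientable g}"
  shows "rho_braids orientable g n M p b out i r \<subseteq> carrier (pure_braid_group n M (base_config n p b))"
proof
  fix A assume "A \<in> rho_braids orientable g n M p b out i r"
  then obtain c where A: "A = path_class (config_space n M) (\<lambda>t. (base_config n p b)(i := c t))"
    and c: "edge_loop orientable g n p b out i r c"
    by (auto simp: rho_braids_def)
  define m where "m = num_labels orientable g"
  define P where "P = ball 0 1 - b ` ({1..n} - {i})"
  from c obtain \<alpha> \<beta> t where t: "t \<in> {0<..<1}" and ceq: "c = (p \<circ> \<alpha>) +++ (p \<circ> \<beta>)"
    and path: "path \<alpha>" "path \<beta>"
    and \<alpha>0: "pathstart \<alpha> = b i" and \<alpha>P: "\<alpha> ` {0..<1} \<subseteq> P"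
    and \<alpha>1: "pathfinish \<alpha> = edge_point m (if out r then r else m + r) t"
    and \<beta>0: "pathstart \<beta> = edge_point m (if out r then m + r else r) (glue_param orientable g r t)"
    and \<beta>P: "\<beta> ` {0<..1} \<subseteq> P" and \<beta>1: "pathfinish \<beta> = b i"
    unfolding edge_loop_def Let_def m_def P_def by blast
  define S where "S = cball 0 1 - b ` ({1..n} - {i})"
  have bb: "b j \<in> ball 0 1" if "j \<in> {1..n}" for j
    using on_segment_in_order_ball[OF b that] .
  have edge: "edge_point m k s \<in> S" for k s
  proof -
    have "norm (edge_point m k s) = 1"
      by (simp add: edge_point_def)
    moreover have "norm (b j) < 1" if "j \<in> {1..n}" for j
      using bb[OF that] by simp
    ultimately show ?thesis
      unfolding S_def by fastforce
  qed
  have PS: "P \<subseteq> S"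
    by (auto simp: P_def S_def)
  have im: "\<alpha> ` {0..1} \<subseteq> S" "\<beta> ` {0..1} \<subseteq> S"
  proof -
    have "{0..1::real} = insert 1 {0..<1}"
      by auto
    then show "\<alpha> ` {0..1} \<subseteq> S"
      using \<alpha>P PS \<alpha>1 edge by (auto simp: pathfinish_def)
    have "{0..1::real} = insert 0 {0<..1}"
      by auto
    then show "\<beta> ` {0..1} \<subseteq> S"
      using \<beta>P PS \<beta>0 edge by (auto simp: pathstart_def)
  qed
  have contp: "continuous_on (cball 0 1) p" and pM: "p ` cball 0 1 = M"
    using M quotient_imp_continuous_map[of "top_of_set (cball 0 1)" "top_of_set M" p]
    by (auto simp: polygon_surface_def quotient_map_def continuous_map_in_subtopology)
  have glue: "p (pathfinish \<alpha>) = p (pathstart \<beta>)"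
  proof -
    let ?s = "glue_param orientable g r t"
    have s: "?s \<in> {0..1}" "t \<in> {0..1}" "glue_param orientable g r ?s = t"
      using t by (auto simp: glue_param_def)
    have "glued orientable g (edge_point m r t) (edge_point m (m + r) ?s)"
      "glued orientable g (edge_point m r ?s) (edge_point m (m + r) t)"
      using r s unfolding glued_def Let_def m_def by metis+
    then have "equivclp (glued orientable g) (pathfinish \<alpha>) (pathstart \<beta>)"
      unfolding \<alpha>1 \<beta>0 by (auto intro: equivclp_sym)
    then show ?thesis
      using M edge unfolding polygon_surface_def \<alpha>1 \<beta>0 S_def by blast
  qed
  have pc: "path c" "pathstart c = p (b i)" "pathfinish c = p (b i)"
  proof -
    have "path_image \<alpha> \<subseteq> cball 0 1" "path_image \<beta> \<subseteq> cball 0 1"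
      using im unfolding S_def path_image_def by blast+
    then have "path (p \<circ> \<alpha>)" "path (p \<circ> \<beta>)"
      using path by (auto intro!: path_continuous_image continuous_on_subset[OF contp] simp del: mem_cball)
    then show "path c"
      using glue by (simp add: ceq pathfinish_compose pathstart_compose)
  qed (simp_all add: ceq \<alpha>0 \<beta>1 pathfinish_compose pathstart_compose)
  have cS: "c ` {0..1} \<subseteq> p ` S"
  proof -
    have "path_image (p \<circ> \<alpha>) \<subseteq> p ` S" "path_image (p \<circ> \<beta>) \<subseteq> p ` S"
      using im by (auto simp only: path_image_def image_comp[symmetric] intro!: image_mono)
    then have "path_image c \<subseteq> p ` S"
      using path_image_join_subset[of "p \<circ> \<alpha>" "p \<circ> \<beta>"] unfolding ceq by blast
    then show ?thesis
      by (simp add: path_image_def)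
  qed
  let ?Q = "base_config n p b"
  let ?c = "\<lambda>t. ?Q(i := c t)"
  have Q: "?Q \<in> config_space n M"
    using base_config_in_config_space[OF M b] .
  have "?c \<in> loops_at (config_space n M) ?Q"
    unfolding loops_at_def
  proof (intro CollectI conjI)
    show "path ?c"
      unfolding path_def
    proof (rule continuous_on_coordinatewise_then_product)
      show "continuous_on {0..1} (\<lambda>t. ?c t j)" for j
        using pc(1) by (cases "j = i") (simp_all add: path_def)
    qed
    show "path_image ?c \<subseteq> config_space n M"
    proof -
      have "?Q(i := x) \<in> config_space n M" if x: "x \<in> p ` S" for x
      proof -
        have xM: "x \<in> M"
          using x pM unfolding S_def by blast
        have ne: "x \<noteq> ?Q j" if j: "j \<in> {1..n}" "j \<noteq> i" for j
        proof
          assume eq: "x = ?Q j"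
          from x obtain z where z: "z \<in> S" "x = p z" by blast
          have "p (b j) = p z"
            using eq z(2) j(1) by (simp add: base_config_def)
          moreover have "z \<in> cball 0 1"
            using z(1) unfolding S_def by blast
          ultimately have "b j = z"
            using polygon_surface_eqD[OF M bb[OF j(1)]] by blast
          then show False
            using z(1) j unfolding S_def by blast
        qed
        have QM: "?Q \<in> {1..n} \<rightarrow>\<^sub>E M" and inj: "inj_on ?Q {1..n}"
          using Q unfolding config_space_def by blast+
        have "?Q(i := x) \<in> insert i {1..n} \<rightarrow>\<^sub>E M"
          by (rule PiE_fun_upd[OF xM QM])
        moreover have "inj_on (?Q(i := x)) {1..n}"
        proof (rule inj_onI)
          fix j k assume jk: "j \<in> {1..n}" "k \<in> {1..n}" "(?Q(i := x)) j = (?Q(i := x)) k"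
          show "j = k"
            using jk(3) ne[OF jk(1)] ne[OF jk(2)] inj_onD[OF inj _ jk(1,2)]
            by (cases "j = i"; cases "k = i") auto
        qed
        ultimately show ?thesis
          unfolding config_space_def insert_absorb[OF i] by blast
      qed
      then show ?thesis
        using cS unfolding path_image_def by blast
    qed
    show "pathstart ?c = ?Q" "pathfinish ?c = ?Q"
      using pc i by (auto simp: pathstart_def pathfinish_def base_config_def)
  qed
  then show "A \<in> carrier (pure_braid_group n M ?Q)"
    by (auto simp: A pure_braid_group_def fundamental_group_def)
qed

end

theory Submission
  imports Defs
begin

text \<open>
  Permuting coordinates and moving the base point back along a path \<open>\<gamma>\<close> gives an automorphism of the
  pure braid group; a braid moving only string \<open>i\<close> through an edge becomes one moving only string
  \<open>\<tau> i\<close> through that edge, conjugated by \<open>\<gamma>\<close> and with the resting points permuted.  So the class in the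
  abelianization of a braid that moves one string through an edge must be shown to depend neither on the
  chosen path nor on the resting points.  A loop along the boundary circle avoids all points inside the
  disc, so the resting points may be moved freely once the choice of path is irrelevant, and this reduces
  to the triviality of a small loop of string \<open>k\<close> around point \<open>j\<close>.  Two diameters of the polygon give
  closed curves in \<open>M\<close> that meet in one point; moving \<open>k\<close> along one and \<open>j\<close> along the other maps a
  torus minus a disc to the configuration space, and its boundary, the loop of \<open>k\<close> around \<open>j\<close>, is a
  commutator.
\<close>

section \<open>Path functionals with values in an abelian group\<close>

text \<open>A \<open>path_functional\<close> is a functor from the fundamental groupoid to a
  commutative group; having values on all paths, not only on loops at \<open>Q\<close>, allows a
  braid to be cut at the boundary of the polygon and its base point to be moved. That the path is
  irrelevant on a set means that the functional has a primitive there, a \<open>potential\<close>.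
  Primitives on the punctured polygon are glued from primitives on slit or cut convex pieces, and
  the only obstruction is the value of a small quadrilateral around each puncture.

  The commutator needs two pairs of antipodal boundary points, identified within each pair but not
  across. Midpoints of two translated edges supply them in the orientable case; in the
  non-orientable case two points of the edge with reversed orientation do, also for the projective
  plane. This is where \<open>g \<ge> 1\<close> enters.

  Given a potential for string \<open>k\<close> on the punctured closed disc, a loop through an edge
  has as value the potential difference between the two copies of the edge, which is the same at
  every crossing point because both copies have the same image in \<open>M\<close>.\<close>

locale path_functional = comm_group H for H (structure) +
  fixes F :: "'b::topological_space set" and val :: "(real \<Rightarrow> 'b) \<Rightarrow> 'h"
  assumes val_closed [simp]: "path c \<Longrightarrow> path_image c \<subseteq> F \<Longrightarrow> val c \<in> carrier H"
    and val_join: "path c \<Longrightarrow> path_image c \<subseteq> F \<Longrightarrow> path d \<Longrightarrow> path_image d \<subseteq> F \<Longrightarrow>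
      pathfinish c = pathstart d \<Longrightarrow> val (c +++ d) = val c \<otimes> val d"
    and val_homotopic: "homotopic_paths F c d \<Longrightarrow> val c = val d"
begin

text \<open>A primitive of \<open>val\<close> along the paths in \<open>S\<close>, in multiplicative
  notation. For \<open>S\<close> inside \<open>F\<close> its existence makes \<open>val\<close>
  depend only on the endpoints of a path in \<open>S\<close>, so that loops in \<open>S\<close> have
  value one.\<close>

definition potential :: "'b set \<Rightarrow> ('b \<Rightarrow> 'h) \<Rightarrow> bool" where
  "potential S \<theta> \<longleftrightarrow> \<theta> ` S \<subseteq> carrier H \<and>
     (\<forall>c. path c \<longrightarrow> path_image c \<subseteq> S \<longrightarrow> \<theta> (pathstart c) \<otimes> val c = \<theta> (pathfinish c))"

lemma potential_closed: "potential S \<theta> \<Longrightarrow> x \<in> S \<Longrightarrow> \<theta> x \<in> carrier H"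
  by (auto simp: potential_def)

lemma potentialD:
  "potential S \<theta> \<Longrightarrow> path c \<Longrightarrow> path_image c \<subseteq> S \<Longrightarrow> \<theta> (pathstart c) \<otimes> val c = \<theta> (pathfinish c)"
  by (auto simp: potential_def)

text \<open>The constant path equals its join with itself, so its value is idempotent.\<close>

lemma val_const:
  assumes "x \<in> F"
  shows "val (\<lambda>_. x) = \<one>"
proof -
  have "path (\<lambda>_. x)" "path_image (\<lambda>_. x) \<subseteq> F"
    using loops_at_const[OF assms] by (auto simp: loops_at_def)
  moreover have "(\<lambda>_. x) +++ (\<lambda>_. x) = (\<lambda>_. x)"
    by (auto simp: joinpaths_def)
  ultimately have "val (\<lambda>_. x) \<otimes> val (\<lambda>_. x) = val (\<lambda>_. x)"
    using val_join[of "\<lambda>_. x" "\<lambda>_. x"] by (simp add: pathstart_def pathfinish_def)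
  then show ?thesis
    using \<open>path (\<lambda>_. x)\<close> \<open>path_image (\<lambda>_. x) \<subseteq> F\<close> by (metis l_cancel_one' val_closed)
qed

lemma val_cong:
  assumes "path c" "path_image c \<subseteq> F" "\<And>t. t \<in> {0..1} \<Longrightarrow> c t = d t"
  shows "val c = val d"
  by (rule val_homotopic) (use assms in \<open>auto intro: homotopic_paths_eq\<close>)

lemma val_reversepath:
  assumes "path c" "path_image c \<subseteq> F"
  shows "val (reversepath c) = inv (val c)"
proof -
  have "val (reversepath c) \<otimes> val c = val (\<lambda>_. pathfinish c)"
    using assms by (subst val_join[symmetric]) (auto intro!: val_homotopic homotopic_paths_reverse_left)
  also have "\<dots> = \<one>"
    using assms by (intro val_const) auto
  finally show ?thesis
    using assms by (intro inv_equality[symmetric]) auto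
qed

end

text \<open>This turns a parametrized family of configurations into a domain of its own: potentials
  are then sought on an interval, a square or a punctured disc instead of in the configuration
  space.\<close>

lemma path_functional_pullback:
  assumes "path_functional H F val" and f: "continuous_on W f" "f \<in> W \<rightarrow> F"
  shows "path_functional H W (\<lambda>c. val (f \<circ> c))"
proof -
  interpret path_functional H F val by fact
  have p: "path (f \<circ> c)" "path_image (f \<circ> c) \<subseteq> F" if "path c" "path_image c \<subseteq> W" for c
    using that f by (auto intro!: path_continuous_image intro: continuous_on_subset simp: path_image_compose)
  show ?thesis
  proof
    show "val (f \<circ> c) \<in> carrier H" if "path c" "path_image c \<subseteq> W" for c
      using p[OF that] by simp
    show "val (f \<circ> (c +++ d)) = val (f \<circ> c) \<otimes>\<^bsub>H\<^esub> val (f \<circ> d)"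
      if "path c" "path_image c \<subseteq> W" "path d" "path_image d \<subseteq> W" "pathfinish c = pathstart d" for c d
      using p that by (simp add: path_compose_join val_join pathfinish_compose pathstart_compose)
    show "val (f \<circ> c) = val (f \<circ> d)" if "homotopic_paths W c d" for c d
      using homotopic_paths_continuous_image[OF that f] by (rule val_homotopic)
  qed
qed

text \<open>A starlike set is simply connected, so any path in \<open>S\<close> may be replaced by
  one through the centre \<open>a\<close>.\<close>

lemma potential_starlike:
  fixes W S :: "'c::real_normed_vector set"
  assumes "path_functional H W val" and S: "S \<subseteq> W" and a: "\<And>x. x \<in> S \<Longrightarrow> closed_segment a x \<subseteq> S"
  shows "path_functional.potential H val S (\<lambda>x. val (linepath a x))"
proof -
  interpret W: path_functional H W val by fact
  show ?thesis unfolding W.potential_def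
  proof (intro conjI allI impI)
    show "(\<lambda>x. val (linepath a x)) ` S \<subseteq> carrier H"
      using a S by (intro image_subsetI W.val_closed) (simp, force)
    fix c :: "real \<Rightarrow> 'c" assume c: "path c" "path_image c \<subseteq> S"
    then have "pathstart c \<in> S" "pathfinish c \<in> S" by auto
    then have seg: "closed_segment a (pathstart c) \<subseteq> S" "closed_segment a (pathfinish c) \<subseteq> S"
      using a by auto
    then have "a \<in> S" by auto
    then have "starlike S"
      using a by (auto simp: starlike_def)
    then have *: "homotopic_paths S d e" if "path d" "path_image d \<subseteq> S" "path e" "path_image e \<subseteq> S"
        "pathstart e = pathstart d" "pathfinish e = pathfinish d" for d e
      using starlike_imp_simply_connected[of S] that unfolding simply_connected_eq_homotopic_paths by blast
    have "homotopic_paths S (linepath a (pathstart c) +++ c) (linepath a (pathfinish c))"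
      by (rule *) (use seg c in \<open>simp_all add: path_image_join\<close>)
    then have "val (linepath a (pathstart c) +++ c) = val (linepath a (pathfinish c))"
      using S by (meson W.val_homotopic homotopic_paths_subset)
    then show "val (linepath a (pathstart c)) \<otimes>\<^bsub>H\<^esub> val c = val (linepath a (pathfinish c))"
      using c S seg by (subst W.val_join[symmetric]) auto
  qed
qed


context path_functional
begin

lemma mult_inv_mult_cancel:
  assumes "a \<in> carrier H" "b \<in> carrier H" "v \<in> carrier H"
  shows "(a \<otimes> v) \<otimes> inv (b \<otimes> v) = a \<otimes> inv b"
proof -
  have "(a \<otimes> v) \<otimes> inv (b \<otimes> v) = a \<otimes> (v \<otimes> inv v) \<otimes> inv b"
    using assms by (simp only: inv_mult_group m_assoc inv_closed m_closed)
  then show ?thesis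
    using assms by simp
qed

text \<open>Being a primitive is a local property, and no subdivision of the path is needed to see
  it: along \<open>c\<close> the functional pulled back to the interval has a potential
  \<open>\<theta>'\<close> of its own, the quotient of \<open>\<theta> \<circ> c\<close> by
  \<open>\<theta>'\<close> is locally constant because near each parameter \<open>c\<close> stays in
  \<open>U\<close> or in \<open>V\<close>, and the interval is connected.\<close>

lemma potential_Un:
  assumes F: "U \<union> V \<subseteq> F"
    and op: "openin (top_of_set (U \<union> V)) U" "openin (top_of_set (U \<union> V)) V"
    and pot: "potential U \<theta>" "potential V \<theta>"
  shows "potential (U \<union> V) \<theta>"
  unfolding potential_def
proof (intro conjI allI impI)
  show "\<theta> ` (U \<union> V) \<subseteq> carrier H"
    using pot by (auto simp: potential_def)
  fix c :: "real \<Rightarrow> 'b" assume c: "path c" "path_image c \<subseteq> U \<union> V"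
  have cc: "continuous_on {0..1} c" and cUV: "c \<in> {0..1} \<rightarrow> U \<union> V" and cF: "c \<in> {0..1} \<rightarrow> F"
    using c F by (auto simp: path_def path_image_def)
  interpret I: path_functional H "{0..1}" "\<lambda>d. val (c \<circ> d)"
    using path_functional_pullback[OF path_functional_axioms cc cF] .
  obtain \<theta>' where \<theta>': "I.potential {0..1} \<theta>'"
    using potential_starlike[OF I.path_functional_axioms order_refl, of 0]
    by (auto simp: closed_segment_eq_real_ivl)
  define q where "q s = \<theta> (c s) \<otimes> inv \<theta>' s" for s
  have cl: "\<theta> (c s) \<in> carrier H" "\<theta>' s \<in> carrier H" if "s \<in> {0..1}" for s
    using I.potential_closed[OF \<theta>' that] potential_closed[OF pot(1)] potential_closed[OF pot(2)] cUV that
    by blast+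
  have val01: "\<theta>' a \<otimes> val (c \<circ> linepath a s) = \<theta>' s" "val (c \<circ> linepath a s) \<in> carrier H"
    if "a \<in> {0..1}" "s \<in> {0..1}" for a s
    using I.potentialD[OF \<theta>', of "linepath a s"] I.val_closed[of "linepath a s"] that
    by (auto simp: closed_segment_eq_real_ivl split: if_splits)
  have loc: "\<exists>T. openin (top_of_set {0..1}) T \<and> a \<in> T \<and> (\<forall>s\<in>T. q a = q s)"
    if a: "a \<in> {0..1}" and X: "X = U \<or> X = V" "c a \<in> X" for a X
  proof -
    have potX: "potential X \<theta>" and opX: "openin (top_of_set (U \<union> V)) X"
      using X op pot by auto
    have "openin (top_of_set {0..1}) ({0..1} \<inter> c -` X)"
      by (rule continuous_openin_preimage[OF cc cUV opX])
    then obtain e where e: "e > 0" "ball a e \<inter> {0..1} \<subseteq> {0..1} \<inter> c -` X"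
      using a X(2) unfolding openin_contains_ball by blast
    have "q a = q s" if s: "s \<in> ball a e \<inter> {0..1}" for s
    proof -
      have seg: "closed_segment a s \<subseteq> ball a e \<inter> {0..1}"
        using s e(1) a by (intro closed_segment_subset convex_Int) auto
      have "path (c \<circ> linepath a s)"
        using seg by (intro path_continuous_image continuous_on_subset[OF cc]) auto
      moreover have "path_image (c \<circ> linepath a s) \<subseteq> X"
        using seg e(2) by (auto simp: path_image_compose)
      ultimately have "\<theta> (c a) \<otimes> val (c \<circ> linepath a s) = \<theta> (c s)"
        using potentialD[OF potX, of "c \<circ> linepath a s"] by (simp add: pathstart_compose pathfinish_compose)
      then show ?thesis
        using val01[OF a, of s] s mult_inv_mult_cancel[OF cl(1)[OF a] cl(2)[OF a], of "val (c \<circ> linepath a s)"]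
        unfolding q_def by auto
    qed
    then show ?thesis
      using e(1) a by (intro exI[of _ "ball a e \<inter> {0..1}"]) (auto intro!: openin_subtopology_Int2 simp: Int_commute[of "ball a e"])
  qed
  have "q 0 = q 1"
  proof (rule connected_equivalence_relation[of "{0..1::real}" _ _ "\<lambda>s t. q s = q t"])
    show "\<exists>T. openin (top_of_set {0..1}) T \<and> a \<in> T \<and> (\<forall>s\<in>T. q a = q s)" if "a \<in> {0..1}" for a
      using loc[OF that] cUV that by blast
  qed auto
  moreover have "val (c \<circ> linepath 0 1) = val c"
    using c F by (intro val_cong[symmetric]) (auto simp: linepath_def)
  ultimately have *: "\<theta> (c 0) \<otimes> inv \<theta>' 0 = \<theta> (c 1) \<otimes> inv (\<theta>' 0 \<otimes> val c)" "val c \<in> carrier H"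
    using val01[of 0 1] unfolding q_def by auto
  have "\<theta> (c 0) \<otimes> val c = \<theta> (c 0) \<otimes> inv \<theta>' 0 \<otimes> (\<theta>' 0 \<otimes> val c)"
    using cl[of 0] *(2) by (simp add: m_assoc[symmetric]) (simp add: m_assoc)
  also have "\<dots> = \<theta> (c 1)"
    unfolding *(1) using cl[of 0] cl[of 1] *(2) by (simp add: m_assoc)
  finally show "\<theta> (pathstart c) \<otimes> val c = \<theta> (pathfinish c)"
    by (simp add: pathstart_def pathfinish_def)
qed

text \<open>The functional pulled back to the square has a potential, so both ways around the square
  have the same value. The sides \<open>t = 0\<close> and \<open>t = 1\<close> are the same path by
  \<open>loop\<close> and cancel because \<open>H\<close> is commutative; the base point may
  therefore move.\<close>

lemma val_free_homotopy:
  assumes h: "continuous_on ({0..1} \<times> {0..1}) (\<lambda>(s::real, t::real). h s t)"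
    and F: "\<And>s t. s \<in> {0..1} \<Longrightarrow> t \<in> {0..1} \<Longrightarrow> h s t \<in> F"
    and loop: "\<And>s. s \<in> {0..1} \<Longrightarrow> h s 0 = h s 1"
  shows "val (h 0) = val (h 1)"
proof -
  define k where "k = (\<lambda>(s::real, t::real). h s t)"
  define Q where "Q = {0..1::real} \<times> {0..1::real}"
  have cvx: "convex Q"
    unfolding Q_def by (intro convex_Times) auto
  have kF: "k \<in> Q \<rightarrow> F"
    using F by (auto simp: k_def Q_def)
  have kc: "continuous_on Q k"
    using h by (simp add: k_def Q_def)
  interpret I: path_functional H Q "\<lambda>d. val (k \<circ> d)"
    using path_functional_pullback[OF path_functional_axioms kc kF] .
  have "(0, 0) \<in> Q"
    by (simp add: Q_def)
  then obtain \<theta> where \<theta>: "I.potential Q \<theta>"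
    using potential_starlike[OF I.path_functional_axioms order_refl, of "(0, 0)"] cvx
    by (auto simp: closed_segment_subset)
  have v: "\<theta> a \<otimes> val (k \<circ> linepath a s) = \<theta> s" "val (k \<circ> linepath a s) \<in> carrier H"
    "path (k \<circ> linepath a s)" "path_image (k \<circ> linepath a s) \<subseteq> F" "\<theta> a \<in> carrier H"
    if "a \<in> Q" "s \<in> Q" for a s
  proof -
    have seg: "closed_segment a s \<subseteq> Q"
      using that cvx by (rule closed_segment_subset)
    show "path (k \<circ> linepath a s)" "path_image (k \<circ> linepath a s) \<subseteq> F"
      using seg kc kF by (auto intro!: path_continuous_image intro: continuous_on_subset simp: path_image_compose)
    show "\<theta> a \<otimes> val (k \<circ> linepath a s) = \<theta> s" "val (k \<circ> linepath a s) \<in> carrier H" "\<theta> a \<in> carrier H"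
      using I.potentialD[OF \<theta>, of "linepath a s"] I.val_closed[of "linepath a s"] seg I.potential_closed[OF \<theta> that(1)]
      by auto
  qed
  have Q: "(0, 0) \<in> Q" "(0, 1) \<in> Q" "(1, 0) \<in> Q" "(1, 1) \<in> Q"
    by (auto simp: Q_def)
  have v0: "val (k \<circ> linepath (0, 0) (0, 1)) = val (h 0)" "val (k \<circ> linepath (1, 0) (1, 1)) = val (h 1)"
    by (rule val_cong[OF v(3,4)]; use Q in \<open>simp add: linepath_def k_def\<close>)+
  moreover have "val (k \<circ> linepath (0, 0) (1, 0)) = val (k \<circ> linepath (0, 1) (1, 1))"
    by (rule val_cong[OF v(3,4)]; use Q in \<open>simp add: linepath_def k_def loop\<close>)
  \<comment> \<open>Both sides are the potential at the corner \<open>(1, 1)\<close>, reached by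
    \<open>h 0\<close> first or by \<open>h 1\<close> last; \<open>x\<close> is the value of the
    track of the base point.\<close>
  ultimately have "\<theta> (0, 0) \<otimes> val (h 0) \<otimes> x = \<theta> (0, 0) \<otimes> x \<otimes> val (h 1)" "x \<in> carrier H"
    if "x = val (k \<circ> linepath (0, 0) (1, 0))" for x
    using v(1,2)[OF Q(1,2)] v(1,2)[OF Q(3,4)] v(1,2)[OF Q(1,3)] v(1,2)[OF Q(2,4)] that by simp_all
  moreover have "val (h 0) \<in> carrier H" "val (h 1) \<in> carrier H" "\<theta> (0, 0) \<in> carrier H"
    using v0 v(2)[OF Q(1,2)] v(2)[OF Q(3,4)] v(5)[OF Q(1,1)] by simp_all
  moreover define x where "x = val (k \<circ> linepath (0, 0) (1, 0))"
  ultimately have *: "\<theta> (0, 0) \<otimes> val (h 0) \<otimes> x = \<theta> (0, 0) \<otimes> x \<otimes> val (h 1)" "x \<in> carrier H"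
    using v(1,2)[OF Q(1,2)] v(1,2)[OF Q(3,4)] v(1,2)[OF Q(1,3)] v(1,2)[OF Q(2,4)] by simp_all
  moreover have "val (h 0) \<in> carrier H" "val (h 1) \<in> carrier H" "\<theta> (0, 0) \<in> carrier H"
    using v0 v(2)[OF Q(1,2)] v(2)[OF Q(3,4)] v(5)[OF Q(1,1)] by simp_all
  ultimately have "\<theta> (0, 0) \<otimes> x \<otimes> val (h 0) = \<theta> (0, 0) \<otimes> x \<otimes> val (h 1)" "\<theta> (0, 0) \<otimes> x \<in> carrier H"
    by (simp_all add: m_assoc m_comm[of x])
  then show ?thesis
    using \<open>val (h 0) \<in> carrier H\<close> \<open>val (h 1) \<in> carrier H\<close> by auto
qed

end

section \<open>Gluing potentials over two relatively open sets\<close>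

context path_functional
begin

lemma potential_cong:
  assumes "potential S \<theta>" "\<And>x. x \<in> S \<Longrightarrow> \<theta> x = \<eta> x"
  shows "potential S \<eta>"
  using assms unfolding potential_def
  by (metis image_cong pathfinish_in_path_image pathstart_in_path_image subsetD)

lemma potential_shift:
  assumes "potential S \<theta>" "k \<in> carrier H" "S \<subseteq> F"
  shows "potential S (\<lambda>x. k \<otimes> \<theta> x)"
  unfolding potential_def
proof (intro conjI allI impI)
  show "(\<lambda>x. k \<otimes> \<theta> x) ` S \<subseteq> carrier H"
    using assms by (auto simp: potential_closed)
  fix c :: "real \<Rightarrow> 'b" assume c: "path c" "path_image c \<subseteq> S"
  then have "\<theta> (pathstart c) \<in> carrier H" "val c \<in> carrier H"
    using assms(3) potential_closed[OF assms(1)] by (auto intro!: val_closed)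
  then show "k \<otimes> \<theta> (pathstart c) \<otimes> val c = k \<otimes> \<theta> (pathfinish c)"
    using assms(2) potentialD[OF assms(1) c] by (simp add: m_assoc)
qed

lemma potential_glue:
  assumes F: "U \<union> V \<subseteq> F"
    and op: "openin (top_of_set (U \<union> V)) U" "openin (top_of_set (U \<union> V)) V"
    and pot: "potential U \<theta>" "potential V \<eta>"
    and k: "k \<in> carrier H" "\<And>z. z \<in> U \<Longrightarrow> z \<in> V \<Longrightarrow> \<theta> z = k \<otimes> \<eta> z"
  shows "\<exists>\<theta>. potential (U \<union> V) \<theta>"
proof -
  define \<psi> where "\<psi> z = (if z \<in> U then \<theta> z else k \<otimes> \<eta> z)" for z
  have "potential U \<psi>"
    by (rule potential_cong[OF pot(1)]) (simp add: \<psi>_def)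
  moreover have "potential V \<psi>"
    by (rule potential_cong[OF potential_shift[OF pot(2) k(1)]]) (use F k in \<open>auto simp: \<psi>_def\<close>)
  ultimately show ?thesis
    using potential_Un[OF F op] by blast
qed

text \<open>Along \<open>c\<close> both potentials change by the same factor \<open>val c\<close>,
  so their quotient is carried from one end to the other.\<close>

lemma potential_diff_const:
  assumes pot: "potential U \<theta>" "potential V \<eta>" and F: "U \<union> V \<subseteq> F"
    and c: "path c" "path_image c \<subseteq> U \<inter> V"
    and k: "k \<in> carrier H" "\<theta> (pathstart c) = k \<otimes> \<eta> (pathstart c)"
  shows "\<theta> (pathfinish c) = k \<otimes> \<eta> (pathfinish c)"
proof -
  have "\<eta> (pathstart c) \<in> carrier H" "val c \<in> carrier H"
    using c F potential_closed[OF pot(2)] by (auto intro!: val_closed)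
  then show ?thesis
    using potentialD[OF pot(1), of c] potentialD[OF pot(2), of c] c k by (simp add: m_assoc)
qed

text \<open>On a path connected overlap the quotient of the two potentials is a constant, and
  rescaling one of them by it makes them agree there.\<close>

lemma potential_glue_path_connected:
  assumes F: "U \<union> V \<subseteq> F"
    and op: "openin (top_of_set (U \<union> V)) U" "openin (top_of_set (U \<union> V)) V"
    and pot: "potential U \<theta>" "potential V \<eta>"
    and conn: "path_connected (U \<inter> V)"
  shows "\<exists>\<theta>. potential (U \<union> V) \<theta>"
proof (cases "U \<inter> V = {}")
  case True
  then show ?thesis
    using potential_glue[OF F op pot one_closed] by blast
next
  case False
  then obtain w where w: "w \<in> U" "w \<in> V" by blast
  define k where "k = \<theta> w \<otimes> inv \<eta> w"
  have "k \<in> carrier H" "\<theta> w = k \<otimes> \<eta> w"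
    using w pot by (auto simp: k_def m_assoc potential_closed)
  moreover have "\<theta> z = k \<otimes> \<eta> z" if z: "z \<in> U" "z \<in> V" for z
  proof -
    obtain c where "path c" "path_image c \<subseteq> U \<inter> V" "pathstart c = w" "pathfinish c = z"
      using conn w z unfolding path_connected_def by blast
    then show ?thesis
      using potential_diff_const[OF pot F, of c k] \<open>k \<in> carrier H\<close> \<open>\<theta> w = k \<otimes> \<eta> w\<close> by auto
  qed
  ultimately show ?thesis
    using potential_glue[OF F op pot] by blast
qed

end

section \<open>Punctured convex sets in the plane\<close>

text \<open>A parallelogram with half diagonals \<open>f\<close> and \<open>h\<close>, which is a
  meridian of \<open>a\<close> when these are real independent. Its two halves between
  \<open>a - h\<close> and \<open>a + h\<close> pass through \<open>a + f\<close> and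
  \<open>a - f\<close>, which suits slits along the line of \<open>f\<close>.\<close>

definition diamond :: "complex \<Rightarrow> complex \<Rightarrow> complex \<Rightarrow> real \<Rightarrow> complex" where
  "diamond a f h = linepath (a - h) (a + f) +++ (linepath (a + f) (a + h) +++
     (linepath (a + h) (a - f) +++ linepath (a - f) (a - h)))"

text \<open>Multiplication by \<open>cnj f\<close> turns the removed ray from \<open>a\<close> into
  the nonnegative reals. Along a segment from \<open>a - f\<close> the imaginary part is
  \<open>t\<close> times that at its end point, so for \<open>t > 0\<close> it vanishes only if the
  whole segment lies on the negative axis.\<close>

lemma slit_starlike:
  assumes K: "convex K" and f: "a - f \<in> K" "f \<noteq> 0"
    and x: "x \<in> {z\<in>K. \<not> (Im ((z - a) * cnj f) = 0 \<and> Re ((z - a) * cnj f) \<ge> 0)}" (is "x \<in> ?U")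
  shows "closed_segment (a - f) x \<subseteq> ?U"
proof
  fix y assume y: "y \<in> closed_segment (a - f) x"
  have "y \<in> K"
    using y closed_segment_subset[OF f(1) _ K] x by blast
  from y obtain t where t: "t \<in> {0..1}" "y = (1 - t) *\<^sub>R (a - f) + t *\<^sub>R x"
    by (auto simp: in_segment)
  define q where "q = (x - a) * cnj f"
  have "(y - a) * cnj f = - of_real ((1 - t) * (cmod f)\<^sup>2) + of_real t * q"
    unfolding t(2) q_def of_real_mult complex_norm_square by (simp add: scaleR_conv_of_real algebra_simps)
  then have im: "Im ((y - a) * cnj f) = t * Im q" and re: "Re ((y - a) * cnj f) = t * Re q - (1 - t) * (cmod f)\<^sup>2"
    by (auto simp del: of_real_mult of_real_power)
  have "\<not> (t * Im q = 0 \<and> t * Re q - (1 - t) * (cmod f)\<^sup>2 \<ge> 0)"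
  proof
    assume *: "t * Im q = 0 \<and> t * Re q - (1 - t) * (cmod f)\<^sup>2 \<ge> 0"
    have "t \<noteq> 0"
      using * f(2) by auto
    then have "Im q = 0" "t > 0"
      using * t by auto
    then have "Re q < 0"
      using x by (auto simp: q_def)
    then have "t * Re q < 0"
      using \<open>t > 0\<close> by (simp add: mult_pos_neg)
    moreover have "(1 - t) * (cmod f)\<^sup>2 \<ge> 0"
      using t(1) by simp
    ultimately show False
      using * by linarith
  qed
  then show "y \<in> ?U"
    unfolding mem_Collect_eq im re using \<open>y \<in> K\<close> by blast
qed

text \<open>For nonzero \<open>f\<close> and \<open>s\<close> this is an open half-plane bounded by
  the line through \<open>a\<close> in direction \<open>f\<close>; the sign of \<open>s\<close>
  selects the side.\<close>

lemma convex_Im_mult_cnj: "convex {z. Im ((z - a) * cnj f) * s > 0}"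
proof (rule convexI)
  fix x y u v assume *: "x \<in> {z. Im ((z - a) * cnj f) * s > 0}" "y \<in> {z. Im ((z - a) * cnj f) * s > 0}"
    and uv: "0 \<le> u" "0 \<le> v" "u + v = (1::real)"
  have eq: "u *\<^sub>R x + v *\<^sub>R y - a = u *\<^sub>R (x - a) + v *\<^sub>R (y - a)"
  proof -
    have "a = u *\<^sub>R a + v *\<^sub>R a"
      by (simp add: scaleR_left_distrib[symmetric] uv(3))
    then show ?thesis
      unfolding scaleR_diff_right by (metis add_diff_add)
  qed
  have "Im ((u *\<^sub>R x + v *\<^sub>R y - a) * cnj f) * s = u * (Im ((x - a) * cnj f) * s) + v * (Im ((y - a) * cnj f) * s)"
    unfolding eq by (simp add: algebra_simps)
  moreover have "\<dots> > 0"
  proof (cases "u = 0")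
    case True
    then show ?thesis using * uv by simp
  next
    case False
    then show ?thesis using * uv by (intro add_pos_nonneg) auto
  qed
  ultimately show "u *\<^sub>R x + v *\<^sub>R y \<in> {z. Im ((z - a) * cnj f) * s > 0}"
    by simp
qed

text \<open>Slits along two opposite rays give starlike pieces \<open>U\<close> and \<open>V\<close>
  that cover \<open>K - {a}\<close> and overlap in the two sides of the line of \<open>f\<close>. On
  each side the two potentials differ by a constant. The diamond goes from one side to the other
  within \<open>V\<close> and returns within \<open>U\<close>, so its trivial value makes the two
  constants equal. Having this for all small \<open>r\<close> lets the diamond be shrunk into
  \<open>K\<close>.\<close>

lemma potential_punctured_convex:
  assumes pf: "path_functional H F val" and K: "convex K" "a \<in> interior K" "K - {a} \<subseteq> F"
    and ind: "Im (h * cnj f) \<noteq> 0"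
    and dia: "\<forall>\<^sub>F r in at_right 0. val (diamond a (r *\<^sub>R f) (r *\<^sub>R h)) = \<one>\<^bsub>H\<^esub>"
  shows "\<exists>\<theta>. path_functional.potential H val (K - {a}) \<theta>"
proof -
  interpret path_functional H F val by fact
  obtain e where e: "e > 0" "ball a e \<subseteq> K"
    using K(2) by (auto simp: mem_interior)
  have f0: "f \<noteq> 0" and h0: "h \<noteq> 0"
    using ind by auto
  have "\<forall>\<^sub>F r in at_right 0. r < e / norm f" "\<forall>\<^sub>F r in at_right 0. r < e / norm h"
    using e f0 h0 by (auto intro!: eventually_at_right_less order_tendstoD simp: tendsto_ident_at)
  moreover have "\<forall>\<^sub>F r in at_right 0. r > (0::real)"
    by (rule eventually_at_right_less)
  ultimately have "\<forall>\<^sub>F r in at_right 0. r > 0 \<and> r < e / norm f \<and> r < e / norm h \<and>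
      val (diamond a (r *\<^sub>R f) (r *\<^sub>R h)) = \<one>\<^bsub>H\<^esub>"
    using dia by eventually_elim auto
  then obtain r where r: "r > 0" "r < e / norm f" "r < e / norm h"
      "val (diamond a (r *\<^sub>R f) (r *\<^sub>R h)) = \<one>\<^bsub>H\<^esub>"
    using eventually_happens'[OF trivial_limit_at_right_real] by blast
  define f' h' where "f' = r *\<^sub>R f" and "h' = r *\<^sub>R h"
  have "norm f' < e" "norm h' < e"
    using r f0 h0 by (auto simp: f'_def h'_def field_simps)
  then have inK: "a - f' \<in> K" "a + f' \<in> K" "a - h' \<in> K" "a + h' \<in> K"
    using e(2) by (auto simp: dist_norm subset_iff)
  have f'0: "f' \<noteq> 0"
    using f0 r by (simp add: f'_def)
  have ind': "Im (h' * cnj f') \<noteq> 0"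
  proof -
    have "h' * cnj f' = of_real (r * r) * (h * cnj f)"
      by (simp add: f'_def h'_def scaleR_conv_of_real)
    then show ?thesis
      using ind r(1) by (simp del: of_real_mult)
  qed
  define U where "U = {z\<in>K. \<not> (Im ((z - a) * cnj f') = 0 \<and> Re ((z - a) * cnj f') \<ge> 0)}"
  define V where "V = {z\<in>K. \<not> (Im ((z - a) * cnj f') = 0 \<and> Re ((z - a) * cnj f') \<le> 0)}"
  have Vneg: "V = {z\<in>K. \<not> (Im ((z - a) * cnj (- f')) = 0 \<and> Re ((z - a) * cnj (- f')) \<ge> 0)}"
    unfolding V_def by (auto simp: algebra_simps)
  have starU: "closed_segment (a - f') x \<subseteq> U" if "x \<in> U" for x
    using slit_starlike[OF K(1) inK(1) f'0] that unfolding U_def by blast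
  have starV: "closed_segment (a + f') x \<subseteq> V" if "x \<in> V" for x
    using slit_starlike[OF K(1), of a "- f'" x] inK(2) f'0 that unfolding Vneg by simp
  have UV: "U \<union> V = K - {a}"
  proof -
    have "z = a" if "Im ((z - a) * cnj f') = 0" "Re ((z - a) * cnj f') = 0" for z
    proof -
      have "(z - a) * cnj f' = 0"
        using that by (simp add: complex_eq_iff)
      then show ?thesis
        using f'0 by simp
    qed
    then show ?thesis
      by (auto simp: U_def V_def)
  qed
  have F: "U \<union> V \<subseteq> F"
    using UV K(3) by simp
  define \<theta> where "\<theta> x = val (linepath (a - f') x)" for x
  define \<eta> where "\<eta> x = val (linepath (a + f') x)" for x
  have pot: "potential U \<theta>" "potential V \<eta>"
    unfolding \<theta>_def \<eta>_def
    by (rule potential_starlike[OF pf]; use F starU starV in blast)+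
  have op: "openin (top_of_set (U \<union> V)) U" "openin (top_of_set (U \<union> V)) V"
  proof -
    have cl: "closed {z. Im ((z - a) * cnj f') = 0 \<and> Re ((z - a) * cnj f') \<ge> 0}"
      "closed {z. Im ((z - a) * cnj f') = 0 \<and> Re ((z - a) * cnj f') \<le> 0}"
      by (intro closed_Collect_conj closed_Collect_eq closed_Collect_le continuous_intros)+
    have "U = (U \<union> V) \<inter> - {z. Im ((z - a) * cnj f') = 0 \<and> Re ((z - a) * cnj f') \<ge> 0}"
      "V = (U \<union> V) \<inter> - {z. Im ((z - a) * cnj f') = 0 \<and> Re ((z - a) * cnj f') \<le> 0}"
      by (auto simp: U_def V_def)
    then show "openin (top_of_set (U \<union> V)) U" "openin (top_of_set (U \<union> V)) V"
      using openin_open_Int[OF open_Compl[OF cl(1)], of "U \<union> V"] openin_open_Int[OF open_Compl[OF cl(2)], of "U \<union> V"]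
      by argo+
  qed
  have hUV: "a - h' \<in> U" "a - h' \<in> V" "a + h' \<in> U" "a + h' \<in> V"
    using ind' inK by (auto simp: U_def V_def)
  \<comment> \<open>The constant on the side of \<open>a - h'\<close>; \<open>kp\<close> shows that
    the side of \<open>a + h'\<close> has the same one.\<close>
  define k where "k = \<theta> (a - h') \<otimes>\<^bsub>H\<^esub> inv\<^bsub>H\<^esub> \<eta> (a - h')"
  have k: "k \<in> carrier H" and km: "\<theta> (a - h') = k \<otimes>\<^bsub>H\<^esub> \<eta> (a - h')"
    using hUV pot by (auto simp: k_def m_assoc potential_closed)
  have kp: "\<theta> (a + h') = k \<otimes>\<^bsub>H\<^esub> \<eta> (a + h')"
  proof -
    define c where "c = linepath (a - h') (a + f') +++ linepath (a + f') (a + h')"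
    define d where "d = linepath (a + h') (a - f') +++ linepath (a - f') (a - h')"
    have l: "closed_segment (a - h') (a + f') \<subseteq> V" "closed_segment (a + f') (a + h') \<subseteq> V"
      "closed_segment (a + h') (a - f') \<subseteq> U" "closed_segment (a - f') (a - h') \<subseteq> U"
      using starU[OF hUV(1)] starU[OF hUV(3)] starV[OF hUV(2)] starV[OF hUV(4)]
        closed_segment_commute[of "a - h'" "a + f'"] closed_segment_commute[of "a + h'" "a - f'"] by argo+
    have c: "path c" "path_image c \<subseteq> V" "pathstart c = a - h'" "pathfinish c = a + h'"
      and d: "path d" "path_image d \<subseteq> U" "pathstart d = a + h'" "pathfinish d = a - h'"
      using l by (auto simp: c_def d_def path_image_join)
    have lF: "closed_segment (a - h') (a + f') \<subseteq> F" "closed_segment (a + f') (a + h') \<subseteq> F"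
      "closed_segment (a + h') (a - f') \<subseteq> F" "closed_segment (a - f') (a - h') \<subseteq> F"
      using l F by blast+
    have "val (diamond a f' h') = val c \<otimes>\<^bsub>H\<^esub> val d"
      unfolding diamond_def c_def d_def using lF
      by (simp add: val_join path_image_join m_assoc)
    then have cd: "val c \<otimes>\<^bsub>H\<^esub> val d = \<one>\<^bsub>H\<^esub>"
      using r(4) by (simp add: f'_def h'_def)
    have cl: "val c \<in> carrier H" "val d \<in> carrier H" "\<theta> (a + h') \<in> carrier H" "\<eta> (a + h') \<in> carrier H"
      "\<theta> (a - h') \<in> carrier H" "\<eta> (a - h') \<in> carrier H"
      using c d F hUV pot by (auto simp: potential_closed)
    have "\<theta> (a + h') \<otimes>\<^bsub>H\<^esub> val d = \<theta> (a - h')" "\<eta> (a - h') \<otimes>\<^bsub>H\<^esub> val c = \<eta> (a + h')"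
      using potentialD[OF pot(1) d(1,2)] potentialD[OF pot(2) c(1,2)] c d by auto
    then have "\<theta> (a + h') \<otimes>\<^bsub>H\<^esub> val d = k \<otimes>\<^bsub>H\<^esub> \<eta> (a - h')"
      using km by simp
    also have "\<dots> = k \<otimes>\<^bsub>H\<^esub> \<eta> (a - h') \<otimes>\<^bsub>H\<^esub> (val c \<otimes>\<^bsub>H\<^esub> val d)"
      using cd k cl by simp
    also have "\<dots> = (k \<otimes>\<^bsub>H\<^esub> (\<eta> (a - h') \<otimes>\<^bsub>H\<^esub> val c)) \<otimes>\<^bsub>H\<^esub> val d"
      using k cl by (simp add: m_assoc)
    also have "\<dots> = k \<otimes>\<^bsub>H\<^esub> \<eta> (a + h') \<otimes>\<^bsub>H\<^esub> val d"
      using \<open>\<eta> (a - h') \<otimes>\<^bsub>H\<^esub> val c = \<eta> (a + h')\<close> by simp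
    finally show ?thesis
      using cl k by auto
  qed
  have "\<theta> z = k \<otimes>\<^bsub>H\<^esub> \<eta> z" if z: "z \<in> U" "z \<in> V" for z
  proof -
    define s where "s = Im ((z - a) * cnj f')"
    define \<sigma> where "\<sigma> = Im (h' * cnj f')"
    have "s \<noteq> 0" "\<sigma> \<noteq> 0"
      using z ind' by (auto simp: U_def V_def s_def \<sigma>_def)
    \<comment> \<open>A vertex on the same side of the slit line as \<open>z\<close>, so that the
      segment between them stays in the overlap.\<close>
    have "\<exists>w\<in>{a - h', a + h'}. Im ((w - a) * cnj f') * s > 0"
    proof (cases "\<sigma> * s > 0")
      case True
      then show ?thesis
        by (intro bexI[of _ "a + h'"]) (auto simp: \<sigma>_def)
    next
      case False
      then have "- \<sigma> * s > 0"
        using \<open>s \<noteq> 0\<close> \<open>\<sigma> \<noteq> 0\<close> by (metis mult_eq_0_iff mult_minus_left neg_0_less_iff_less not_less_iff_gr_or_eq)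
      then show ?thesis
        by (intro bexI[of _ "a - h'"]) (auto simp: \<sigma>_def)
    qed
    then obtain w where w: "w \<in> {a - h', a + h'}" "Im ((w - a) * cnj f') * s > 0"
      by blast
    have "closed_segment w z \<subseteq> {z. Im ((z - a) * cnj f') * s > 0}"
    proof (intro closed_segment_subset convex_Im_mult_cnj)
      show "w \<in> {z. Im ((z - a) * cnj f') * s > 0}"
        using w(2) by blast
      show "z \<in> {z. Im ((z - a) * cnj f') * s > 0}"
        unfolding mem_Collect_eq s_def[symmetric] using \<open>s \<noteq> 0\<close> by (metis not_real_square_gt_zero)
    qed
    moreover have "closed_segment w z \<subseteq> K"
      using w(1) inK z K(1) by (intro closed_segment_subset) (auto simp: U_def)
    ultimately have "closed_segment w z \<subseteq> U \<inter> V"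
      by (force simp: U_def V_def)
    then show ?thesis
      using potential_diff_const[OF pot F, of "linepath w z" k] w(1) k km kp by auto
  qed
  then show ?thesis
    using potential_glue[OF F op pot k] UV by metis
qed

text \<open>Induction on the number of punctures in \<open>K\<close>. If there are two of them,
  \<open>a\<close> and \<open>b\<close>, then \<open>K\<close> is covered by two convex pieces
  bounded by lines orthogonal to \<open>b - a\<close>, each with fewer punctures, whose overlap is a
  strip without punctures.\<close>

lemma potential_convex_minus_finite:
  assumes pf: "path_functional H F val" and A: "finite A"
    and K: "convex K" "K - A \<subseteq> F" "A \<inter> K \<subseteq> interior K"
    and dia: "\<And>a. a \<in> A \<inter> K \<Longrightarrow> \<exists>f h. Im (h * cnj f) \<noteq> 0 \<and>
       (\<forall>\<^sub>F r in at_right 0. val (diamond a (r *\<^sub>R f) (r *\<^sub>R h)) = \<one>\<^bsub>H\<^esub>)"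
  shows "\<exists>\<theta>. path_functional.potential H val (K - A) \<theta>"
  using K dia
proof (induction "card (A \<inter> K)" arbitrary: K rule: less_induct)
  case less
  interpret path_functional H F val by fact
  consider "A \<inter> K = {}" | a where "A \<inter> K = {a}" | a b where "a \<in> A \<inter> K" "b \<in> A \<inter> K" "a \<noteq> b"
    by blast
  then show ?case
  proof cases
    case 1
    show ?thesis
    proof (cases "K = {}")
      case True
      then show ?thesis by (auto simp: potential_def)
    next
      case False
      then obtain a where "a \<in> K" by blast
      moreover have "K - A = K"
        using 1 by blast
      ultimately show ?thesis
        using potential_starlike[OF pf, of K a] less.prems by (auto simp: closed_segment_subset)
    qed
  next
    case (2 a)
    then have "K - A = K - {a}" by blast
    moreover have a: "a \<in> interior K" "a \<in> A \<inter> K"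
      using less.prems(3) 2 by auto
    moreover obtain f h where "Im (h * cnj f) \<noteq> 0"
        "\<forall>\<^sub>F r in at_right 0. val (diamond a (r *\<^sub>R f) (r *\<^sub>R h)) = \<one>\<^bsub>H\<^esub>"
      using less.prems(4)[OF a(2)] by blast
    ultimately show ?thesis
      using potential_punctured_convex[OF pf less.prems(1) a(1), of h f] less.prems(2) by simp
  next
    case (3 a b)
    define d where "d = b - a"
    have "b \<bullet> d - a \<bullet> d = d \<bullet> d"
      by (simp add: d_def inner_diff_left)
    then have ab: "a \<bullet> d < b \<bullet> d"
      using 3(3) by (metis d_def diff_gt_0_iff_gt inner_gt_zero_iff right_minus_eq)
    define B where "B = (\<lambda>z. z \<bullet> d) ` {z \<in> A \<inter> K. z \<bullet> d < b \<bullet> d}"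
    \<comment> \<open>The greatest height below that of \<open>b\<close> at which there is a
      puncture: the strip between the two heights is free of punctures, \<open>K1\<close> misses
      \<open>b\<close>, and \<open>K2\<close> misses \<open>a\<close> because
      \<open>a \<bullet> d \<le> c\<close>.\<close>
    define c where "c = Max B"
    have B: "finite B" "a \<bullet> d \<in> B"
      using A 3 ab by (auto simp: B_def)
    then have "c \<in> B"
      unfolding c_def by (intro Max_in) auto
    then have cb: "c < b \<bullet> d"
      by (auto simp: B_def)
    have ac: "a \<bullet> d \<le> c"
      using B by (simp add: c_def)
    define K1 where "K1 = K \<inter> {z. z \<bullet> d < b \<bullet> d}"
    define K2 where "K2 = K \<inter> {z. z \<bullet> d > c}"
    have o: "open {z. z \<bullet> d < b \<bullet> d}" "open {z. z \<bullet> d > c}"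
      by (auto intro!: open_Collect_less continuous_intros)
    have cv: "convex {z. z \<bullet> d < b \<bullet> d}" "convex {z. z \<bullet> d > c}"
      using convex_halfspace_lt[of d "b \<bullet> d"] convex_halfspace_gt[where a=d and b=c] by (auto simp: inner_commute)
    have pot: "\<exists>\<theta>. potential (L - A) \<theta>"
      if L: "L = K \<inter> S" "open S" "convex S" "x \<in> A \<inter> K" "x \<notin> S" for L S x
    proof (rule less.hyps)
      show "card (A \<inter> L) < card (A \<inter> K)"
        using A L by (intro psubset_card_mono) auto
      show "convex L" "L - A \<subseteq> F"
        using less.prems L by (auto intro: convex_Int)
      show "A \<inter> L \<subseteq> interior L"
        using less.prems(3) L by (auto simp: interior_open)
      show "\<exists>f h. Im (h * cnj f) \<noteq> 0 \<and> (\<forall>\<^sub>F r in at_right 0. val (diamond a (r *\<^sub>R f) (r *\<^sub>R h)) = \<one>\<^bsub>H\<^esub>)"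
        if "a \<in> A \<inter> L" for a
        using less.prems(4) that L by auto
    qed
    obtain \<theta> \<eta> where \<theta>: "potential (K1 - A) \<theta>" and \<eta>: "potential (K2 - A) \<eta>"
      using pot[OF K1_def o(1) cv(1) 3(2)] pot[OF K2_def o(2) cv(2) 3(1)] ac by auto
    have un: "(K1 - A) \<union> (K2 - A) = K - A"
      using cb by (auto simp: K1_def K2_def)
    have "z \<notin> A" if "z \<in> K1" "z \<in> K2" for z
    proof
      assume "z \<in> A"
      then have "z \<bullet> d \<in> B"
        using that by (auto simp: B_def K1_def)
      then have "z \<bullet> d \<le> c"
        using B by (simp add: c_def)
      then show False
        using that by (simp add: K2_def)
    qed
    then have "(K1 - A) \<inter> (K2 - A) = K1 \<inter> K2"
      by blast
    moreover have "convex (K1 \<inter> K2)"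
      using less.prems(1) cv by (simp add: K1_def K2_def convex_Int)
    ultimately have conn: "path_connected ((K1 - A) \<inter> (K2 - A))"
      by (simp add: convex_imp_path_connected)
    have "K1 - A = (K - A) \<inter> {z. z \<bullet> d < b \<bullet> d}" "K2 - A = (K - A) \<inter> {z. z \<bullet> d > c}"
      by (auto simp: K1_def K2_def)
    then have op: "openin (top_of_set ((K1 - A) \<union> (K2 - A))) (K1 - A)"
      "openin (top_of_set ((K1 - A) \<union> (K2 - A))) (K2 - A)"
      unfolding un using openin_open_Int[OF o(1), of "K - A"] openin_open_Int[OF o(2), of "K - A"] by argo+
    show ?thesis
      using potential_glue_path_connected[OF _ op \<theta> \<eta> conn] less.prems(2) unfolding un by blast
  qed
qed

section \<open>Homotopy classes of paths\<close>

definition path_in :: "'a::topological_space set \<Rightarrow> 'a \<Rightarrow> (real \<Rightarrow> 'a) \<Rightarrow> 'a \<Rightarrow> bool" where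
  "path_in X x c y \<longleftrightarrow> path c \<and> path_image c \<subseteq> X \<and> pathstart c = x \<and> pathfinish c = y"

lemma path_in_join: "path_in X x c y \<Longrightarrow> path_in X y d z \<Longrightarrow> path_in X x (c +++ d) z"
  by (auto simp: path_in_def path_image_join)

lemma path_in_reverse: "path_in X x c y \<Longrightarrow> path_in X y (reversepath c) x"
  by (auto simp: path_in_def)

lemma path_in_compose:
  assumes "path_in X x c y" "continuous_on X f" "f \<in> X \<rightarrow> Y"
  shows "path_in Y (f x) (f \<circ> c) (f y)"
  using assms unfolding path_in_def
  by (auto simp: pathstart_compose pathfinish_compose path_image_compose
           intro!: path_continuous_image intro: continuous_on_subset)

lemma path_in_loop: "c \<in> loops_at X x \<longleftrightarrow> path_in X x c x"
  by (auto simp: loops_at_def path_in_def)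

lemma homotopic_join:
  assumes "homotopic_paths X c c'" "homotopic_paths X d d'" "path_in X x c y" "path_in X y d z"
  shows "homotopic_paths X (c +++ d) (c' +++ d')"
  using assms by (intro homotopic_paths_join) (auto simp: path_in_def)

lemma homotopic_refl: "path_in X x c y \<Longrightarrow> homotopic_paths X c c"
  by (auto simp: path_in_def)

lemma homotopic_assoc:
  assumes "path_in X x c y" "path_in X y d z" "path_in X z e w"
  shows "homotopic_paths X ((c +++ d) +++ e) (c +++ (d +++ e))"
  using assms by (intro homotopic_paths_sym[OF homotopic_paths_assoc]) (auto simp: path_in_def)

lemma homotopic_cancel_left:
  assumes d: "path_in X x d y" and e: "path_in X y e z"
  shows "homotopic_paths X (reversepath d +++ (d +++ e)) e"
proof -
  note d' = path_in_reverse[OF d]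
  have "homotopic_paths X (reversepath d +++ (d +++ e)) ((reversepath d +++ d) +++ e)"
    by (rule homotopic_paths_sym[OF homotopic_assoc[OF d' d e]])
  moreover have "homotopic_paths X ((reversepath d +++ d) +++ e) ((\<lambda>_. y) +++ e)"
    by (rule homotopic_join[OF _ homotopic_refl[OF e] path_in_join[OF d' d] e])
       (use d in \<open>auto simp: path_in_def intro!: homotopic_paths_reverse_left\<close>)
  moreover have "homotopic_paths X ((\<lambda>_. y) +++ e) e"
    using e by (intro homotopic_paths_const_left) (auto simp: path_in_def)
  ultimately show ?thesis
    by (meson homotopic_paths_trans)
qed

lemma homotopic_cancel_left':
  assumes d: "path_in X x d y" and e: "path_in X x e z"
  shows "homotopic_paths X (d +++ (reversepath d +++ e)) e"
  using homotopic_cancel_left[OF path_in_reverse[OF d] e] by simp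

lemma homotopic_cancel_right:
  assumes c: "path_in X x c y" and d: "path_in X y d z"
  shows "homotopic_paths X ((c +++ d) +++ reversepath d) c"
proof -
  have "homotopic_paths X (reversepath (reversepath d) +++ (reversepath d +++ reversepath c)) (reversepath c)"
    by (rule homotopic_cancel_left[OF path_in_reverse[OF d] path_in_reverse[OF c]])
  then have "homotopic_paths X (reversepath (reversepath (reversepath d) +++ (reversepath d +++ reversepath c))) c"
    using homotopic_paths_reversepath by fastforce
  moreover have "reversepath (reversepath (reversepath d) +++ (reversepath d +++ reversepath c)) = (c +++ d) +++ reversepath d"
    using c d by (simp add: reversepath_joinpaths path_in_def)
  ultimately show ?thesis by simp
qed

lemma homotopic_cancel_right':
  assumes c: "path_in X x c y" and d: "path_in X z d y"
  shows "homotopic_paths X ((c +++ reversepath d) +++ d) c"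
  using homotopic_cancel_right[OF c path_in_reverse[OF d]] by simp

text \<open>The inner \<open>reversepath b\<close> and \<open>b\<close> cancel. Closing paths up by
  fixed connecting paths is thus compatible with joining, both for the functional on all paths and
  for the automorphism below.\<close>

lemma homotopic_conj_join:
  assumes a: "path_in X p a x" and c: "path_in X x c y" and b: "path_in X p b y"
    and d: "path_in X y d z" and e: "path_in X p e z"
  shows "homotopic_paths X ((a +++ (c +++ reversepath b)) +++ (b +++ (d +++ reversepath e)))
           (a +++ ((c +++ d) +++ reversepath e))"
proof -
  note b' = path_in_reverse[OF b] and e' = path_in_reverse[OF e]
  note j = path_in_join
  note r = homotopic_refl
  have "homotopic_paths X ((a +++ (c +++ reversepath b)) +++ (b +++ (d +++ reversepath e)))
     (a +++ ((c +++ reversepath b) +++ (b +++ (d +++ reversepath e))))"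
    by (rule homotopic_assoc[OF a j[OF c b'] j[OF b j[OF d e']]])
  moreover have "homotopic_paths X (a +++ ((c +++ reversepath b) +++ (b +++ (d +++ reversepath e))))
     (a +++ (c +++ (reversepath b +++ (b +++ (d +++ reversepath e)))))"
    by (rule homotopic_join[OF r[OF a] homotopic_assoc[OF c b' j[OF b j[OF d e']]] a])
       (rule j[OF j[OF c b'] j[OF b j[OF d e']]])
  moreover have "homotopic_paths X (a +++ (c +++ (reversepath b +++ (b +++ (d +++ reversepath e)))))
     (a +++ (c +++ (d +++ reversepath e)))"
    by (rule homotopic_join[OF r[OF a] homotopic_join[OF r[OF c]] a])
       (rule homotopic_cancel_left[OF b j[OF d e']] c j b' b d e')+
  moreover have "homotopic_paths X (a +++ (c +++ (d +++ reversepath e))) (a +++ ((c +++ d) +++ reversepath e))"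
    by (rule homotopic_join[OF r[OF a] homotopic_paths_sym[OF homotopic_assoc[OF c d e']] a])
       (rule j[OF c j[OF d e']])
  ultimately show ?thesis
    by (meson homotopic_paths_trans)
qed

section \<open>The fundamental group: its abelianization as a path functional, and its
  automorphisms\<close>

lemma path_class_eqI: "homotopic_paths X c d \<Longrightarrow> path_class X c = path_class X d"
  using path_class_eq_iff homotopic_paths_imp_path homotopic_paths_imp_subset by metis

text \<open>An arbitrary path is closed up by chosen paths from \<open>x\<close> to its ends and
  then sent to the abelianization. For a loop at \<open>x\<close> this amounts to conjugation by the
  path chosen for \<open>x\<close> itself, which disappears in a commutative group.\<close>

lemma fundamental_group_path_functional:
  fixes X :: "'a::topological_space set"
  assumes x: "x \<in> X"
  obtains val where "path_functional (abelianization (fundamental_group X x)) X val"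
    "\<And>c. c \<in> loops_at X x \<Longrightarrow> val c = ab_class (fundamental_group X x) (path_class X c)"
proof -
  define G where "G = fundamental_group X x"
  interpret G: group G
    unfolding G_def by (rule group_fundamental_group[OF x])
  interpret A: comm_group "abelianization G"
    unfolding abelianization_def by (rule G.derived_quot_is_comm_group)
  have carG: "carrier G = path_class X ` loops_at X x"
    by (simp add: G_def fundamental_group_def)
  define R where "R y \<longleftrightarrow> (\<exists>d. path_in X x d y)" for y
  define \<delta> where "\<delta> y = (SOME d. path_in X x d y)" for y
  have \<delta>: "path_in X x (\<delta> y) y" if "R y" for y
    using that unfolding R_def \<delta>_def by (rule someI_ex)
  have R: "R y \<longleftrightarrow> R z" if "path_in X y c z" for c y z
    using that unfolding R_def by (meson path_in_join path_in_reverse)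
  define \<kappa> where "\<kappa> c = \<delta> (pathstart c) +++ (c +++ reversepath (\<delta> (pathfinish c)))" for c
  have \<kappa>: "\<kappa> c \<in> loops_at X x" if "path_in X y c z" "R y" for c y z
    using that R[OF that(1)] \<delta>[of y] \<delta>[of z] unfolding path_in_loop \<kappa>_def
    by (intro path_in_join path_in_reverse) (auto simp: path_in_def)
  \<comment> \<open>Paths outside the path component of \<open>x\<close> get the value one. As
    \<open>R\<close> is invariant along paths, a join never mixes the two cases.\<close>
  define val where "val c = (if R (pathstart c) then ab_class G (path_class X (\<kappa> c)) else \<one>\<^bsub>abelianization G\<^esub>)" for c
  have cl: "ab_class G (path_class X c) \<in> carrier (abelianization G)" if "c \<in> loops_at X x" for c
    using that by (auto simp: G.abelianization_carrier carG)
  have mult: "ab_class G (path_class X c) \<otimes>\<^bsub>abelianization G\<^esub> ab_class G (path_class X d) =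
      ab_class G (path_class X (c +++ d))" if "c \<in> loops_at X x" "d \<in> loops_at X x" for c d
  proof -
    have "path_class X c \<otimes>\<^bsub>G\<^esub> path_class X d = path_class X (c +++ d)"
      using fundamental_group_mult[OF that] by (simp add: G_def)
    then show ?thesis
      using that by (simp add: G.abelianization_mult carG)
  qed
  have pi: "path_in X (pathstart c) c (pathfinish c)" if "path c" "path_image c \<subseteq> X" for c
    using that by (simp add: path_in_def)
  have "path_functional (abelianization G) X val"
  proof
    show "val c \<in> carrier (abelianization G)" if "path c" "path_image c \<subseteq> X" for c
      using \<kappa>[OF pi[OF that]] cl by (auto simp: val_def)
    show "val (c +++ d) = val c \<otimes>\<^bsub>abelianization G\<^esub> val d"
      if c: "path c" "path_image c \<subseteq> X" and d: "path d" "path_image d \<subseteq> X" and cd: "pathfinish c = pathstart d" for c d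
    proof (cases "R (pathstart c)")
      case True
      have Rd: "R (pathstart d)" "R (pathfinish d)"
        using True R[OF pi[OF c]] R[OF pi[OF d]] cd by auto
      have "homotopic_paths X (\<kappa> c +++ \<kappa> d) (\<kappa> (c +++ d))"
        unfolding \<kappa>_def cd pathstart_join pathfinish_join
        by (rule homotopic_conj_join[OF \<delta>[OF True] _ \<delta>[OF Rd(1)] pi[OF d] \<delta>[OF Rd(2)]])
           (use pi[OF c] cd in simp)
      then have "path_class X (\<kappa> (c +++ d)) = path_class X (\<kappa> c +++ \<kappa> d)"
        using path_class_eqI by metis
      then show ?thesis
        using True Rd mult[OF \<kappa>[OF pi[OF c] True] \<kappa>[OF pi[OF d] Rd(1)]] by (simp add: val_def)
    next
      case False
      then show ?thesis
        using R[OF pi[OF c]] cd by (simp add: val_def)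
    qed
    show "val c = val d" if h: "homotopic_paths X c d" for c d
    proof (cases "R (pathstart c)")
      case True
      have c: "path c" "path_image c \<subseteq> X"
        using h homotopic_paths_imp_path homotopic_paths_imp_subset by blast+
      have ends: "pathstart c = pathstart d" "pathfinish c = pathfinish d"
        using h homotopic_paths_imp_pathstart homotopic_paths_imp_pathfinish by blast+
      have Rf: "R (pathfinish c)"
        using True R[OF pi[OF c]] by auto
      have "homotopic_paths X (\<kappa> c) (\<kappa> d)"
        unfolding \<kappa>_def ends[symmetric]
        by (intro homotopic_join[OF homotopic_refl[OF \<delta>[OF True]] homotopic_join[OF h homotopic_refl]])
           (rule \<delta>[OF True] \<delta>[OF Rf] pi[OF c] path_in_join path_in_reverse)+
      then show ?thesis
        using path_class_eqI[of X "\<kappa> c" "\<kappa> d"] ends by (simp add: val_def)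
    next
      case False
      then show ?thesis
        using homotopic_paths_imp_pathstart[OF h] by (simp add: val_def)
    qed
  qed
  moreover have "val c = ab_class G (path_class X c)" if c: "c \<in> loops_at X x" for c
  proof -
    have ends: "pathstart c = x" "pathfinish c = x" "path_in X x c x"
      using c by (auto simp: loops_at_def path_in_def)
    have "R x"
      using ends unfolding R_def by blast
    then have d: "\<delta> x \<in> loops_at X x" "reversepath (\<delta> x) \<in> loops_at X x"
      using \<delta>[of x] path_in_loop path_in_reverse by blast+
    let ?a = "\<lambda>c. ab_class G (path_class X c)"
    have "homotopic_paths X (\<delta> x +++ reversepath (\<delta> x)) (\<lambda>_. x)"
      using homotopic_paths_reverse_left[of "reversepath (\<delta> x)" X x] d(2) by (auto simp: loops_at_def)
    then have "?a (\<delta> x +++ reversepath (\<delta> x)) = ?a (\<lambda>_. x)"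
      using path_class_eqI by metis
    also have "path_class X (\<lambda>_. x) = \<one>\<^bsub>G\<^esub>"
      by (simp add: G_def fundamental_group_def)
    also have "ab_class G \<one>\<^bsub>G\<^esub> = \<one>\<^bsub>abelianization G\<^esub>"
      by (simp add: ab_class_def abelianization_def FactGroup_def G.derived_in_carrier G.coset_mult_one)
    finally have dd: "?a (\<delta> x) \<otimes>\<^bsub>abelianization G\<^esub> ?a (reversepath (\<delta> x)) = \<one>\<^bsub>abelianization G\<^esub>"
      using mult[OF d] by simp
    have "val c = ?a (\<delta> x) \<otimes>\<^bsub>abelianization G\<^esub> (?a c \<otimes>\<^bsub>abelianization G\<^esub> ?a (reversepath (\<delta> x)))"
      using \<open>R x\<close> ends mult[OF d(1) loops_at_join[OF c d(2)]] mult[OF c d(2)] by (simp add: val_def \<kappa>_def)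
    also have "\<dots> = ?a c \<otimes>\<^bsub>abelianization G\<^esub> (?a (\<delta> x) \<otimes>\<^bsub>abelianization G\<^esub> ?a (reversepath (\<delta> x)))"
      using cl[OF d(1)] cl[OF d(2)] cl[OF c] by (simp add: A.m_lcomm)
    finally show ?thesis
      using dd cl[OF c] by simp
  qed
  ultimately show thesis
    using that unfolding G_def by blast
qed

text \<open>The homeomorphism \<open>f\<close> with inverse \<open>g\<close> moves loops at
  \<open>x\<close> to loops at \<open>f x\<close>, and conjugation by \<open>\<gamma>\<close> brings
  them back to \<open>x\<close>.\<close>

lemma fundamental_group_auto:
  fixes X :: "'a::topological_space set"
  assumes f: "continuous_on X f" "f \<in> X \<rightarrow> X" and g: "continuous_on X g" "g \<in> X \<rightarrow> X"
    and gf: "\<And>y. y \<in> X \<Longrightarrow> g (f y) = y" and fg: "\<And>y. y \<in> X \<Longrightarrow> f (g y) = y"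
    and \<gamma>: "path_in X x \<gamma> (f x)"
  obtains \<phi> where "\<phi> \<in> auto (fundamental_group X x)"
    "\<And>c. c \<in> loops_at X x \<Longrightarrow> \<phi> (path_class X c) = path_class X (\<gamma> +++ ((f \<circ> c) +++ reversepath \<gamma>))"
proof -
  let ?G = "fundamental_group X x"
  have car: "carrier ?G = path_class X ` loops_at X x"
    by (simp add: fundamental_group_def)
  have x: "x \<in> X"
    using \<gamma> by (auto simp: path_in_def)
  note j = path_in_join and rev = path_in_reverse and r = homotopic_refl
  define T where "T c = \<gamma> +++ ((f \<circ> c) +++ reversepath \<gamma>)" for c
  have fc: "path_in X (f y) (f \<circ> c) (f z)" if "path_in X y c z" for y c z
    using path_in_compose[OF that f] .
  have gc: "path_in X (g y) (g \<circ> c) (g z)" if "path_in X y c z" for y c z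
    using path_in_compose[OF that g] .
  have T: "path_in X x (T c) x" if "path_in X x c x" for c
    unfolding T_def by (intro j[OF \<gamma>] j[OF fc[OF that]] rev[OF \<gamma>])
  have T_cong: "homotopic_paths X (T c) (T d)" if "path_in X x c x" "homotopic_paths X c d" for c d
    unfolding T_def
    by (rule homotopic_join[OF r[OF \<gamma>] homotopic_join[OF homotopic_paths_continuous_image[OF that(2) f] r[OF rev[OF \<gamma>]]]])
       (rule \<gamma> j fc rev that)+
  \<comment> \<open>Group elements are sets of paths, so a representative is picked;
    \<open>T_cong\<close> makes the choice immaterial.\<close>
  define \<phi> where "\<phi> = (\<lambda>A\<in>carrier ?G. path_class X (T (SOME c. c \<in> A)))"
  have \<phi>: "\<phi> (path_class X c) = path_class X (T c)" if c: "c \<in> loops_at X x" for c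
  proof -
    have "(SOME d. d \<in> path_class X c) \<in> path_class X c"
      by (rule someI[of _ c]) (use c in \<open>auto simp: path_class_def loops_at_def\<close>)
    then have "homotopic_paths X c (SOME d. d \<in> path_class X c)"
      by (simp add: path_class_def)
    then have "homotopic_paths X (T c) (T (SOME d. d \<in> path_class X c))"
      using T_cong c path_in_loop by blast
    then show ?thesis
      using c path_class_eqI[of X "T c"] by (simp add: \<phi>_def car)
  qed
  have "\<phi> \<in> hom ?G ?G"
  proof (rule homI)
    show "\<phi> A \<in> carrier ?G" if A: "A \<in> carrier ?G" for A
    proof -
      from A obtain c where "c \<in> loops_at X x" "A = path_class X c" by (auto simp: car)
      then show ?thesis
        using T[of c] by (auto simp: car \<phi> path_in_loop)
    qed
    show "\<phi> (A \<otimes>\<^bsub>?G\<^esub> B) = \<phi> A \<otimes>\<^bsub>?G\<^esub> \<phi> B" if AB: "A \<in> carrier ?G" "B \<in> carrier ?G" for A B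
    proof -
      from AB obtain c d where c: "c \<in> loops_at X x" "A = path_class X c"
        and d: "d \<in> loops_at X x" "B = path_class X d"
        by (auto simp: car)
      have c': "path_in X x c x" and d': "path_in X x d x"
        using c d path_in_loop by blast+
      have "homotopic_paths X (T c +++ T d) (T (c +++ d))"
        unfolding T_def path_compose_join
        by (rule homotopic_conj_join[OF \<gamma> fc[OF c'] \<gamma> fc[OF d'] \<gamma>])
      then have "path_class X (T (c +++ d)) = path_class X (T c +++ T d)"
        using path_class_eqI by metis
      then show ?thesis
        using T[OF c'] T[OF d'] c d loops_at_join[OF c(1) d(1)]
        by (simp add: fundamental_group_mult \<phi> path_in_loop)
    qed
  qed
  moreover have "inj_on \<phi> (carrier ?G)"
  proof (rule inj_onI)
    fix A B assume AB: "A \<in> carrier ?G" "B \<in> carrier ?G" and eq: "\<phi> A = \<phi> B"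
    from AB obtain c d where c: "c \<in> loops_at X x" "A = path_class X c"
      and d: "d \<in> loops_at X x" "B = path_class X d"
      by (auto simp: car)
    have c': "path_in X x c x" and d': "path_in X x d x"
      using c d path_in_loop by blast+
    have strip: "homotopic_paths X ((reversepath \<gamma> +++ T e) +++ \<gamma>) (f \<circ> e)" if e: "path_in X x e x" for e
    proof -
      have "homotopic_paths X ((reversepath \<gamma> +++ T e) +++ \<gamma>) (((f \<circ> e) +++ reversepath \<gamma>) +++ \<gamma>)"
        unfolding T_def
        by (rule homotopic_join[OF homotopic_cancel_left[OF \<gamma>] r[OF \<gamma>]]) (rule j fc[OF e] rev \<gamma>)+
      then show ?thesis
        using homotopic_cancel_right'[OF fc[OF e] \<gamma>] homotopic_paths_trans by blast
    qed
    have "homotopic_paths X (T c) (T d)"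
      using eq c d T[OF c'] path_class_eq_iff[of "T c" X "T d"] by (simp add: \<phi> path_in_def)
    then have "homotopic_paths X ((reversepath \<gamma> +++ T c) +++ \<gamma>) ((reversepath \<gamma> +++ T d) +++ \<gamma>)"
      by (intro homotopic_join[OF homotopic_join[OF r[OF rev[OF \<gamma>]]] r[OF \<gamma>]])
         (rule j rev[OF \<gamma>] T[OF c'] \<gamma> | assumption)+
    then have "homotopic_paths X (f \<circ> c) (f \<circ> d)"
      using strip[OF c'] strip[OF d'] by (meson homotopic_paths_sym homotopic_paths_trans)
    then have "homotopic_paths X (g \<circ> (f \<circ> c)) (g \<circ> (f \<circ> d))"
      by (rule homotopic_paths_continuous_image[OF _ g])
    moreover have "homotopic_paths X e (g \<circ> (f \<circ> e))" if e: "path_in X x e x" for e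
      by (rule homotopic_paths_eq) (use e gf in \<open>auto simp: path_in_def path_image_def image_subset_iff\<close>)
    ultimately have "homotopic_paths X c d"
      using c' d' by (meson homotopic_paths_sym homotopic_paths_trans)
    then show "A = B"
      using path_class_eqI c d by blast
  qed
  moreover have "\<phi> ` carrier ?G = carrier ?G"
  proof
    show "\<phi> ` carrier ?G \<subseteq> carrier ?G"
      using \<open>\<phi> \<in> hom ?G ?G\<close> by (auto simp: hom_def)
    show "carrier ?G \<subseteq> \<phi> ` carrier ?G"
    proof
      fix A assume "A \<in> carrier ?G"
      then obtain c where c: "c \<in> loops_at X x" "A = path_class X c"
        by (auto simp: car)
      have c': "path_in X x c x"
        using c path_in_loop by blast
      \<comment> \<open>The preimage of the class of \<open>c\<close> is found by moving
        \<open>c\<close> to the base point \<open>f x\<close> and applying \<open>g\<close>.\<close>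
      define k where "k = reversepath \<gamma> +++ (c +++ \<gamma>)"
      have k: "path_in X (f x) k (f x)"
        unfolding k_def by (rule j rev[OF \<gamma>] c' \<gamma>)+
      have gk: "path_in X x (g \<circ> k) x"
        using gc[OF k] gf[OF x] by simp
      have "homotopic_paths X k (f \<circ> (g \<circ> k))"
        by (rule homotopic_paths_eq) (use k fg in \<open>auto simp: path_in_def path_image_def image_subset_iff\<close>)
      then have "homotopic_paths X (\<gamma> +++ (k +++ reversepath \<gamma>)) (T (g \<circ> k))"
        unfolding T_def
        by (intro homotopic_join[OF r[OF \<gamma>] homotopic_join[OF _ r[OF rev[OF \<gamma>]]]])
           (rule j k rev[OF \<gamma>] \<gamma> | assumption)+
      moreover have "homotopic_paths X (k +++ reversepath \<gamma>) (reversepath \<gamma> +++ ((c +++ \<gamma>) +++ reversepath \<gamma>))"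
        unfolding k_def by (rule homotopic_assoc[OF rev[OF \<gamma>] j[OF c' \<gamma>] rev[OF \<gamma>]])
      then have "homotopic_paths X (\<gamma> +++ (k +++ reversepath \<gamma>)) (\<gamma> +++ (reversepath \<gamma> +++ ((c +++ \<gamma>) +++ reversepath \<gamma>)))"
        by (intro homotopic_join[OF r[OF \<gamma>]]) (rule j k rev[OF \<gamma>] \<gamma> | assumption)+
      moreover have "homotopic_paths X (\<gamma> +++ (reversepath \<gamma> +++ ((c +++ \<gamma>) +++ reversepath \<gamma>))) ((c +++ \<gamma>) +++ reversepath \<gamma>)"
        by (rule homotopic_cancel_left'[OF \<gamma>]) (rule j c' \<gamma> rev[OF \<gamma>])+
      moreover have "homotopic_paths X ((c +++ \<gamma>) +++ reversepath \<gamma>) c"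
        by (rule homotopic_cancel_right[OF c' \<gamma>])
      ultimately have "homotopic_paths X (T (g \<circ> k)) c"
        by (meson homotopic_paths_sym homotopic_paths_trans)
      then have "A = \<phi> (path_class X (g \<circ> k))"
        using path_class_eqI[of X "T (g \<circ> k)" c] c gk by (simp add: \<phi> path_in_loop)
      then show "A \<in> \<phi> ` carrier ?G"
        using gk by (auto simp: car path_in_loop)
    qed
  qed
  ultimately have "\<phi> \<in> auto ?G"
    by (auto simp: auto_def Bij_def bij_betw_def \<phi>_def)
  then show thesis
    using that[of \<phi>] \<phi> by (simp add: T_def)
qed

section \<open>Configurations in the disc\<close>

text \<open>Up to scaling and translation this diamond is the boundary of the square |Re w| \<le> 1,
  |Im w| \<le> 1 under the real linear map taking \<open>w\<close> to \<open>Re w\<close> times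
  \<open>\<zeta>\<close> minus \<open>Im w\<close> times \<open>\<xi>\<close>. That is the position
  of a string on the diameter of \<open>\<zeta>\<close> relative to one on the diameter of
  \<open>\<xi>\<close>.\<close>

lemma diamond_eq:
  "diamond a (r *\<^sub>R (\<zeta> + \<xi>)) (r *\<^sub>R (\<zeta> - \<xi>)) t =
     a + of_real r * (of_real (Re (diamond 0 (1 - \<i>) (1 + \<i>) t)) * \<zeta> - of_real (Im (diamond 0 (1 - \<i>) (1 + \<i>) t)) * \<xi>)"
proof -
  have "2 * (2 * (2 * t - 1) - 1) = 8 * t - 6" by simp
  then show ?thesis
    by (auto simp: diamond_def joinpaths_def linepath_def complex_eq_iff algebra_simps)
qed

lemma diamond_square:
  assumes "t \<in> {0..1}"
  defines "w \<equiv> diamond 0 (1 - \<i>) (1 + \<i>) t"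
  shows "\<bar>Re w\<bar> \<le> 1" "\<bar>Im w\<bar> \<le> 1" "\<bar>Re w\<bar> = 1 \<or> \<bar>Im w\<bar> = 1"
  using assms(1) unfolding w_def diamond_def joinpaths_def linepath_def by (auto simp: abs_le_iff)

lemma path_diamond: "path (diamond a f h)"
  by (simp add: diamond_def)

lemma diamond_loop: "diamond a f h 0 = diamond a f h 1"
  by (simp add: diamond_def joinpaths_def linepath_def)

lemma real_independent:
  assumes "Im (\<zeta> * cnj \<xi>) \<noteq> 0" "of_real a * \<zeta> + of_real b * \<xi> = 0"
  shows "a = 0 \<and> b = 0"
proof -
  have "(of_real a * \<zeta> + of_real b * \<xi>) * cnj \<xi> = 0"
    using assms(2) by simp
  then have "of_real a * (\<zeta> * cnj \<xi>) + of_real (b * (cmod \<xi>)\<^sup>2) = 0"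
    unfolding of_real_mult complex_norm_square by (simp add: algebra_simps)
  then have "Im (of_real a * (\<zeta> * cnj \<xi>) + of_real (b * (cmod \<xi>)\<^sup>2)) = 0"
    by (metis zero_complex.sel(2))
  then have "a * Im (\<zeta> * cnj \<xi>) = 0"
    by (simp del: of_real_mult)
  then have "a = 0"
    using assms(1) by simp
  moreover have "\<xi> \<noteq> 0"
    using assms(1) by auto
  ultimately show ?thesis
    using assms(2) by simp
qed

text \<open>Two points of the affine family \<open>(1 - z) x + z y\<close> collide for at most one complex \<open>z\<close>, and
  finitely many points do not disconnect the plane.\<close>

lemma configuration_path:
  fixes x y :: "'i \<Rightarrow> complex"
  assumes I: "finite I" and K: "open K" "convex K" and x: "x ` I \<subseteq> K" "inj_on x I"
    and y: "y ` I \<subseteq> K" "inj_on y I"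
  obtains e where "\<And>i. continuous_on {0..1} (\<lambda>t::real. e t i)" "e 0 = x" "e 1 = y"
    "\<And>t. t \<in> {0..1} \<Longrightarrow> e t ` I \<subseteq> K \<and> inj_on (e t) I"
proof -
  define L where "L i z = (1 - z) * x i + z * y i" for i and z :: complex
  have cL: "continuous_on S (L i)" for S i
    unfolding L_def by (intro continuous_intros)
  define W where "W = (\<Inter>i\<in>I. L i -` K)"
  define C where "C = (\<Union>i\<in>I. \<Union>j\<in>I - {i}. {z. L i z = L j z})"
  have "open W"
    unfolding W_def using I K cL by (intro open_INT ballI open_vimage) auto
  moreover have "convex W"
    unfolding W_def
  proof (intro convex_INT convexI)
    fix i z w u v assume i: "i \<in> I" and zw: "z \<in> L i -` K" "w \<in> L i -` K"
      and uv: "0 \<le> u" "0 \<le> v" "u + v = (1::real)"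
    have "of_real u + of_real v = (1::complex)"
      using uv(3) by (metis of_real_1 of_real_add)
    then have v: "of_real v = 1 - (of_real u :: complex)"
      by (simp add: algebra_simps)
    have "L i (u *\<^sub>R z + v *\<^sub>R w) = u *\<^sub>R L i z + v *\<^sub>R L i w"
      unfolding L_def scaleR_conv_of_real v by (simp add: algebra_simps)
    then show "u *\<^sub>R z + v *\<^sub>R w \<in> L i -` K"
      using convexD[OF K(2)] zw uv by auto
  qed
  moreover have "finite C"
    unfolding C_def
  proof (intro finite_UN_I I finite_Diff)
    fix i j assume ij: "i \<in> I" "j \<in> I - {i}"
    then have "x i \<noteq> x j"
      using x(2) by (auto dest: inj_onD)
    then have "z = w" if "L i z = L j z" "L i w = L j w" for z w
    proof -
      define d d' where "d = x i - x j" and "d' = y i - y j"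
      have "(1 - u) * d + u * d' = L i u - L j u" for u
        by (simp add: L_def d_def d'_def algebra_simps)
      then have "(1 - z) * d + z * d' = 0" "(1 - w) * d + w * d' = 0"
        using that by simp_all
      then have "d = z * (d - d')" "d = w * (d - d')"
        by (simp_all add: algebra_simps)
      moreover have "d \<noteq> 0"
        using \<open>x i \<noteq> x j\<close> by (simp add: d_def)
      ultimately have "z * (d - d') = w * (d - d')" "d - d' \<noteq> 0"
        by auto
      then show ?thesis by simp
    qed
    then show "finite {z. L i z = L j z}"
      by (cases "\<exists>z. L i z = L j z") (auto intro: finite_subset[of _ "{_}"])
  qed
  ultimately have conn: "path_connected (W - C)"
    by (intro path_connected_open_diff_countable) (auto simp: convex_connected countable_finite)
  have L01: "L i 0 = x i" "L i 1 = y i" for i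
    by (auto simp: L_def)
  have "0 \<in> W - C" "1 \<in> W - C"
    using x y by (auto simp: W_def C_def L01 dest: inj_onD)
  then obtain \<gamma> where \<gamma>: "path \<gamma>" "path_image \<gamma> \<subseteq> W - C" "pathstart \<gamma> = 0" "pathfinish \<gamma> = 1"
    using conn unfolding path_connected_def by blast
  show thesis
  proof
    show "continuous_on {0..1} (\<lambda>t. L i (\<gamma> t))" for i
      using \<gamma>(1) unfolding path_def L_def by (intro continuous_intros)
    show "(\<lambda>i. L i (\<gamma> 0)) = x" "(\<lambda>i. L i (\<gamma> 1)) = y"
      using \<gamma>(3,4) by (auto simp: pathstart_def pathfinish_def L01)
    fix t :: real assume "t \<in> {0..1}"
    then have "\<gamma> t \<in> W" "\<gamma> t \<notin> C"
      using \<gamma>(2) unfolding path_image_def by blast+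
    then show "(\<lambda>i. L i (\<gamma> t)) ` I \<subseteq> K \<and> inj_on (\<lambda>i. L i (\<gamma> t)) I"
      by (auto simp: W_def C_def inj_on_def)
  qed
qed

text \<open>Compactness in \<open>s\<close> and finiteness in \<open>i\<close> yield one bound for a
  whole motion; it provides a meridian radius that works throughout.\<close>

lemma uniform_positive_lower_bound:
  fixes f :: "'i \<Rightarrow> real \<Rightarrow> real"
  assumes "finite I" "\<And>i. i \<in> I \<Longrightarrow> continuous_on {0..1} (f i)"
    "\<And>i s. i \<in> I \<Longrightarrow> s \<in> {0..1} \<Longrightarrow> f i s > 0"
  shows "\<exists>\<delta>>0. \<forall>i\<in>I. \<forall>s\<in>{0..1}. \<delta> \<le> f i s"
  using assms
proof (induction I rule: finite_induct)
  case empty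
  show ?case by (intro exI[of _ 1]) auto
next
  case (insert i I)
  obtain \<delta> where \<delta>: "\<delta> > 0" "\<forall>i\<in>I. \<forall>s\<in>{0..1}. \<delta> \<le> f i s"
    using insert by auto
  obtain s where s: "s \<in> {0..1}" "\<forall>t\<in>{0..1}. f i s \<le> f i t"
    using continuous_attains_inf[of "{0..1::real}" "f i"] insert.prems(1) by auto
  then have "f i s > 0"
    using insert.prems(2) by auto
  then show ?case
    using \<delta> s by (intro exI[of _ "min \<delta> (f i s)"]) (auto simp: min_le_iff_disj)
qed

text \<open>By \<open>p_eq\<close> an interior point of the disc is identified with no other point.
  Hence one string may run along the boundary circle, where \<open>p\<close> glues, as long as the
  others stay in the open disc.\<close>

locale disc_braids = path_functional H "config_space n M" val
  for H (structure) and n :: nat and M :: "'a::topological_space set" and val +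
  fixes p :: "complex \<Rightarrow> 'a"
  assumes p_continuous: "continuous_on (cball 0 1) p"
    and p_in: "z \<in> cball 0 1 \<Longrightarrow> p z \<in> M"
    and p_eq: "z \<in> ball 0 1 \<Longrightarrow> w \<in> cball 0 1 \<Longrightarrow> p z = p w \<Longrightarrow> z = w"
begin

text \<open>The entry \<open>x k\<close> is overwritten, so only the values of \<open>x\<close> on
  \<open>rest k\<close> matter.\<close>

definition move :: "(nat \<Rightarrow> complex) \<Rightarrow> nat \<Rightarrow> complex \<Rightarrow> nat \<Rightarrow> 'a" where
  "move x k w = base_config n p (x(k := w))"

definition rest :: "nat \<Rightarrow> nat set" where
  "rest k = {1..n} - {k}"

lemma base_config_mem:
  assumes "\<And>i. i \<in> {1..n} \<Longrightarrow> x i \<in> cball 0 1"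
    "\<And>i j. i \<in> {1..n} \<Longrightarrow> j \<in> {1..n} \<Longrightarrow> i \<noteq> j \<Longrightarrow> p (x i) \<noteq> p (x j)"
  shows "base_config n p x \<in> config_space n M"
proof -
  have "inj_on (base_config n p x) {1..n}"
  proof (rule inj_onI)
    fix i j assume "i \<in> {1..n}" "j \<in> {1..n}" "base_config n p x i = base_config n p x j"
    then show "i = j"
      using assms(2)[of i j] by (auto simp: base_config_def)
  qed
  moreover have "p (x i) \<in> M" if "i \<in> {1..n}" for i
    using p_in assms(1) that by blast
  then have "base_config n p x \<in> {1..n} \<rightarrow>\<^sub>E M"
    unfolding base_config_def by (rule restrict_PiE_iff[THEN iffD2, OF ballI])
  ultimately show ?thesis
    by (simp add: config_space_def)
qed

lemma base_config_continuous:
  assumes "\<And>i. i \<in> {1..n} \<Longrightarrow> continuous_on S (\<lambda>s. e s i)"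
    "\<And>i s. i \<in> {1..n} \<Longrightarrow> s \<in> S \<Longrightarrow> e s i \<in> cball 0 1"
  shows "continuous_on S (\<lambda>s. base_config n p (e s))"
proof (rule continuous_on_coordinatewise_then_product)
  fix i
  show "continuous_on S (\<lambda>s. base_config n p (e s) i)"
  proof (cases "i \<in> {1..n}")
    case True
    then show ?thesis
      using assms by (auto simp: base_config_def simp del: mem_cball intro!: continuous_on_compose2[OF p_continuous])
  next
    case False
    then show ?thesis
      by (auto simp: base_config_def)
  qed
qed

lemma move_mem:
  assumes "k \<in> {1..n}" "x ` rest k \<subseteq> ball 0 1" "inj_on x (rest k)" "w \<in> cball 0 1" "w \<notin> x ` rest k"
  shows "move x k w \<in> config_space n M"
  unfolding move_def
proof (rule base_config_mem)
  have b: "x i \<in> ball 0 1" if "i \<in> {1..n}" "i \<noteq> k" for i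
    using assms(2) that by (auto simp: rest_def image_subset_iff simp del: mem_ball)
  show c: "(x(k := w)) i \<in> cball 0 1" if "i \<in> {1..n}" for i
    using b[OF that] assms(4) by auto
  have ne: "p (x i) \<noteq> p ((x(k := w)) j)" if "i \<in> {1..n}" "i \<noteq> k" "j \<in> {1..n}" "i \<noteq> j" for i j
  proof
    assume "p (x i) = p ((x(k := w)) j)"
    then have "x i = (x(k := w)) j"
      using p_eq[OF b[OF that(1,2)] c[OF that(3)]] by blast
    moreover have "i \<in> rest k"
      using that by (simp add: rest_def)
    moreover have "j \<in> rest k" if "j \<noteq> k"
      using that \<open>j \<in> {1..n}\<close> by (simp add: rest_def)
    ultimately show False
      using inj_onD[OF assms(3), of i j] assms(5) \<open>i \<noteq> j\<close> by (cases "j = k") auto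
  qed
  show "p ((x(k := w)) i) \<noteq> p ((x(k := w)) j)" if "i \<in> {1..n}" "j \<in> {1..n}" "i \<noteq> j" for i j
    using ne[of i j] ne[of j i] that by (cases "i = k") auto
qed

text \<open>The curve \<open>c s\<close> need not close up in the disc: \<open>loop\<close> asks
  this only after applying \<open>p\<close>, which suits a string passing through an edge. The
  resting points move along \<open>e\<close> at the same time.\<close>

lemma move_homotopy:
  fixes e :: "real \<Rightarrow> nat \<Rightarrow> complex" and c :: "real \<Rightarrow> real \<Rightarrow> complex"
  assumes k: "k \<in> {1..n}" and e: "\<And>i. i \<in> rest k \<Longrightarrow> continuous_on {0..1} (\<lambda>s. e s i)"
    "\<And>s. s \<in> {0..1} \<Longrightarrow> e s ` rest k \<subseteq> ball 0 1 \<and> inj_on (e s) (rest k)"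
    and c: "continuous_on ({0..1} \<times> {0..1}) (\<lambda>(s, t). c s t)"
    "\<And>s t. s \<in> {0..1} \<Longrightarrow> t \<in> {0..1} \<Longrightarrow> c s t \<in> cball 0 1 \<and> c s t \<notin> e s ` rest k"
    and loop: "\<And>s. s \<in> {0..1} \<Longrightarrow> move (e s) k (c s 0) = move (e s) k (c s 1)"
  shows "val (move (e 0) k \<circ> c 0) = val (move (e 1) k \<circ> c 1)"
proof -
  have "val ((\<lambda>s t. move (e s) k (c s t)) 0) = val ((\<lambda>s t. move (e s) k (c s t)) 1)"
  proof (rule val_free_homotopy)
    show "continuous_on ({0..1} \<times> {0..1}) (\<lambda>(s, t). move (e s) k (c s t))"
      unfolding move_def case_prod_beta
    proof (rule base_config_continuous)
      fix i assume i: "i \<in> {1..n}"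
      show "continuous_on ({0..1} \<times> {0..1}) (\<lambda>q. ((e (fst q))(k := c (fst q) (snd q))) i)"
      proof (cases "i = k")
        case True
        then show ?thesis using c(1) by (simp add: case_prod_beta)
      next
        case False
        then have "continuous_on ({0..1} \<times> {0..1}) (\<lambda>q::real \<times> real. e (fst q) i)"
          using i by (intro continuous_on_compose2[OF e(1)[of i]] continuous_intros) (auto simp: rest_def)
        then show ?thesis
          using False by simp
      qed
      show "((e (fst q))(k := c (fst q) (snd q))) i \<in> cball 0 1" if "q \<in> {0..1} \<times> {0..1}" for q
      proof (cases "i = k")
        case False
        then have "e (fst q) i \<in> ball 0 1"
          using e(2)[of "fst q"] that i by (auto simp: rest_def image_subset_iff mem_Times_iff simp del: mem_ball)
        then show ?thesis
          using False by simp
      qed (use c(2) that in \<open>auto simp: mem_Times_iff\<close>)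
    qed
    show "move (e s) k (c s t) \<in> config_space n M" if "s \<in> {0..1}" "t \<in> {0..1}" for s t
      using e(2)[OF that(1)] c(2)[OF that] by (intro move_mem k) auto
  qed (rule loop)
  then show ?thesis
    by (simp add: o_def)
qed

lemma move_continuous:
  assumes k: "k \<in> {1..n}" and x: "x ` rest k \<subseteq> ball 0 1" "inj_on x (rest k)"
  shows "continuous_on (cball 0 1 - x ` rest k) (move x k)"
    "move x k \<in> cball 0 1 - x ` rest k \<rightarrow> config_space n M"
proof -
  show "move x k \<in> cball 0 1 - x ` rest k \<rightarrow> config_space n M"
    using move_mem[OF k x] by auto
  show "continuous_on (cball 0 1 - x ` rest k) (move x k)"
    unfolding move_def
  proof (rule base_config_continuous)
    fix i assume i: "i \<in> {1..n}"
    show "continuous_on (cball 0 1 - x ` rest k) (\<lambda>w. (x(k := w)) i)"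
      by (cases "i = k") auto
    show "(x(k := w)) i \<in> cball 0 1" if "w \<in> cball 0 1 - x ` rest k" for w
    proof (cases "i = k")
      case False
      then have "x i \<in> ball 0 1"
        using x(1) i by (auto simp: rest_def image_subset_iff simp del: mem_ball)
      then show ?thesis
        using False by simp
    qed (use that in simp)
  qed
qed

lemma move_functional:
  assumes "k \<in> {1..n}" "x ` rest k \<subseteq> ball 0 1" "inj_on x (rest k)"
  shows "path_functional H (cball 0 1 - x ` rest k) (\<lambda>c. val (move x k \<circ> c))"
  by (rule path_functional_pullback[OF path_functional_axioms move_continuous[OF assms]])

end

section \<open>Meridians are null-homologous\<close>

text \<open>The diameters through \<open>\<zeta>\<close> and \<open>\<xi>\<close> become closed
  curves in \<open>M\<close>; \<open>distinct\<close> keeps their ends apart, so that the curves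
  meet only in \<open>p 0\<close>.\<close>

locale crossing_loops = disc_braids H n M val p
  for H (structure) and n :: nat and M :: "'a::topological_space set" and val and p +
  fixes \<zeta> \<xi> :: complex
  assumes norm1: "norm \<zeta> = 1" "norm \<xi> = 1" and indep: "Im (\<zeta> * cnj \<xi>) \<noteq> 0"
    and glue: "p (- \<zeta>) = p \<zeta>" "p (- \<xi>) = p \<xi>" and distinct: "p \<zeta> \<noteq> p \<xi>"
begin

abbreviation square_loop :: "real \<Rightarrow> complex" where
  "square_loop \<equiv> diamond 0 (1 - \<i>) (1 + \<i>)"

lemma continuous_square_loop: "continuous_on {0..1} square_loop"
  using path_diamond by (simp add: path_def)

lemma continuous_square_loop_snd: "continuous_on ({0..1} \<times> {0..1}) (\<lambda>q::real \<times> real. square_loop (snd q))"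
  by (intro continuous_on_compose2[OF continuous_square_loop] continuous_intros) auto

lemma norm_comb_le: "norm (of_real a * \<zeta> - of_real b * \<xi>) \<le> \<bar>a\<bar> + \<bar>b\<bar>"
  using norm_triangle_ineq4[of "of_real a * \<zeta>" "of_real b * \<xi>"] by (simp add: norm_mult norm1)

lemma diameters_eq:
  assumes "\<bar>a\<bar> \<le> 1" "\<bar>b\<bar> \<le> 1" "p (of_real a * \<zeta>) = p (of_real b * \<xi>)"
  shows "a = 0 \<and> b = 0"
proof -
  have n: "norm (of_real a * \<zeta>) = \<bar>a\<bar>" "norm (of_real b * \<xi>) = \<bar>b\<bar>"
    by (simp_all add: norm_mult norm1)
  \<comment> \<open>If both points are ends of their diameters, \<open>glue\<close> leads to a
    contradiction with \<open>distinct\<close>; otherwise one of them is interior and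
    \<open>p_eq\<close> applies.\<close>
  have "of_real a * \<zeta> = of_real b * \<xi>"
  proof (cases "\<bar>a\<bar> = 1 \<and> \<bar>b\<bar> = 1")
    case True
    then have "(a = 1 \<or> a = -1) \<and> (b = 1 \<or> b = -1)"
      by auto
    then show ?thesis
      using assms(3) glue distinct by auto
  next
    case False
    then show ?thesis
      using assms p_eq[of "of_real a * \<zeta>" "of_real b * \<xi>"] p_eq[of "of_real b * \<xi>" "of_real a * \<zeta>"] n by auto
  qed
  then have "of_real a * \<zeta> + of_real (- b) * \<xi> = 0"
    by simp
  then show ?thesis
    using real_independent[OF indep] by fastforce
qed

end

text \<open>The strings \<open>k\<close> and \<open>j\<close> move along the two diameters, which are loops meeting in one point; the other
  points are parked off both diameters.\<close>

locale crossing_strings = crossing_loops H n M val p \<zeta> \<xi>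
  for H (structure) and n :: nat and M :: "'a::topological_space set" and val and p and \<zeta> \<xi> +
  fixes k j :: nat
  assumes kj: "k \<in> {1..n}" "j \<in> {1..n}" "k \<noteq> j"
begin

text \<open>A positive multiple of \<open>\<zeta> + \<xi>\<close> lies on neither diameter. The
  factor \<open>1 / (l + 2)\<close> makes these points distinct, and since their norm is at most
  \<open>2 / (l + 2)\<close>, they are interior for \<open>l \<ge> 1\<close>.\<close>

definition parked :: "nat \<Rightarrow> complex" where
  "parked l = of_real (1 / (real l + 2)) * (\<zeta> + \<xi>)"

definition pair :: "complex \<Rightarrow> complex \<Rightarrow> nat \<Rightarrow> 'a" where
  "pair u v = base_config n p (parked(k := u, j := v))"

lemma sum_nonzero: "\<zeta> + \<xi> \<noteq> 0"
  using real_independent[OF indep, of 1 1] by auto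

lemma parked_eq_comb: "parked l = of_real (1 / (real l + 2)) * \<zeta> - of_real (- (1 / (real l + 2))) * \<xi>"
  by (simp add: parked_def algebra_simps del: of_real_divide)

lemma parked_inj: "inj parked"
proof (rule injI)
  fix l m assume "parked l = parked m"
  then have "of_real (1 / (real l + 2)) = (of_real (1 / (real m + 2)) :: complex)"
    using sum_nonzero by (simp add: parked_def del: of_real_divide)
  then have "1 / (real l + 2) = 1 / (real m + 2)"
    by (simp only: of_real_eq_iff)
  then show "l = m"
    by (simp add: field_simps)
qed

lemma parked_ball: "l \<in> {1..n} \<Longrightarrow> parked l \<in> ball 0 1"
proof -
  assume l: "l \<in> {1..n}"
  have "norm (parked l) \<le> 2 * (1 / (real l + 2))"
    using norm_comb_le[of "1 / (real l + 2)" "- (1 / (real l + 2))"]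
    unfolding parked_eq_comb[symmetric] by (simp add: abs_minus)
  also have "\<dots> < 1"
    using l by (simp add: field_simps)
  finally show ?thesis by simp
qed

lemma parked_off_diameters: "parked l \<noteq> of_real a * \<zeta>" "parked l \<noteq> of_real a * \<xi>"
proof -
  define c where "c = 1 / (real l + 2)"
  have c: "c \<noteq> 0"
    by (simp add: c_def)
  have "parked l - of_real a * \<zeta> = of_real (c - a) * \<zeta> + of_real c * \<xi>"
    "parked l - of_real a * \<xi> = of_real c * \<zeta> + of_real (c - a) * \<xi>"
    unfolding parked_def c_def[symmetric] by (simp_all add: algebra_simps)
  then show "parked l \<noteq> of_real a * \<zeta>" "parked l \<noteq> of_real a * \<xi>"
    using real_independent[OF indep, of "c - a" c] real_independent[OF indep, of c "c - a"] c by auto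
qed

lemma parked_lower_bound: "\<exists>\<delta>>0. \<forall>l\<in>{1..n}. \<delta> \<le> norm (parked l)"
proof -
  have "\<exists>\<delta>>0. \<forall>l\<in>{1..n}. \<forall>s\<in>{0..1::real}. \<delta> \<le> norm (parked l)"
  proof (rule uniform_positive_lower_bound)
    show "norm (parked l) > 0" for l
      using parked_off_diameters(1)[of l 0] by simp
  qed auto
  then show ?thesis
    by (metis atLeastAtMost_iff order_refl zero_le_one)
qed

lemma pair_mem:
  assumes "u \<in> cball 0 1" "v \<in> cball 0 1" "p u \<noteq> p v" "u \<notin> parked ` {1..n}" "v \<notin> parked ` {1..n}"
  shows "pair u v \<in> config_space n M"
  unfolding pair_def
proof (rule base_config_mem)
  have b: "parked l \<in> cball 0 1" if "l \<in> {1..n}" for l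
    using parked_ball[OF that] ball_subset_cball by blast
  show "(parked(k := u, j := v)) l \<in> cball 0 1" if "l \<in> {1..n}" for l
    using b[OF that] assms(1,2) by simp
  have ne: "p (parked l) \<noteq> p w" if "l \<in> {1..n}" "w \<in> cball 0 1" "parked l \<noteq> w" for l w
    using p_eq[OF parked_ball[OF that(1)] that(2)] that(3) by blast
  have ne2: "p (parked l) \<noteq> p (parked m)" if "l \<in> {1..n}" "m \<in> {1..n}" "l \<noteq> m" for l m
    using ne[OF that(1) b[OF that(2)]] parked_inj that(3) by (auto dest: injD)
  have uv: "p (parked l) \<noteq> p u" "p (parked l) \<noteq> p v" if "l \<in> {1..n}" for l
    using ne[OF that assms(1)] ne[OF that assms(2)] assms(4,5) that by blast+
  show "p ((parked(k := u, j := v)) l) \<noteq> p ((parked(k := u, j := v)) m)" if "l \<in> {1..n}" "m \<in> {1..n}" "l \<noteq> m" for l m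
    using uv[OF that(1)] uv[OF that(2)] ne2[OF that] assms(3) that(3)
      uv[OF that(1), THEN not_sym] uv[OF that(2), THEN not_sym] assms(3)[THEN not_sym]
    by (simp split: if_splits)
qed

lemma pair_continuous:
  assumes "continuous_on S u" "continuous_on S v" "\<And>s. s \<in> S \<Longrightarrow> u s \<in> cball 0 1" "\<And>s. s \<in> S \<Longrightarrow> v s \<in> cball 0 1"
  shows "continuous_on S (\<lambda>s. pair (u s) (v s))"
  unfolding pair_def
proof (rule base_config_continuous)
  fix l assume l: "l \<in> {1..n}"
  show "continuous_on S (\<lambda>s. (parked(k := u s, j := v s)) l)"
    using assms(1,2) by (cases "l = k"; cases "l = j") auto
  show "(parked(k := u s, j := v s)) l \<in> cball 0 1" if "s \<in> S" for s
    using assms(3,4)[OF that] parked_ball[OF l] by (simp add: less_imp_le)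
qed

lemma pair_homotopy:
  fixes u v :: "real \<Rightarrow> real \<Rightarrow> complex"
  assumes "continuous_on ({0..1} \<times> {0..1}) (\<lambda>(s, t). u s t)" "continuous_on ({0..1} \<times> {0..1}) (\<lambda>(s, t). v s t)"
    and uv: "\<And>s t. s \<in> {0..1} \<Longrightarrow> t \<in> {0..1} \<Longrightarrow> u s t \<in> cball 0 1 \<and> v s t \<in> cball 0 1 \<and> p (u s t) \<noteq> p (v s t) \<and>
       u s t \<notin> parked ` {1..n} \<and> v s t \<notin> parked ` {1..n}"
    and "\<And>s. u s 0 = u s 1" "\<And>s. v s 0 = v s 1"
  shows "val (\<lambda>t. pair (u 0 t) (v 0 t)) = val (\<lambda>t. pair (u 1 t) (v 1 t))"
proof (rule val_free_homotopy[where h = "\<lambda>s t. pair (u s t) (v s t)"])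
  show "continuous_on ({0..1} \<times> {0..1}) (\<lambda>(s, t). pair (u s t) (v s t))"
    using assms(1,2) uv unfolding case_prod_beta by (intro pair_continuous) (auto simp: mem_Times_iff simp del: mem_cball)
  show "pair (u s t) (v s t) \<in> config_space n M" if "s \<in> {0..1}" "t \<in> {0..1}" for s t
    using uv[OF that] by (intro pair_mem) auto
qed (use assms(4,5) in simp)

text \<open>The map \<open>(s, t) \<mapsto> (s \<zeta>, t \<xi>)\<close> factors through a torus in the configuration space with one point
  removed, and the boundary of the square is the commutator of its meridian and longitude.\<close>

lemma val_torus_boundary:
  "val (\<lambda>t. pair (of_real (Re (square_loop t)) * \<zeta>) (of_real (Im (square_loop t)) * \<xi>)) = \<one>"
proof -
  define S where "S = {w. \<bar>Re w\<bar> \<le> 1 \<and> \<bar>Im w\<bar> \<le> 1 \<and> w \<noteq> 0}"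
  define f where "f w = pair (of_real (Re w) * \<zeta>) (of_real (Im w) * \<xi>)" for w
  have inc: "of_real (Re w) * \<zeta> \<in> cball 0 1" "of_real (Im w) * \<xi> \<in> cball 0 1" if "w \<in> S" for w
    using that by (auto simp: S_def norm_mult norm1)
  have "f \<in> S \<rightarrow> config_space n M"
  proof
    fix w assume w: "w \<in> S"
    then have "p (of_real (Re w) * \<zeta>) \<noteq> p (of_real (Im w) * \<xi>)"
      using diameters_eq[of "Re w" "Im w"] by (auto simp: S_def complex_eq_iff)
    then show "f w \<in> config_space n M"
      unfolding f_def using inc[OF w] parked_off_diameters by (intro pair_mem) (auto dest: sym)
  qed
  moreover have "continuous_on S f"
    unfolding f_def using inc by (intro pair_continuous continuous_intros)
  ultimately interpret S: path_functional H S "\<lambda>c. val (f \<circ> c)"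
    by (intro path_functional_pullback[OF path_functional_axioms])
  define l1 l2 l3 l4 where l: "l1 = linepath (- 1 - \<i>) (1 - \<i>)" "l2 = linepath (1 - \<i>) (1 + \<i>)"
    "l3 = linepath (1 + \<i>) (- 1 + \<i>)" "l4 = linepath (- 1 + \<i>) (- 1 - \<i>)"
  have sq: "square_loop = l1 +++ (l2 +++ (l3 +++ l4))"
  proof -
    have "0 - (1 + \<i>) = - 1 - \<i>" "0 - (1 - \<i>) = - 1 + \<i>" "0 + (1 - \<i>) = 1 - \<i>" "0 + (1 + \<i>) = 1 + \<i>"
      by simp_all
    then show ?thesis
      unfolding diamond_def l by (simp only:)
  qed
  have "linepath a b t \<in> S" if "t \<in> {0..1}" "(a, b) \<in> {(- 1 - \<i>, 1 - \<i>), (1 - \<i>, 1 + \<i>), (1 + \<i>, - 1 + \<i>), (- 1 + \<i>, - 1 - \<i>)}" for a b t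
    using that by (auto simp: linepath_def S_def complex_eq_iff abs_le_iff)
  then have lS: "path_image l1 \<subseteq> S" "path_image l2 \<subseteq> S" "path_image l3 \<subseteq> S" "path_image l4 \<subseteq> S"
    unfolding l by (auto simp only: path_image_def insert_iff)
  have lp: "path l1" "path l2" "path l3" "path l4"
    by (simp_all add: l)
  have ends: "pathfinish l1 = pathstart l2" "pathfinish l2 = pathstart l3" "pathfinish l3 = pathstart l4"
    by (simp_all add: l)
  have "val (f \<circ> square_loop) = val (f \<circ> l1) \<otimes> (val (f \<circ> l2) \<otimes> (val (f \<circ> l3) \<otimes> val (f \<circ> l4)))"
    unfolding sq using lS lp ends by (simp add: S.val_join path_image_join)
  \<comment> \<open>On \<open>l3\<close> and on the reversed \<open>l1\<close> string
    \<open>k\<close> moves alike, while string \<open>j\<close> rests at \<open>\<xi>\<close> and at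
    \<open>- \<xi>\<close>, which are one point of \<open>M\<close>.\<close>
  moreover have "f \<circ> l3 = f \<circ> reversepath l1"
  proof
    fix t
    have "Re (l3 t) = Re (reversepath l1 t)" "Im (l3 t) = 1" "Im (reversepath l1 t) = -1"
      by (auto simp: l linepath_def reversepath_def algebra_simps)
    then show "(f \<circ> l3) t = (f \<circ> reversepath l1) t"
      using glue(2) by (auto simp: f_def pair_def base_config_def)
  qed
  moreover have "f \<circ> l4 = f \<circ> reversepath l2"
  proof
    fix t
    have "Im (l4 t) = Im (reversepath l2 t)" "Re (l4 t) = -1" "Re (reversepath l2 t) = 1"
      by (auto simp: l linepath_def reversepath_def algebra_simps)
    then show "(f \<circ> l4) t = (f \<circ> reversepath l2) t"
      using glue(1) by (auto simp: f_def pair_def base_config_def)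
  qed
  moreover have "val (f \<circ> reversepath l1) = inv val (f \<circ> l1)" "val (f \<circ> reversepath l2) = inv val (f \<circ> l2)"
    using S.val_reversepath lp lS by blast+
  moreover have "val (f \<circ> l1) \<in> carrier H" "val (f \<circ> l2) \<in> carrier H"
    using S.val_closed lp lS by blast+
  ultimately have "val (f \<circ> square_loop) = \<one>"
    by (simp add: m_lcomm[of "val (f \<circ> l2)"])
  then show ?thesis
    by (simp add: f_def o_def)
qed

text \<open>Two homotopies start from the torus boundary: both motions along the diameters are
  shrunk by the factor \<open>r\<close>, then the motion of \<open>j\<close> is transferred to
  \<open>k\<close>. The bounds on \<open>r\<close> keep the second homotopy in the disc and away
  from the parked points.\<close>

lemma val_meridian_parked:
  assumes \<delta>: "\<delta> > 0" "\<forall>l\<in>{1..n}. \<delta> \<le> norm (parked l)" and r: "0 < r" "2 * r < \<delta>" "2 * r < 1"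
  shows "val (move (parked(j := 0)) k \<circ> diamond 0 (r *\<^sub>R (\<zeta> + \<xi>)) (r *\<^sub>R (\<zeta> - \<xi>))) = \<one>"
proof -
  define a b where "a t = Re (square_loop t)" and "b t = Im (square_loop t)" for t
  have cab: "continuous_on ({0..1} \<times> {0..1}) (\<lambda>q::real \<times> real. a (snd q))"
    "continuous_on ({0..1} \<times> {0..1}) (\<lambda>q::real \<times> real. b (snd q))"
    unfolding a_def b_def by (intro continuous_intros continuous_square_loop_snd)+
  have ab: "\<bar>a t\<bar> \<le> 1" "\<bar>b t\<bar> \<le> 1" "\<not> (a t = 0 \<and> b t = 0)" if "t \<in> {0..1}" for t
    using diamond_square[OF that] by (auto simp: a_def b_def)
  have ab01: "a 0 = a 1" "b 0 = b 1"
    by (simp_all add: a_def b_def diamond_loop)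
  have "val (\<lambda>t. pair (of_real ((1 - 0 + 0 * r) * a t) * \<zeta>) (of_real ((1 - 0 + 0 * r) * b t) * \<xi>)) =
        val (\<lambda>t. pair (of_real ((1 - 1 + 1 * r) * a t) * \<zeta>) (of_real ((1 - 1 + 1 * r) * b t) * \<xi>))"
  proof (rule pair_homotopy[where u = "\<lambda>s t. of_real ((1 - s + s * r) * a t) * \<zeta>"
        and v = "\<lambda>s t. of_real ((1 - s + s * r) * b t) * \<xi>"])
    fix s t :: real assume s: "s \<in> {0..1}" and t: "t \<in> {0..1}"
    define q where "q = 1 - s + s * r"
    have q: "0 < q" "q \<le> 1"
    proof -
      have "s * r \<le> s" "0 \<le> s * r"
        using s r by (auto intro: mult_left_le)
      then show "0 < q" "q \<le> 1"
        using s r unfolding q_def by (cases "s = 1"; auto)+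
    qed
    have qab: "\<bar>q * a t\<bar> \<le> 1" "\<bar>q * b t\<bar> \<le> 1" "\<not> (q * a t = 0 \<and> q * b t = 0)"
      using q ab[OF t] by (auto simp: abs_mult intro: mult_le_one)
    \<comment> \<open>Both strings stay on their diameters, so they cannot collide, by
      \<open>diameters_eq\<close>, nor meet a parked point.\<close>
    have "of_real (q * a t) * \<zeta> \<in> cball 0 1 \<and> of_real (q * b t) * \<xi> \<in> cball 0 1 \<and>
      p (of_real (q * a t) * \<zeta>) \<noteq> p (of_real (q * b t) * \<xi>) \<and>
      of_real (q * a t) * \<zeta> \<notin> parked ` {1..n} \<and> of_real (q * b t) * \<xi> \<notin> parked ` {1..n}"
    proof (intro conjI)
      show "of_real (q * a t) * \<zeta> \<in> cball 0 1" "of_real (q * b t) * \<xi> \<in> cball 0 1"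
        using qab(1,2) by (simp_all add: norm_mult norm1 del: of_real_mult)
      show "p (of_real (q * a t) * \<zeta>) \<noteq> p (of_real (q * b t) * \<xi>)"
        using diameters_eq[OF qab(1,2)] qab(3) by blast
      show "of_real (q * a t) * \<zeta> \<notin> parked ` {1..n}" "of_real (q * b t) * \<xi> \<notin> parked ` {1..n}"
        using parked_off_diameters by (metis imageE)+
    qed
    then show "of_real ((1 - s + s * r) * a t) * \<zeta> \<in> cball 0 1 \<and> of_real ((1 - s + s * r) * b t) * \<xi> \<in> cball 0 1 \<and>
      p (of_real ((1 - s + s * r) * a t) * \<zeta>) \<noteq> p (of_real ((1 - s + s * r) * b t) * \<xi>) \<and>
      of_real ((1 - s + s * r) * a t) * \<zeta> \<notin> parked ` {1..n} \<and> of_real ((1 - s + s * r) * b t) * \<xi> \<notin> parked ` {1..n}"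
      unfolding q_def .
  qed (unfold case_prod_beta, intro continuous_intros cab, intro continuous_intros cab, simp_all add: ab01)
  moreover have "val (\<lambda>t. pair (of_real (r * a t) * \<zeta> - of_real (0 * r * b t) * \<xi>) (of_real ((1 - 0) * r * b t) * \<xi>)) =
        val (\<lambda>t. pair (of_real (r * a t) * \<zeta> - of_real (1 * r * b t) * \<xi>) (of_real ((1 - 1) * r * b t) * \<xi>))"
  proof (rule pair_homotopy[where u = "\<lambda>s t. of_real (r * a t) * \<zeta> - of_real (s * r * b t) * \<xi>"
        and v = "\<lambda>s t. of_real ((1 - s) * r * b t) * \<xi>"])
    fix s t :: real assume s: "s \<in> {0..1}" and t: "t \<in> {0..1}"
    let ?u = "of_real (r * a t) * \<zeta> - of_real (s * r * b t) * \<xi>"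
    let ?v = "of_real ((1 - s) * r * b t) * \<xi>"
    have ra: "\<bar>r * a t\<bar> \<le> r" "\<bar>r * b t\<bar> \<le> r"
      using ab[OF t] r(1) by (auto simp: abs_mult mult_left_le)
    have "\<bar>s * (r * b t)\<bar> \<le> r" "\<bar>(1 - s) * (r * b t)\<bar> \<le> r"
      using s ra(2) by (auto simp: abs_mult intro: order_trans[OF mult_left_le_one_le])
    then have nu: "norm ?u \<le> 2 * r" and nv: "norm ?v \<le> r"
      using norm_comb_le[of "r * a t" "s * r * b t"] ra(1)
      by (simp_all add: norm_mult norm1 mult.assoc del: of_real_mult)
    have small: "norm w \<le> 2 * r \<Longrightarrow> w \<in> ball 0 1 \<and> w \<notin> parked ` {1..n}" for w
      using \<delta>(2) r by fastforce
    \<comment> \<open>The difference of the two points does not depend on \<open>s\<close>: their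
      relative position is unchanged while the motion of \<open>j\<close> passes to
      \<open>k\<close>.\<close>
    have "?u \<noteq> ?v"
    proof
      assume "?u = ?v"
      then have "of_real (r * a t) * \<zeta> + of_real (- r * b t) * \<xi> = 0"
        by (simp add: algebra_simps)
      then show False
        using real_independent[OF indep, of "r * a t" "- r * b t"] ab(3)[OF t] r(1) by simp
    qed
    moreover have "?u \<in> ball 0 1 \<and> ?u \<notin> parked ` {1..n}" "?v \<in> ball 0 1 \<and> ?v \<notin> parked ` {1..n}"
      using small[OF nu] small[of ?v] nv r(1) by auto
    moreover have "?u \<in> cball 0 1" "?v \<in> cball 0 1"
      using calculation ball_subset_cball by blast+
    ultimately show "?u \<in> cball 0 1 \<and> ?v \<in> cball 0 1 \<and> p ?u \<noteq> p ?v \<and> ?u \<notin> parked ` {1..n} \<and> ?v \<notin> parked ` {1..n}"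
      using p_eq by blast
  qed (unfold case_prod_beta, intro continuous_intros cab, intro continuous_intros cab, simp_all add: ab01)
  moreover have "move (parked(j := 0)) k \<circ> diamond 0 (r *\<^sub>R (\<zeta> + \<xi>)) (r *\<^sub>R (\<zeta> - \<xi>)) =
      (\<lambda>t. pair (of_real (r * a t) * \<zeta> - of_real (1 * r * b t) * \<xi>) (of_real ((1 - 1) * r * b t) * \<xi>))"
  proof
    fix t
    have "diamond 0 (r *\<^sub>R (\<zeta> + \<xi>)) (r *\<^sub>R (\<zeta> - \<xi>)) t = of_real (r * a t) * \<zeta> - of_real (1 * r * b t) * \<xi>"
      unfolding diamond_eq a_def b_def by (simp add: algebra_simps)
    then show "(move (parked(j := 0)) k \<circ> diamond 0 (r *\<^sub>R (\<zeta> + \<xi>)) (r *\<^sub>R (\<zeta> - \<xi>))) t =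
        pair (of_real (r * a t) * \<zeta> - of_real (1 * r * b t) * \<xi>) (of_real ((1 - 1) * r * b t) * \<xi>)"
      unfolding o_def move_def pair_def fun_upd_twist[OF kj(3)] by simp
  qed
  ultimately show ?thesis
    using val_torus_boundary by (simp add: a_def b_def)
qed

text \<open>The resting points travel from the parked configuration to \<open>x\<close>, and the
  small loop of \<open>k\<close> is carried along around the moving point
  \<open>e s j\<close>.\<close>

lemma val_meridian:
  assumes x: "x ` rest k \<subseteq> ball 0 1" "inj_on x (rest k)"
  shows "\<forall>\<^sub>F r in at_right 0. val (move x k \<circ> diamond (x j) (r *\<^sub>R (\<zeta> + \<xi>)) (r *\<^sub>R (\<zeta> - \<xi>))) = \<one>"
proof -
  define y where "y = parked(j := 0)"
  have j: "j \<in> rest k"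
    using kj by (simp add: rest_def)
  have fin: "finite (rest k)"
    by (simp add: rest_def)
  have y: "y ` rest k \<subseteq> ball 0 1" "inj_on y (rest k)"
  proof -
    show "y ` rest k \<subseteq> ball 0 1"
      using parked_ball by (auto simp: y_def rest_def)
    show "inj_on y (rest k)"
      using parked_inj parked_off_diameters(1)[of _ 0] by (auto simp: y_def inj_on_def inj_def)
  qed
  obtain e where e: "\<And>i. continuous_on {0..1} (\<lambda>t::real. e t i)" "e 0 = y" "e 1 = x"
    "\<And>t. t \<in> {0..1} \<Longrightarrow> e t ` rest k \<subseteq> ball 0 1 \<and> inj_on (e t) (rest k)"
    using configuration_path[OF fin open_ball convex_ball y x] by blast
  have eb: "norm (e s l) < 1" if "l \<in> rest k" "s \<in> {0..1}" for l s
    using e(4)[OF that(2)] that(1) by auto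
  obtain \<delta>1 where \<delta>1: "\<delta>1 > 0" "\<forall>l\<in>{1..n}. \<delta>1 \<le> norm (parked l)"
    using parked_lower_bound by blast
  obtain \<delta>2 where \<delta>2: "\<delta>2 > 0" "\<forall>l\<in>rest k - {j}. \<forall>s\<in>{0..1}. \<delta>2 \<le> norm (e s l - e s j)"
  proof -
    have "norm (e s l - e s j) > 0" if "l \<in> rest k - {j}" "s \<in> {0..1}" for l s
      using e(4)[OF that(2)] that(1) j by (auto dest: inj_onD)
    then have "\<exists>\<delta>>0. \<forall>l\<in>rest k - {j}. \<forall>s\<in>{0..1}. \<delta> \<le> norm (e s l - e s j)"
      using fin e(1) by (intro uniform_positive_lower_bound continuous_intros) auto
    then show thesis using that by blast
  qed
  obtain \<delta>3 where \<delta>3: "\<delta>3 > 0" "\<forall>s\<in>{0..1}. \<delta>3 \<le> 1 - norm (e s j)"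
  proof -
    have "\<exists>\<delta>>0. \<forall>l\<in>{j}. \<forall>s\<in>{0..1}. \<delta> \<le> 1 - norm (e s l)"
      using e(1) eb[OF j] by (intro uniform_positive_lower_bound continuous_intros) auto
    then show thesis using that by blast
  qed
  \<comment> \<open>\<open>\<delta>1\<close> and \<open>1\<close> serve the parked configuration,
    \<open>\<delta>2\<close> keeps the loop off the other resting points and
    \<open>\<delta>3\<close> keeps it in the disc. The half is there because the diamond reaches at
    most \<open>2 * r\<close> from its centre.\<close>
  define R where "R = min (min \<delta>1 1) (min \<delta>2 \<delta>3) / 2"
  have "R > 0"
    using \<delta>1 \<delta>2 \<delta>3 by (simp add: R_def)
  then have "\<forall>\<^sub>F r in at_right 0. r \<in> {0<..<R}"
    by (rule eventually_at_right_real)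
  then show ?thesis
  proof eventually_elim
    case (elim r)
    then have r: "0 < r" "2 * r < \<delta>1" "2 * r < 1" "2 * r < \<delta>2" "2 * r < \<delta>3"
      by (auto simp: R_def min_def split: if_splits)
    define d where "d a = diamond a (r *\<^sub>R (\<zeta> + \<xi>)) (r *\<^sub>R (\<zeta> - \<xi>))" for a
    define c where "c t = of_real r * (of_real (Re (square_loop t)) * \<zeta> - of_real (Im (square_loop t)) * \<xi>)" for t
    have d: "d a t = a + c t" for a t
      by (simp add: d_def c_def diamond_eq)
    have cn: "norm (c t) \<le> 2 * r" "c t \<noteq> 0" if "t \<in> {0..1}" for t
    proof -
      note sq = diamond_square[OF that]
      have "norm (of_real (Re (square_loop t)) * \<zeta> - of_real (Im (square_loop t)) * \<xi>) \<le> 2"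
        using norm_comb_le[of "Re (square_loop t)" "Im (square_loop t)"] sq by linarith
      then show "norm (c t) \<le> 2 * r"
        using r(1) by (simp add: c_def norm_mult)
      show "c t \<noteq> 0"
        using real_independent[OF indep, of "Re (square_loop t)" "- Im (square_loop t)"] sq r(1)
        by (auto simp: c_def)
    qed
    have eq: "val (move (e 0) k \<circ> (\<lambda>t. e 0 j + c t)) = val (move (e 1) k \<circ> (\<lambda>t. e 1 j + c t))"
    proof (rule move_homotopy[OF kj(1), where c = "\<lambda>s t. e s j + c t"])
      show "continuous_on {0..1} (\<lambda>s. e s i)" for i
        by (rule e(1))
      show "e s ` rest k \<subseteq> ball 0 1 \<and> inj_on (e s) (rest k)" if "s \<in> {0..1}" for s
        using e(4)[OF that] .
      have "continuous_on ({0..1} \<times> {0..1}) (\<lambda>q::real \<times> real. e (fst q) j)"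
        by (intro continuous_on_compose2[OF e(1)[of j]] continuous_intros) auto
      then show "continuous_on ({0..1} \<times> {0..1}) (\<lambda>(s, t). e s j + c t)"
        unfolding case_prod_beta c_def by (intro continuous_intros continuous_square_loop_snd)
      show "e s j + c t \<in> cball 0 1 \<and> e s j + c t \<notin> e s ` rest k" if st: "s \<in> {0..1}" "t \<in> {0..1}" for s t
      proof
        have "norm (e s j + c t) \<le> norm (e s j) + norm (c t)"
          by (rule norm_triangle_ineq)
        then show "e s j + c t \<in> cball 0 1"
          using \<delta>3(2) st cn(1)[OF st(2)] r(5) by fastforce
        have "e s j + c t \<noteq> e s l" if l: "l \<in> rest k" for l
        proof (cases "l = j")
          case True
          then show ?thesis using cn(2)[OF st(2)] by simp
        next
          case False
          then have "\<delta>2 \<le> norm (e s l - e s j)"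
            using \<delta>2(2) st(1) l by blast
          then show ?thesis
            using cn(1)[OF st(2)] r(4) by (metis add_diff_cancel_left' not_le order_trans)
        qed
        then show "e s j + c t \<notin> e s ` rest k"
          by (metis imageE)
      qed
      show "move (e s) k (e s j + c 0) = move (e s) k (e s j + c 1)" for s
        by (simp add: c_def diamond_loop)
    qed
    have d': "(\<lambda>t. z + c t) = d z" for z
      by (simp add: d fun_eq_iff)
    have "val (move y k \<circ> d (y j)) = val (move x k \<circ> d (x j))"
      using eq unfolding d' e(2,3) .
    then show ?case
      using val_meridian_parked[OF \<delta>1 r(1-3)] by (simp add: y_def d_def)
  qed
qed

end

section \<open>Independence of the chosen path and of the resting points\<close>

context crossing_loops
begin

text \<open>Meridians are the only obstruction to a potential on the punctured disc, and
  \<open>val_meridian\<close> removes it at each resting point. The half diagonals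
  \<open>\<zeta> + \<xi>\<close> and \<open>\<zeta> - \<xi>\<close> inherit independence from
  \<open>\<zeta>\<close> and \<open>\<xi>\<close>.\<close>

lemma move_potential:
  assumes k: "k \<in> {1..n}" and x: "x ` rest k \<subseteq> ball 0 1" "inj_on x (rest k)"
  shows "\<exists>\<theta>. path_functional.potential H (\<lambda>c. val (move x k \<circ> c)) (cball 0 1 - x ` rest k) \<theta>"
proof (rule potential_convex_minus_finite[OF move_functional[OF k x]])
  show "x ` rest k \<inter> cball 0 1 \<subseteq> interior (cball 0 1)"
    using x(1) by auto
  fix a assume "a \<in> x ` rest k \<inter> cball 0 1"
  then obtain j where j: "j \<in> rest k" "a = x j"
    by blast
  interpret crossing_strings H n M val p \<zeta> \<xi> k j
    using k j by unfold_locales (auto simp: rest_def)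
  have "Im ((\<zeta> - \<xi>) * cnj (\<zeta> + \<xi>)) = 2 * Im (\<zeta> * cnj \<xi>)"
    by (simp add: algebra_simps)
  then show "\<exists>f h. Im (h * cnj f) \<noteq> 0 \<and> (\<forall>\<^sub>F r in at_right 0. val (move x k \<circ> diamond a (r *\<^sub>R f) (r *\<^sub>R h)) = \<one>)"
    using val_meridian[OF x] indep unfolding j(2) by (intro exI[of _ "\<zeta> + \<xi>"] exI[of _ "\<zeta> - \<xi>"]) simp
qed (simp_all add: rest_def)

text \<open>With \<open>ea\<close> and \<open>eb\<close> parametrizing the two copies of an edge,
  both loops have the value of one path \<open>\<beta>0\<close> along the boundary circle from
  \<open>eb 0\<close> to \<open>ea 0\<close>. Resting points in the open disc never meet the circle,
  so they can be moved from \<open>x\<close> to \<open>x'\<close> while \<open>\<beta>0\<close> is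
  kept.\<close>

lemma val_edge_loop_eq:
  fixes ea eb :: "real \<Rightarrow> complex"
  assumes k: "k \<in> {1..n}" and x: "x ` rest k \<subseteq> ball 0 1" "inj_on x (rest k)"
    and x': "x' ` rest k \<subseteq> ball 0 1" "inj_on x' (rest k)"
    and ea: "continuous_on {0..1} ea" "ea ` {0..1} \<subseteq> sphere 0 1"
    and eb: "continuous_on {0..1} eb" "eb ` {0..1} \<subseteq> sphere 0 1"
    and eq: "\<And>t. t \<in> {0..1} \<Longrightarrow> p (ea t) = p (eb t)"
    and t: "t \<in> {0..1}" "path_in (cball 0 1 - x ` rest k) z \<alpha> (ea t)" "path_in (cball 0 1 - x ` rest k) (eb t) \<beta> z"
    and t': "t' \<in> {0..1}" "path_in (cball 0 1 - x' ` rest k) z' \<alpha>' (ea t')" "path_in (cball 0 1 - x' ` rest k) (eb t') \<beta>' z'"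
  shows "val (move x k \<circ> (\<alpha> +++ \<beta>)) = val (move x' k \<circ> (\<alpha>' +++ \<beta>'))"
proof -
  have sph: "ea t \<in> sphere 0 1" "eb t \<in> sphere 0 1" if "t \<in> {0..1}" for t
    by (rule subsetD[OF ea(2) imageI[OF that]] subsetD[OF eb(2) imageI[OF that]])+
  have ends: "eb 0 \<in> sphere 0 1" "ea 0 \<in> sphere 0 1"
    using sph[of 0] by simp_all
  moreover have "path_connected (sphere (0::complex) 1)"
    by (rule path_connected_sphere) simp
  ultimately obtain \<beta>0 where \<beta>0: "path \<beta>0" "path_image \<beta>0 \<subseteq> sphere 0 1" "pathstart \<beta>0 = eb 0" "pathfinish \<beta>0 = ea 0"
    unfolding path_connected_def by blast
  have reduce: "val (move x k \<circ> (\<alpha> +++ \<beta>)) = val (move x k \<circ> \<beta>0)"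
    if x: "x ` rest k \<subseteq> ball 0 1" "inj_on x (rest k)" and t: "t \<in> {0..1}"
      and \<alpha>: "path_in (cball 0 1 - x ` rest k) z \<alpha> (ea t)" and \<beta>: "path_in (cball 0 1 - x ` rest k) (eb t) \<beta> z"
    for x z \<alpha> \<beta> and t :: real
  proof -
    define W where "W = cball 0 1 - x ` rest k"
    interpret X: path_functional H W "\<lambda>c. val (move x k \<circ> c)"
      unfolding W_def by (rule move_functional[OF k x])
    obtain \<theta> where \<theta>: "X.potential W \<theta>"
      using move_potential[OF k x] unfolding W_def by blast
    have sW: "sphere 0 1 \<subseteq> W"
      using x(1) by (auto simp: W_def)
    have \<alpha>W: "path \<alpha>" "path_image \<alpha> \<subseteq> W" "pathstart \<alpha> = z" "pathfinish \<alpha> = ea t"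
      and \<beta>W: "path \<beta>" "path_image \<beta> \<subseteq> W" "pathstart \<beta> = eb t" "pathfinish \<beta> = z"
      using \<alpha> \<beta> by (auto simp: path_in_def W_def)
    have seg: "closed_segment 0 t \<subseteq> {0..1}"
      using t by (simp add: closed_segment_eq_real_ivl)
    have arc: "path (e \<circ> linepath 0 t)" "path_image (e \<circ> linepath 0 t) \<subseteq> W"
      "pathstart (e \<circ> linepath 0 t) = e 0" "pathfinish (e \<circ> linepath 0 t) = e t"
      if "continuous_on {0..1} e" "e ` {0..1} \<subseteq> sphere 0 1" for e
    proof -
      show "path (e \<circ> linepath 0 t)"
        using seg by (intro path_continuous_image continuous_on_subset[OF that(1)]) auto
      show "path_image (e \<circ> linepath 0 t) \<subseteq> W"
        using seg that(2) sW by (auto simp: path_image_compose)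
    qed (simp_all add: pathstart_compose pathfinish_compose)
    \<comment> \<open>The arcs of \<open>ea\<close> and \<open>eb\<close> from \<open>0\<close> to
      \<open>t\<close> have the same image in the configuration space. Their common value
      \<open>v\<close> cancels, which makes the crossing parameter irrelevant.\<close>
    define v where "v = val (move x k \<circ> (ea \<circ> linepath 0 t))"
    have v': "v = val (move x k \<circ> (eb \<circ> linepath 0 t))"
    proof -
      have "move x k (ea (linepath 0 t s)) = move x k (eb (linepath 0 t s))" if "s \<in> {0..1}" for s
      proof -
        have "linepath 0 t s \<in> {0..1}"
          using linepath_in_path[OF that, of 0 t] seg by blast
        then show ?thesis
          using eq by (auto simp: move_def base_config_def)
      qed
      moreover have "path (move x k \<circ> (ea \<circ> linepath 0 t))" "path_image (move x k \<circ> (ea \<circ> linepath 0 t)) \<subseteq> config_space n M"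
        using arc(1,2)[OF ea] move_continuous[OF k x] unfolding W_def
        by (auto simp: path_image_compose[of "move x k"] intro!: path_continuous_image[of _ "move x k"] intro: continuous_on_subset)
      ultimately show ?thesis
        unfolding v_def by (intro val_cong) (simp_all del: atLeastAtMost_iff)
    qed
    have cl: "v \<in> carrier H" "val (move x k \<circ> \<alpha>) \<in> carrier H" "val (move x k \<circ> \<beta>) \<in> carrier H" "val (move x k \<circ> \<beta>0) \<in> carrier H"
      unfolding v_def using \<alpha>W \<beta>W \<beta>0 sW arc[OF ea] by (auto intro!: X.val_closed simp del: path_image_compose)
    have th: "\<theta> w \<in> carrier H" if "w \<in> W" for w
      using X.potential_closed[OF \<theta> that] .
    have mem: "ea 0 \<in> W" "eb 0 \<in> W" "ea t \<in> W" "eb t \<in> W"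
      using ends sW sph[OF t] by blast+
    have *: "\<theta> z \<otimes> val (move x k \<circ> \<alpha>) = \<theta> (ea t)" "\<theta> (eb t) \<otimes> val (move x k \<circ> \<beta>) = \<theta> z"
      "\<theta> (eb 0) \<otimes> val (move x k \<circ> \<beta>0) = \<theta> (ea 0)" "\<theta> (ea 0) \<otimes> v = \<theta> (ea t)" "\<theta> (eb 0) \<otimes> v = \<theta> (eb t)"
      using X.potentialD[OF \<theta> \<alpha>W(1,2)] X.potentialD[OF \<theta> \<beta>W(1,2)] X.potentialD[OF \<theta> \<beta>0(1) order_trans[OF \<beta>0(2) sW]]
        X.potentialD[OF \<theta> arc(1,2)[OF ea]] X.potentialD[OF \<theta> arc(1,2)[OF eb]]
      unfolding \<alpha>W(3,4) \<beta>W(3,4) \<beta>0(3,4) arc(3,4)[OF ea] arc(3,4)[OF eb] v_def[symmetric] v'[symmetric] by simp_all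
    \<comment> \<open>In the order \<open>\<beta>\<close>, \<open>\<alpha>\<close> the loop is a
      path in the punctured disc from \<open>eb t\<close> through \<open>z\<close> to
      \<open>ea t\<close>, where the potential can be used.\<close>
    have "\<theta> (eb t) \<otimes> (val (move x k \<circ> \<beta>) \<otimes> val (move x k \<circ> \<alpha>)) = \<theta> (ea t)"
      using *(1,2) m_assoc[OF th[OF mem(4)] cl(3,2)] by simp
    also have "\<dots> = \<theta> (eb t) \<otimes> val (move x k \<circ> \<beta>0)"
    proof -
      have "\<theta> (ea t) = \<theta> (eb 0) \<otimes> val (move x k \<circ> \<beta>0) \<otimes> v"
        using *(3,4) by simp
      also have "\<dots> = \<theta> (eb 0) \<otimes> v \<otimes> val (move x k \<circ> \<beta>0)"
        using th[OF mem(2)] cl by (simp add: m_assoc m_comm[of v])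
      finally show ?thesis
        using *(5) by simp
    qed
    finally have "val (move x k \<circ> \<beta>) \<otimes> val (move x k \<circ> \<alpha>) = val (move x k \<circ> \<beta>0)"
      using th[OF mem(4)] cl by simp
    have "z \<in> W"
      using \<alpha>W by (metis pathstart_in_path_image subsetD)
    moreover have "move x k (ea t) = move x k (eb t)"
      using eq[OF t] by (auto simp: move_def base_config_def)
    moreover have "path (move x k \<circ> c)" "path_image (move x k \<circ> c) \<subseteq> config_space n M" if "path c" "path_image c \<subseteq> W" for c
      using that move_continuous[OF k x] unfolding W_def
      by (auto simp: path_image_compose[of "move x k"] intro!: path_continuous_image[of _ "move x k"] intro: continuous_on_subset)
    \<comment> \<open>In the disc \<open>\<alpha> +++ \<beta>\<close> may jump from
      \<open>ea t\<close> to \<open>eb t\<close>; the join is evaluated in the configuration space,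
      where the ends agree.\<close>
    ultimately have "val (move x k \<circ> (\<alpha> +++ \<beta>)) = val (move x k \<circ> \<alpha>) \<otimes> val (move x k \<circ> \<beta>)"
      unfolding path_compose_join using \<alpha>W \<beta>W by (intro val_join) (auto simp: pathfinish_compose pathstart_compose)
    then show ?thesis
      using \<open>val (move x k \<circ> \<beta>) \<otimes> val (move x k \<circ> \<alpha>) = val (move x k \<circ> \<beta>0)\<close> cl by (simp add: m_comm)
  qed
  obtain e where e: "\<And>i. continuous_on {0..1} (\<lambda>t::real. e t i)" "e 0 = x" "e 1 = x'"
    "\<And>t. t \<in> {0..1} \<Longrightarrow> e t ` rest k \<subseteq> ball 0 1 \<and> inj_on (e t) (rest k)"
    using configuration_path[OF _ open_ball convex_ball x x'] by (auto simp: rest_def)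
  have "val (move (e 0) k \<circ> \<beta>0) = val (move (e 1) k \<circ> \<beta>0)"
  proof (rule move_homotopy[OF k e(1) e(4), where c = "\<lambda>_. \<beta>0"])
    show "continuous_on ({0..1} \<times> {0..1}) (\<lambda>(s::real, t::real). \<beta>0 t)"
      unfolding case_prod_beta
      by (rule continuous_on_compose2[OF \<beta>0(1)[unfolded path_def] continuous_on_snd[OF continuous_on_id]]) auto
    show "\<beta>0 t \<in> cball 0 1 \<and> \<beta>0 t \<notin> e s ` rest k" if "s \<in> {0..1}" "t \<in> {0..1}" for s t :: real
    proof -
      have "\<beta>0 t \<in> sphere 0 1"
        using \<beta>0(2) that(2) unfolding path_image_def by blast
      then have "norm (\<beta>0 t) = 1"
        by simp
      then show ?thesis
        using e(4)[OF that(1)] by auto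
    qed
    show "move (e s) k (\<beta>0 0) = move (e s) k (\<beta>0 1)" for s
      using \<beta>0(3,4) eq[of 0] by (auto simp: move_def base_config_def pathstart_def pathfinish_def)
  qed
  then show ?thesis
    using reduce[OF x t] reduce[OF x' t'] e(2,3) by simp
qed

end

section \<open>The surface as a quotient of the disc\<close>

lemma glue_param_glue_param [simp]: "glue_param orientable g r (glue_param orientable g r t) = t"
  by (simp add: glue_param_def)

lemma glue_param_unit: "t \<in> {0..1} \<Longrightarrow> glue_param orientable g r t \<in> {0..1}"
  by (auto simp: glue_param_def)

text \<open>Edge \<open>m + k\<close> lies half a turn after edge \<open>k\<close>.\<close>

lemma edge_point_opposite: "m > 0 \<Longrightarrow> edge_point m (m + k) t = - edge_point m k t"
proof -
  assume "m > 0"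
  then have "pi * (real (m + k) - 1 + t) / real m = pi + pi * (real k - 1 + t) / real m"
    by (simp add: field_simps)
  then show ?thesis
    by (simp add: edge_point_def cis_mult[symmetric])
qed

lemma norm_edge_point: "norm (edge_point m k t) = 1"
  by (simp add: edge_point_def)

lemma continuous_on_edge_point: "continuous_on S (edge_point m k)"
  unfolding edge_point_def by (cases "m = 0") (auto intro!: continuous_intros)

text \<open>Edges \<open>1\<close> to \<open>m\<close> fill half of the circle, and up to sign a
  point determines its angle modulo \<open>pi\<close>. As \<open>t\<close> is strictly inside its
  edge, \<open>t - t'\<close> is an integer of absolute value below one.\<close>

lemma edge_point_eq_up_to_sign:
  assumes r: "r \<in> {1..m}" "r' \<in> {1..m}" and t: "t \<in> {0<..<1}" "t' \<in> {0..1}"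
    and eq: "edge_point m r' t' = edge_point m r t \<or> edge_point m r' t' = - edge_point m r t"
  shows "r' = r \<and> t' = t"
proof -
  define a b where "a = pi * (real r - 1 + t) / real m" and "b = pi * (real r' - 1 + t') / real m"
  have m: "m > 0"
    using r by auto
  have "(cos b = cos a \<and> sin b = sin a) \<or> (cos b = - cos a \<and> sin b = - sin a)"
    using eq by (auto simp: edge_point_def a_def[symmetric] b_def[symmetric] complex_eq_iff)
  then have "sin (a - b) = 0"
    by (auto simp: sin_diff)
  then obtain q :: int where "a - b = of_int q * pi"
    using sin_zero_iff_int2 by blast
  moreover have "a - b = pi * (((real r - 1 + t) - (real r' - 1 + t')) / real m)"
    by (simp add: a_def b_def diff_divide_distrib[symmetric] right_diff_distrib[symmetric])
  ultimately have "pi * (((real r - 1 + t) - (real r' - 1 + t')) / real m) = pi * of_int q"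
    by (metis mult.commute)
  then have "((real r - 1 + t) - (real r' - 1 + t')) / real m = of_int q"
    unfolding mult_cancel_left using pi_neq_zero by blast
  then have q: "real r - real r' + (t - t') = real m * of_int q"
    using m by (simp add: field_simps)
  have "t - t' = of_int (int m * q - int r + int r')"
    using q by simp
  moreover have "-1 < t - t'" "t - t' < 1"
    using t by auto
  ultimately have z: "int m * q - int r + int r' = 0"
    by linarith
  then have "t' = t"
    using \<open>t - t' = of_int (int m * q - int r + int r')\<close> by simp
  have "int r - int r' = int m * q"
    using z by simp
  moreover have "\<bar>int r - int r'\<bar> < int m"
    using r by auto
  ultimately have "int r - int r' = 0"
    by (metis abs_dvd_iff dvd_triv_left zdvd_not_zless abs_of_pos zero_less_abs_iff abs_ge_zero dvd_abs_iff)
  then show ?thesis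
    using \<open>t' = t\<close> by simp
qed

text \<open>With \<open>\<zeta>\<close> the given edge point, \<open>{\<zeta>, - \<zeta>}\<close> is
  saturated for \<open>glued\<close>: a point strictly inside an edge is touched by the gluing of
  this edge only, and there its parameter is fixed.\<close>

lemma equivclp_glued_antipodal:
  assumes r: "r \<in> {1..num_labels orientable g}" and t: "t \<in> {0<..<1}" "glue_param orientable g r t = t"
    and eq: "equivclp (glued orientable g) (edge_point (num_labels orientable g) r t) w"
  shows "w = edge_point (num_labels orientable g) r t \<or> w = - edge_point (num_labels orientable g) r t"
proof -
  define m where "m = num_labels orientable g"
  define \<zeta> where "\<zeta> = edge_point m r t"
  have m: "m > 0"
    using r by (auto simp: m_def)
  have iff: "z \<in> {\<zeta>, - \<zeta>} \<longleftrightarrow> w \<in> {\<zeta>, - \<zeta>}" if gl: "glued orientable g z w" for z w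
  proof -
    obtain r' t' where r': "r' \<in> {1..m}" "t' \<in> {0..1}" and z: "z = edge_point m r' t'"
      and w: "w = edge_point m (m + r') (glue_param orientable g r' t')"
      using gl unfolding glued_def Let_def m_def[symmetric] by blast
    have w: "w = - edge_point m r' (glue_param orientable g r' t')"
      unfolding w by (rule edge_point_opposite[OF m])
    have rm: "r \<in> {1..m}"
      using r by (simp add: m_def)
    show ?thesis
    proof
      assume "z \<in> {\<zeta>, - \<zeta>}"
      then have "r' = r \<and> t' = t"
        unfolding z \<zeta>_def using edge_point_eq_up_to_sign[OF rm r'(1) t(1) r'(2)] by auto
      then show "w \<in> {\<zeta>, - \<zeta>}"
        using t(2) by (simp add: w \<zeta>_def)
    next
      assume "w \<in> {\<zeta>, - \<zeta>}"
      moreover have "edge_point m r' (glue_param orientable g r' t') = - w"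
        by (simp add: w)
      ultimately have "r' = r \<and> glue_param orientable g r' t' = t"
        unfolding \<zeta>_def
        by (intro edge_point_eq_up_to_sign[OF rm r'(1) t(1) glue_param_unit[OF r'(2)]]) auto
      then have "r' = r" "t' = t"
        using t(2) glue_param_glue_param[of orientable g r t'] by auto
      then show "z \<in> {\<zeta>, - \<zeta>}"
        by (simp add: z \<zeta>_def)
    qed
  qed
  have "w \<in> {\<zeta>, - \<zeta>}"
    using eq unfolding m_def[symmetric] \<zeta>_def[symmetric]
  proof (induction rule: equivclp_induct)
    case base
    then show ?case by simp
  next
    case (step y z)
    then show ?case using iff by blast
  qed
  then show ?thesis
    by (simp add: \<zeta>_def m_def)
qed

lemma polygon_surface_glue:
  assumes "polygon_surface orientable g M p" "r \<in> {1..num_labels orientable g}" "t \<in> {0..1}"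
  shows "p (edge_point (num_labels orientable g) r t) =
    p (edge_point (num_labels orientable g) (num_labels orientable g + r) (glue_param orientable g r t))"
proof -
  define m where "m = num_labels orientable g"
  have "glued orientable g (edge_point m r t) (edge_point m (m + r) (glue_param orientable g r t))"
    using assms(2,3) unfolding glued_def Let_def m_def by blast
  then have "equivclp (glued orientable g) (edge_point m r t) (edge_point m (m + r) (glue_param orientable g r t))"
    by blast
  moreover have "edge_point m r t \<in> cball 0 1" "edge_point m (m + r) (glue_param orientable g r t) \<in> cball 0 1"
    by (simp_all add: norm_edge_point)
  ultimately show ?thesis
    using assms(1) unfolding polygon_surface_def m_def by blast
qed

lemma crossing_diameters:
  assumes M: "polygon_surface orientable g M p" and "g \<ge> 1"
  obtains \<zeta> \<xi> where "norm \<zeta> = 1" "norm \<xi> = 1" "Im (\<zeta> * cnj \<xi>) \<noteq> 0"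
    "p (- \<zeta>) = p \<zeta>" "p (- \<xi>) = p \<xi>" "p \<zeta> \<noteq> p \<xi>"
proof -
  define m where "m = num_labels orientable g"
  have m: "m > 0"
    using \<open>g \<ge> 1\<close> by (simp add: m_def num_labels_def)
  have "\<exists>r t r' t'. r \<in> {1..m} \<and> r' \<in> {1..m} \<and> t \<in> {0<..<1} \<and> t' \<in> {0<..<1} \<and>
      glue_param orientable g r t = t \<and> glue_param orientable g r' t' = t' \<and> (r \<noteq> r' \<or> t \<noteq> t')"
  proof (cases orientable)
    case True
    then have "m \<ge> 2"
      using \<open>g \<ge> 1\<close> by (simp add: m_def num_labels_def)
    \<comment> \<open>Translation takes \<open>t\<close> to \<open>1 - t\<close>, so exactly the
      midpoints keep their parameter; there are two edges to choose from.\<close>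
    then show ?thesis
      using True by (intro exI[of _ 1] exI[of _ "1/2"] exI[of _ 2] exI[of _ "1/2"]) (simp add: glue_param_def)
  next
    case False
    \<comment> \<open>On the reversed edge \<open>g\<close> every parameter is kept;
      \<open>1/4\<close> and \<open>3/4\<close> are any two distinct values inside it.\<close>
    then show ?thesis
      using \<open>g \<ge> 1\<close>
      by (intro exI[of _ g] exI[of _ "1/4"] exI[of _ g] exI[of _ "3/4"]) (simp add: glue_param_def m_def num_labels_def)
  qed
  then obtain r t r' t' where r: "r \<in> {1..m}" "t \<in> {0<..<1}" "glue_param orientable g r t = t"
    and r': "r' \<in> {1..m}" "t' \<in> {0<..<1}" "glue_param orientable g r' t' = t'" and ne: "r \<noteq> r' \<or> t \<noteq> t'"
    by blast
  define \<zeta> \<xi> where "\<zeta> = edge_point m r t" and "\<xi> = edge_point m r' t'"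
  have unit: "t \<in> {0..1}" "t' \<in> {0..1}"
    using r r' by auto
  have nx: "\<not> (\<xi> = \<zeta> \<or> \<xi> = - \<zeta>)"
    unfolding \<zeta>_def \<xi>_def using edge_point_eq_up_to_sign[OF r(1) r'(1) r(2) unit(2)] ne by blast
  have n1: "norm \<zeta> = 1" "norm \<xi> = 1"
    by (simp_all add: \<zeta>_def \<xi>_def norm_edge_point)
  \<comment> \<open>Two unit numbers with real quotient agree up to sign, which \<open>nx\<close>
    excludes.\<close>
  have "Im (\<zeta> * cnj \<xi>) \<noteq> 0"
  proof
    assume im: "Im (\<zeta> * cnj \<xi>) = 0"
    define q where "q = Re (\<zeta> * cnj \<xi>)"
    have q: "\<zeta> * cnj \<xi> = of_real q"
      using im by (simp add: q_def complex_eq_iff)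
    have "\<bar>q\<bar> = 1"
      using n1 arg_cong[OF q, of norm] by (simp add: norm_mult)
    have "\<zeta> * (cnj \<xi> * \<xi>) = of_real q * \<xi>"
      using q by (simp add: mult.assoc[symmetric])
    moreover have "cnj \<xi> * \<xi> = 1"
      using n1(2) by (metis complex_norm_square mult.commute of_real_1 power_one)
    ultimately have "\<zeta> = of_real q * \<xi>"
      by simp
    moreover have "q = 1 \<or> q = -1"
      using \<open>\<bar>q\<bar> = 1\<close> by auto
    ultimately show False
      using nx by auto
  qed
  moreover have "p (- \<zeta>) = p \<zeta>" "p (- \<xi>) = p \<xi>"
    using polygon_surface_glue[OF M r(1)[unfolded m_def] unit(1)] polygon_surface_glue[OF M r'(1)[unfolded m_def] unit(2)]
      r(3) r'(3) edge_point_opposite[OF m] unfolding \<zeta>_def \<xi>_def m_def by metis+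
  moreover have "p \<zeta> \<noteq> p \<xi>"
  proof
    assume "p \<zeta> = p \<xi>"
    then have "equivclp (glued orientable g) \<zeta> \<xi>"
      using M n1 by (auto simp: polygon_surface_def)
    then show False
      using equivclp_glued_antipodal[OF r(1)[unfolded m_def] r(2,3)] nx unfolding \<zeta>_def m_def by blast
  qed
  ultimately show thesis
    using that n1 by blast
qed

section \<open>The automorphism permuting the strings\<close>

text \<open>Unlike in \<open>edge_loop\<close>, the parameter is also allowed to be an end of the
  edge, since the comparison of loops slides the crossing to \<open>t = 0\<close>.\<close>

definition leave_point :: "bool \<Rightarrow> nat \<Rightarrow> (nat \<Rightarrow> bool) \<Rightarrow> nat \<Rightarrow> real \<Rightarrow> complex" where
  "leave_point orientable g out r t =
     (let m = num_labels orientable g in edge_point m (if out r then r else m + r) t)"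

definition enter_point :: "bool \<Rightarrow> nat \<Rightarrow> (nat \<Rightarrow> bool) \<Rightarrow> nat \<Rightarrow> real \<Rightarrow> complex" where
  "enter_point orientable g out r t =
     (let m = num_labels orientable g in edge_point m (if out r then m + r else r) (glue_param orientable g r t))"

lemma norm_leave_enter:
  "norm (leave_point orientable g out r t) = 1" "norm (enter_point orientable g out r t) = 1"
  by (simp_all add: leave_point_def enter_point_def Let_def norm_edge_point)

lemma continuous_on_leave_enter:
  "continuous_on S (leave_point orientable g out r)" "continuous_on S (enter_point orientable g out r)"
proof -
  show "continuous_on S (leave_point orientable g out r)"
    unfolding leave_point_def Let_def by (rule continuous_on_edge_point)
  have "continuous_on S (glue_param orientable g r)"
    unfolding glue_param_def by (cases "\<not> orientable \<and> r = g") (auto intro!: continuous_intros)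
  then show "continuous_on S (enter_point orientable g out r)"
    unfolding enter_point_def Let_def
    by (rule continuous_on_compose2[OF continuous_on_edge_point[of UNIV]]) simp
qed

text \<open>If the loop leaves through edge \<open>m + r\<close>, the identification is read
  backwards; \<open>glue_param\<close> is an involution, so the same formula serves.\<close>

lemma leave_enter_glued:
  assumes "polygon_surface orientable g M p" "r \<in> {1..num_labels orientable g}" "t \<in> {0..1}"
  shows "p (leave_point orientable g out r t) = p (enter_point orientable g out r t)"
  using polygon_surface_glue[OF assms] polygon_surface_glue[OF assms(1,2) glue_param_unit[OF assms(3)]]
  by (simp add: leave_point_def enter_point_def Let_def)

text \<open>The half-open arcs are completed by their end points on the circle, where no point of
  \<open>b\<close> lies.\<close>

lemma edge_loop_paths:
  assumes b: "b ` {1..n} \<subseteq> ball 0 1" and loop: "edge_loop orientable g n p b out i r c"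
  obtains \<alpha> \<beta> t where "c = p \<circ> (\<alpha> +++ \<beta>)" "t \<in> {0..1}"
    "path_in (cball 0 1 - b ` ({1..n} - {i})) (b i) \<alpha> (leave_point orientable g out r t)"
    "path_in (cball 0 1 - b ` ({1..n} - {i})) (enter_point orientable g out r t) \<beta> (b i)"
proof -
  define W where "W = cball 0 1 - b ` ({1..n} - {i})"
  define P where "P = ball 0 1 - b ` ({1..n} - {i})"
  obtain \<alpha> \<beta> t where t: "t \<in> {0<..<1}" and c: "c = (p \<circ> \<alpha>) +++ (p \<circ> \<beta>)"
    and path: "path \<alpha>" "path \<beta>" "pathstart \<alpha> = b i" "pathfinish \<alpha> = leave_point orientable g out r t"
      "pathstart \<beta> = enter_point orientable g out r t" "pathfinish \<beta> = b i"
    and P: "\<alpha> ` {0..<1} \<subseteq> P" "\<beta> ` {0<..1} \<subseteq> P"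
    using loop unfolding edge_loop_def leave_point_def enter_point_def Let_def P_def by blast
  have PW: "P \<subseteq> W"
    by (auto simp: P_def W_def)
  have "w \<in> W" if "norm w = 1" for w
    using that b by (auto simp: W_def)
  then have ends: "\<alpha> 1 \<in> W" "\<beta> 0 \<in> W"
    using path(4,5) by (simp_all add: norm_leave_enter pathfinish_def pathstart_def)
  have "{0..1::real} = insert 1 {0..<1}" "{0..1::real} = insert 0 {0<..1}"
    by auto
  then have "path_image \<alpha> = insert (\<alpha> 1) (\<alpha> ` {0..<1})" "path_image \<beta> = insert (\<beta> 0) (\<beta> ` {0<..1})"
    unfolding path_image_def by (metis image_insert)+
  then have "path_image \<alpha> \<subseteq> W" "path_image \<beta> \<subseteq> W"
    using P PW ends by auto
  then show thesis
    using that[of \<alpha> \<beta> t] t path c unfolding W_def by (auto simp: path_in_def path_compose_join)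
qed

lemma continuous_on_reindex:
  fixes X :: "('i \<Rightarrow> 'a::topological_space) set"
  shows "continuous_on X (\<lambda>x. x \<circ> \<sigma>)"
proof (rule continuous_on_coordinatewise_then_product)
  show "continuous_on X (\<lambda>x. (x \<circ> \<sigma>) i)" for i
    unfolding o_def by (rule continuous_on_product_then_coordinatewise[OF continuous_on_id])
qed

lemma config_space_reindex:
  assumes "\<sigma> permutes {1..n}" "x \<in> config_space n M"
  shows "x \<circ> \<sigma> \<in> config_space n M"
proof -
  have "x \<circ> \<sigma> \<in> {1..n} \<rightarrow>\<^sub>E M"
  proof (rule PiE_I)
    show "(x \<circ> \<sigma>) i \<in> M" if "i \<in> {1..n}" for i
      using PiE_mem[of x "{1..n}" "\<lambda>_. M" "\<sigma> i"] assms(2) permutes_in_image[OF assms(1), of i] that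
      by (simp add: config_space_def)
    show "(x \<circ> \<sigma>) i = undefined" if "i \<notin> {1..n}" for i
      using PiE_arb[of x "{1..n}" "\<lambda>_. M" i] assms(2) permutes_not_in[OF assms(1) that] that
      by (simp add: config_space_def)
  qed
  moreover have "inj_on (x \<circ> \<sigma>) {1..n}"
    using assms permutes_inj_on[OF assms(1)] permutes_image[OF assms(1)]
    by (intro comp_inj_on) (auto simp: config_space_def)
  ultimately show ?thesis
    by (simp add: config_space_def)
qed

text \<open>\<open>val d\<close> cancels against its inverse by commutativity, so moving the base
  point back along \<open>\<gamma>\<close> does not affect values.\<close>

lemma (in path_functional) val_conjugate:
  assumes "path_in F x d y" "path_in F y c y"
  shows "val (d +++ (c +++ reversepath d)) = val c"
proof -
  have "val d \<in> carrier H" "val c \<in> carrier H"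
    using assms by (auto simp: path_in_def)
  moreover have "val (d +++ (c +++ reversepath d)) = val d \<otimes> (val c \<otimes> inv (val d))"
    using assms by (simp add: path_in_def val_join path_image_join val_reversepath)
  ultimately show ?thesis
    by (simp add: m_lcomm[of "val d"])
qed

theorem theorem4p1:
  fixes M :: "'a::topological_space set" and p :: "complex \<Rightarrow> 'a"
    and g n :: nat and orientable :: bool
    and b :: "nat \<Rightarrow> complex" and out :: "nat \<Rightarrow> bool"
    and \<rho> :: "nat \<Rightarrow> nat \<Rightarrow> (real \<Rightarrow> nat \<Rightarrow> 'a) set"
    and \<tau> :: "nat \<Rightarrow> nat"
  assumes "g \<ge> 1" and "n \<ge> 1"
    and "polygon_surface orientable g M p"
    and "on_segment_in_order n b"
    and "\<And>i r. i \<in> {1..n} \<Longrightarrow> r \<in> {1..num_labels orientable g} \<Longrightarrow>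
           \<rho> i r \<in> rho_braids orientable g n M p b out i r"
    and "\<tau> permutes {1..n}"
  shows "let P = pure_braid_group n M (base_config n p b) in
         \<exists>\<phi>\<in>auto P. \<forall>i\<in>{1..n}. \<forall>r\<in>{1..num_labels orientable g}.
           ab_map P \<phi> (ab_class P (\<rho> i r)) = ab_class P (\<rho> (\<tau> i) r)"
proof -
  note M = assms(3) and seg = assms(4) and rho = assms(5) and \<tau> = assms(6)
  define F where "F = config_space n M"
  define Q where "Q = base_config n p b"
  define P where "P = pure_braid_group n M Q"
  have P: "P = fundamental_group F Q"
    by (simp add: P_def pure_braid_group_def F_def)
  have QF: "Q \<in> F"
    unfolding Q_def F_def by (rule base_config_in_config_space[OF M seg])
  obtain val where val: "path_functional (abelianization P) F val"
    "\<And>c. c \<in> loops_at F Q \<Longrightarrow> val c = ab_class P (path_class F c)"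
    using fundamental_group_path_functional[OF QF] unfolding P by blast
  obtain \<zeta> \<xi> where \<zeta>\<xi>: "norm \<zeta> = 1" "norm \<xi> = 1" "Im (\<zeta> * cnj \<xi>) \<noteq> 0"
    "p (- \<zeta>) = p \<zeta>" "p (- \<xi>) = p \<xi>" "p \<zeta> \<noteq> p \<xi>"
    using crossing_diameters[OF M \<open>g \<ge> 1\<close>] by blast
  have p: "continuous_on (cball 0 1) p" "p ` cball 0 1 = M"
    using M quotient_imp_continuous_map[of "top_of_set (cball 0 1)" "top_of_set M" p]
    by (auto simp: polygon_surface_def quotient_map_def continuous_map_in_subtopology)
  interpret crossing_loops "abelianization P" n M val p \<zeta> \<xi>
    using val(1) p \<zeta>\<xi> polygon_surface_eqD[OF M]
    unfolding F_def crossing_loops_def crossing_loops_axioms_def disc_braids_def disc_braids_axioms_def by blast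
  interpret G: group P
    unfolding P by (rule group_fundamental_group[OF QF])
  \<comment> \<open>Composing a configuration with the inverse of \<open>\<tau>\<close> gives index
    \<open>\<tau> i\<close> to the point that had index \<open>i\<close>.\<close>
  define \<sigma> where "\<sigma> = inv_into UNIV \<tau>"
  have \<sigma>: "\<sigma> permutes {1..n}" "\<tau> \<circ> \<sigma> = id" "\<sigma> \<circ> \<tau> = id"
    unfolding \<sigma>_def by (rule permutes_inv[OF \<tau>] permutes_inv_o[OF \<tau>])+
  have b: "b ` {1..n} \<subseteq> ball 0 1" "inj_on b {1..n}"
    using on_segment_in_order_ball[OF seg] on_segment_in_order_inj[OF seg] by blast+
  have b\<sigma>: "(b \<circ> \<sigma>) ` {1..n} \<subseteq> ball 0 1" "inj_on (b \<circ> \<sigma>) {1..n}"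
    using b permutes_image[OF \<sigma>(1)] permutes_inj_on[OF \<sigma>(1)]
    by (auto simp: image_comp[symmetric] intro!: comp_inj_on)
  have Q\<sigma>: "Q \<circ> \<sigma> = base_config n p (b \<circ> \<sigma>)"
    using permutes_in_image[OF \<sigma>(1)] by (auto simp: Q_def base_config_def fun_eq_iff)
  obtain e where e: "\<And>i. continuous_on {0..1} (\<lambda>t::real. e t i)" "e 0 = b" "e 1 = b \<circ> \<sigma>"
    "\<And>t. t \<in> {0..1} \<Longrightarrow> e t ` {1..n} \<subseteq> ball 0 1 \<and> inj_on (e t) {1..n}"
    using configuration_path[OF _ open_ball convex_ball b b\<sigma>] by blast
  define \<gamma> where "\<gamma> t = base_config n p (e t)" for t
  have eb: "e t i \<in> ball 0 1" if "t \<in> {0..1}" "i \<in> {1..n}" for t i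
    using e(4)[OF that(1)] that(2) by blast
  have \<gamma>: "path_in F Q \<gamma> (Q \<circ> \<sigma>)"
    unfolding path_in_def
  proof (intro conjI)
    show "path \<gamma>"
      unfolding path_def \<gamma>_def using e(1) eb by (intro base_config_continuous) (auto simp: less_imp_le)
    have "base_config n p (e t) \<in> F" if "t \<in> {0..1}" for t
      unfolding F_def
    proof (rule base_config_mem)
      show "e t i \<in> cball 0 1" if "i \<in> {1..n}" for i
        using eb[OF \<open>t \<in> {0..1}\<close> that] by simp
      show "p (e t i) \<noteq> p (e t j)" if "i \<in> {1..n}" "j \<in> {1..n}" "i \<noteq> j" for i j
        using p_eq[OF eb[OF \<open>t \<in> {0..1}\<close> that(1)], of "e t j"] eb[OF \<open>t \<in> {0..1}\<close> that(2)]
          e(4)[OF \<open>t \<in> {0..1}\<close>] inj_onD[of "e t" "{1..n}" i j] that by auto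
    qed
    then show "path_image \<gamma> \<subseteq> F"
      unfolding path_image_def \<gamma>_def by blast
    show "pathstart \<gamma> = Q" "pathfinish \<gamma> = Q \<circ> \<sigma>"
      unfolding Q\<sigma> by (simp_all add: pathstart_def pathfinish_def \<gamma>_def e(2,3) Q_def)
  qed
  have mem: "(\<lambda>x. x \<circ> \<sigma>) \<in> F \<rightarrow> F" "(\<lambda>x. x \<circ> \<tau>) \<in> F \<rightarrow> F"
    using config_space_reindex[OF \<sigma>(1)] config_space_reindex[OF \<tau>] by (auto simp: F_def)
  have inv: "x \<circ> \<sigma> \<circ> \<tau> = x" "x \<circ> \<tau> \<circ> \<sigma> = x" for x :: "nat \<Rightarrow> 'a"
    using \<sigma>(2,3) by (simp_all add: o_assoc[symmetric])
  obtain \<phi> where \<phi>: "\<phi> \<in> auto P"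
    "\<And>c. c \<in> loops_at F Q \<Longrightarrow> \<phi> (path_class F c) = path_class F (\<gamma> +++ (((\<lambda>x. x \<circ> \<sigma>) \<circ> c) +++ reversepath \<gamma>))"
    using fundamental_group_auto[OF continuous_on_reindex mem(1) continuous_on_reindex mem(2) inv \<gamma>]
    unfolding P by blast
  have rho_loop: "\<exists>\<alpha> \<beta> t. \<rho> i r = path_class F (move b i \<circ> (\<alpha> +++ \<beta>)) \<and> move b i \<circ> (\<alpha> +++ \<beta>) \<in> loops_at F Q \<and>
      t \<in> {0..1} \<and> path_in (cball 0 1 - b ` ({1..n} - {i})) (b i) \<alpha> (leave_point orientable g out r t) \<and>
      path_in (cball 0 1 - b ` ({1..n} - {i})) (enter_point orientable g out r t) \<beta> (b i)"
    if i: "i \<in> {1..n}" and r: "r \<in> {1..num_labels orientable g}" for i r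
  proof -
    obtain c where c: "\<rho> i r = path_class F (\<lambda>t. Q(i := c t))" "edge_loop orientable g n p b out i r c"
      using rho[OF i r] unfolding rho_braids_def F_def Q_def by blast
    obtain \<alpha> \<beta> t where *: "c = p \<circ> (\<alpha> +++ \<beta>)" "t \<in> {0..1}"
      "path_in (cball 0 1 - b ` ({1..n} - {i})) (b i) \<alpha> (leave_point orientable g out r t)"
      "path_in (cball 0 1 - b ` ({1..n} - {i})) (enter_point orientable g out r t) \<beta> (b i)"
      using edge_loop_paths[OF b(1) c(2)] by blast
    have mv: "(\<lambda>t. Q(i := c t)) = move b i \<circ> (\<alpha> +++ \<beta>)"
      using i by (auto simp: fun_eq_iff *(1) move_def Q_def base_config_def)
    \<comment> \<open>That the chosen representative is a loop at \<open>Q\<close> is read off from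
      its class: it is homotopic to some loop \<open>d\<close> at \<open>Q\<close>.\<close>
    have "\<rho> i r \<in> carrier P"
      using rho_braids_in_carrier[OF M seg i r, of out] rho[OF i r] unfolding P_def Q_def by blast
    then obtain d where d: "d \<in> loops_at F Q" "\<rho> i r = path_class F d"
      unfolding P fundamental_group_def by auto
    have "path_class F d = path_class F (move b i \<circ> (\<alpha> +++ \<beta>))"
      using c(1) d(2) unfolding mv by simp
    then have "homotopic_paths F d (move b i \<circ> (\<alpha> +++ \<beta>))"
      using d(1) path_class_eq_iff[of d F "move b i \<circ> (\<alpha> +++ \<beta>)"] by (auto simp: loops_at_def)
    note h = this
    have "move b i \<circ> (\<alpha> +++ \<beta>) \<in> loops_at F Q"
      using d(1) homotopic_paths_imp_path[OF h] homotopic_paths_imp_subset[OF h]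
        homotopic_paths_imp_pathstart[OF h] homotopic_paths_imp_pathfinish[OF h]
      by (simp add: loops_at_def)
    then show ?thesis
      using c(1) * unfolding mv by blast
  qed
  have "ab_map P \<phi> (ab_class P (\<rho> i r)) = ab_class P (\<rho> (\<tau> i) r)"
    if i: "i \<in> {1..n}" and r: "r \<in> {1..num_labels orientable g}" for i r
  proof -
    define k where "k = \<tau> i"
    have k: "k \<in> {1..n}" "\<sigma> k = i"
      using permutes_in_image[OF \<tau>] i \<sigma>(3) by (auto simp: k_def fun_eq_iff)
    obtain \<alpha> \<beta> t where A: "\<rho> i r = path_class F (move b i \<circ> (\<alpha> +++ \<beta>))" "move b i \<circ> (\<alpha> +++ \<beta>) \<in> loops_at F Q"
      "t \<in> {0..1}" "path_in (cball 0 1 - b ` ({1..n} - {i})) (b i) \<alpha> (leave_point orientable g out r t)"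
      "path_in (cball 0 1 - b ` ({1..n} - {i})) (enter_point orientable g out r t) \<beta> (b i)"
      using rho_loop[OF i r] by blast
    obtain \<alpha>' \<beta>' t' where B: "\<rho> k r = path_class F (move b k \<circ> (\<alpha>' +++ \<beta>'))" "move b k \<circ> (\<alpha>' +++ \<beta>') \<in> loops_at F Q"
      "t' \<in> {0..1}" "path_in (cball 0 1 - b ` ({1..n} - {k})) (b k) \<alpha>' (leave_point orientable g out r t')"
      "path_in (cball 0 1 - b ` ({1..n} - {k})) (enter_point orientable g out r t') \<beta>' (b k)"
      using rho_loop[OF k(1) r] by blast
    define c where "c = move b i \<circ> (\<alpha> +++ \<beta>)"
    have \<sigma>_iff: "\<sigma> l = i \<longleftrightarrow> l = k" for l
      using k(2) permutes_inj[OF \<sigma>(1)] by (auto dest: injD)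
    \<comment> \<open>After reindexing it is string \<open>k\<close> that follows
      \<open>\<alpha> +++ \<beta>\<close>, from its new position
      \<open>(b \<circ> \<sigma>) k = b i\<close>; the other strings occupy the same points of the
      disc under new indices.\<close>
    have c\<sigma>: "(\<lambda>x. x \<circ> \<sigma>) \<circ> c = move (b \<circ> \<sigma>) k \<circ> (\<alpha> +++ \<beta>)"
      using permutes_in_image[OF \<sigma>(1)] by (auto simp: c_def fun_eq_iff move_def base_config_def \<sigma>_iff)
    have image: "(b \<circ> \<sigma>) ` rest k = b ` ({1..n} - {i})"
    proof -
      have "\<sigma> ` ({1..n} - {k}) = {1..n} - {i}"
        using image_set_diff[OF permutes_inj[OF \<sigma>(1)], of "{1..n}" "{k}"] permutes_image[OF \<sigma>(1)] k(2) by simp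
      then show ?thesis
        by (simp only: rest_def image_comp[symmetric])
    qed
    \<comment> \<open>The two loops of string \<open>k\<close> cross the same edge in the same
      direction but differ in base point, path and resting points.\<close>
    have "val (move (b \<circ> \<sigma>) k \<circ> (\<alpha> +++ \<beta>)) = val (move b k \<circ> (\<alpha>' +++ \<beta>'))"
    proof (rule val_edge_loop_eq[OF k(1)])
      show "(b \<circ> \<sigma>) ` rest k \<subseteq> ball 0 1" "b ` rest k \<subseteq> ball 0 1"
        using b\<sigma>(1) b(1) by (auto simp: rest_def)
      show "inj_on (b \<circ> \<sigma>) (rest k)" "inj_on b (rest k)"
        using b\<sigma>(2) b(2) by (auto simp: rest_def intro: inj_on_subset)
      show "leave_point orientable g out r ` {0..1} \<subseteq> sphere 0 1" "enter_point orientable g out r ` {0..1} \<subseteq> sphere 0 1"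
        by (auto simp: norm_leave_enter)
      show "p (leave_point orientable g out r s) = p (enter_point orientable g out r s)" if "s \<in> {0..1}" for s
        using leave_enter_glued[OF M r that] .
      show "path_in (cball 0 1 - (b \<circ> \<sigma>) ` rest k) (b i) \<alpha> (leave_point orientable g out r t)"
        "path_in (cball 0 1 - (b \<circ> \<sigma>) ` rest k) (enter_point orientable g out r t) \<beta> (b i)"
        unfolding image by (rule A)+
      show "path_in (cball 0 1 - b ` rest k) (b k) \<alpha>' (leave_point orientable g out r t')"
        "path_in (cball 0 1 - b ` rest k) (enter_point orientable g out r t') \<beta>' (b k)"
        unfolding rest_def by (rule B)+
    qed (rule continuous_on_leave_enter A(3) B(3))+
    then have eq: "val ((\<lambda>x. x \<circ> \<sigma>) \<circ> c) = ab_class P (\<rho> k r)"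
      unfolding c\<sigma> B(1) using val(2)[OF B(2)] by simp
    have cl: "path_in F Q c Q"
      using A(2) by (simp add: c_def path_in_loop)
    have c': "path_in F (Q \<circ> \<sigma>) ((\<lambda>x. x \<circ> \<sigma>) \<circ> c) (Q \<circ> \<sigma>)"
      by (rule path_in_compose[OF cl continuous_on_reindex mem(1)])
    define conj where "conj = \<gamma> +++ (((\<lambda>x. x \<circ> \<sigma>) \<circ> c) +++ reversepath \<gamma>)"
    have conj: "conj \<in> loops_at F Q"
      unfolding conj_def path_in_loop by (rule path_in_join[OF \<gamma> path_in_join[OF c' path_in_reverse[OF \<gamma>]]])
    have "ab_map P \<phi> (ab_class P (\<rho> i r)) = ab_class P (\<phi> (\<rho> i r))"
      using G.ab_map_ab_class[OF \<phi>(1)] A(1,2) by (simp add: P fundamental_group_def)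
    also have "\<phi> (\<rho> i r) = path_class F conj"
      unfolding A(1) conj_def c_def by (rule \<phi>(2)[OF A(2)])
    also have "ab_class P (path_class F conj) = val conj"
      by (rule val(2)[OF conj, symmetric])
    also have "\<dots> = val ((\<lambda>x. x \<circ> \<sigma>) \<circ> c)"
      unfolding conj_def F_def[symmetric]
      by (rule val_conjugate[OF \<gamma>[unfolded F_def] c'[unfolded F_def]])
    finally show ?thesis
      using eq by (simp add: k_def)
  qed
  then show ?thesis
    using \<phi>(1) unfolding P_def[unfolded Q_def, symmetric] Let_def by blast
qed

end
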